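(* Let $\Theta\subseteq\mathbb R$, let $\{P_\theta\}_{\theta\in\Theta}$ be a family of probability distributions on $\mathbb R^d$, each absolutely continuous with respect to a $\sigma$-finite measure $\mu$, with densities $p_\theta=dP_\theta/d\mu$, and let $\ell_x(\theta)=\log p_\theta(x)$. Let $\theta_\ast\in\Theta$ and let $X_1,\dots,X_N$ be i.i.d. copies of $X\sim P_{\theta_\ast}$. Assume (derivatives $'$ are with respect to $\theta$): (1) $[\theta_\ast-\delta,\theta_\ast+\delta]\subseteq\Theta$ for some $\delta>0$; (2) $\mathbb E\ell_X'(\theta_\ast)=0$, and the Fisher information $I(\theta_\ast):=\mathbb E\ell_X'(\theta_\ast)^2=-\mathbb E\ell_X''(\theta_\ast)$ is finite (and positive); (3) $\mathbb E|\ell_X'(\theta_\ast)|^3+\mathbb E|\ell_X''(\theta_\ast)|^3<\infty$; (4) for $\mu$-almost all $x$, $\ell_x(\theta)$ is three times differentiable for $\theta\in[\theta_\ast-\delta,\theta_\ast+\delta]$, and $\mathbb E\sup_{|\theta-\theta_\ast|\le\delta}|\ell_X'''(\theta)|^3<\infty$; (5) there are constants $c>0$ and $\gamma\in[0,1)$ such that the maximum likelihood estimator $\bar\theta$ of $\theta_\ast$ based on $n$ i.i.d. observations from $P_{\theta_\ast}$ satisfies $\mathbb P(|\bar\theta-\theta_\ast|\ge\delta)\le c\gamma^n$. Let the sample be partitioned (independently of the data) into $k$ disjoint groups $G_1,\dots,G_k$ with $\mathrm{card}(G_j)\ge n=\lfloor N/k\rfloor$ for $j=1,\dots,k$, let $\bar\theta_j$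 be the maximum likelihood estimator of $\theta_\ast$ based on the observations in $G_j$, and let $\widehat\theta^{(k)}=\mathrm{med}(\bar\theta_1,\dots,\bar\theta_k)$. Then there is a positive constant $\mathfrak C$, depending only on $\{P_\theta\}_{\theta\in[\theta_\ast-\delta,\theta_\ast+\delta]}$, such that for all $s>0$ with $\frac{\mathfrak C}{\sqrt n}+c\gamma^n+\sqrt{\frac sk}\le0.33$, $$\big|\widehat\theta^{(k)}-\theta_\ast\big|\le\frac{3}{\sqrt{I(\theta_\ast)}}\left(\frac{\mathfrak C}{n}+\frac{c}{\sqrt n}\gamma^n+\sqrt{\frac{s}{kn}}\right)$$ with probability at least $1-4e^{-2s}$.
   Context: $\mathrm{med}(\cdot)$ is the usual univariate sample median. The maximum likelihood estimator based on observations $x_1,\dots,x_r$ is a (measurable) maximizer over $\theta\in\Theta$ of $\sum_{i=1}^r\ell_{x_i}(\theta)$.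
   Formalization: The formal theorem additionally assumes that θ* is identifiable in [θ*−δ, θ*+δ] (P_θ = P_θ* there forces θ = θ* ); without this the claim fails, e.g. for N(sin πθ, 1) with θ* = 0, δ = 1.5 and a maximum likelihood estimator tending to 1. *)

theory Defs
  imports "HOL-Probability.Probability"
begin

text \<open>
  The two middle indices coincide for lists of odd length.
\<close>
definition median :: "real list \<Rightarrow> real" where
  "median xs = (let ys = sort xs; m = length xs
                in (ys ! ((m - 1) div 2) + ys ! (m div 2)) / 2)"

text \<open>
  The log-likelihood takes values in \<^typ>\<open>ereal\<close> because \<^prop>\<open>ln 0 = (0::real)\<close> in the library,
  whereas maximum likelihood needs $\log 0 = -\infty$.
\<close>
definition loglik :: "(real \<Rightarrow> 'a \<Rightarrow> real) \<Rightarrow> 'a \<Rightarrow> real \<Rightarrow> ereal" where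
  "loglik p x \<theta> = (if p \<theta> x = 0 then -\<infinity> else ereal (ln (p \<theta> x)))"

text \<open>
  Derivatives relative to a closed interval, so that they are one-sided at its end points;
  the parameter set need not extend beyond the interval.
\<close>
definition deriv_within :: "real set \<Rightarrow> (real \<Rightarrow> real) \<Rightarrow> real \<Rightarrow> real" where
  "deriv_within S f = (\<lambda>t. vector_derivative f (at t within S))"

definition dloglik :: "real set \<Rightarrow> (real \<Rightarrow> 'a \<Rightarrow> real) \<Rightarrow> nat \<Rightarrow> 'a \<Rightarrow> real \<Rightarrow> real" where
  "dloglik S p m x = (deriv_within S ^^ m) (\<lambda>\<theta>. real_of_ereal (loglik p x \<theta>))"

definition thrice_differentiable_on :: "(real \<Rightarrow> real) \<Rightarrow> real set \<Rightarrow> bool"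
    (infix "thrice'_differentiable'_on" 50) where
  "f thrice_differentiable_on S \<longleftrightarrow> (\<forall>m<3. (deriv_within S ^^ m) f differentiable_on S)"

locale dominated_family =
  fixes \<Theta> :: "real set"
    and \<mu> :: "(real^'d) measure"
    and P :: "real \<Rightarrow> (real^'d) measure"
    and p :: "real \<Rightarrow> real^'d \<Rightarrow> real"
  assumes sigma_finite: "sigma_finite_measure \<mu>"
    and sets_mu: "sets \<mu> = sets borel"
    and prob: "\<theta> \<in> \<Theta> \<Longrightarrow> prob_space (P \<theta>)"
    and p_measurable: "\<theta> \<in> \<Theta> \<Longrightarrow> p \<theta> \<in> borel_measurable borel"
    and p_nonneg: "\<theta> \<in> \<Theta> \<Longrightarrow> 0 \<le> p \<theta> x"
    and density: "\<theta> \<in> \<Theta> \<Longrightarrow> P \<theta> = density \<mu> (\<lambda>x. ennreal (p \<theta> x))"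

text \<open>
  The derivatives of the log-likelihood exist only almost everywhere and may be
  arbitrary on a null set. Their moments are therefore taken with respect to the completion
  of $P_\theta$, so that no Borel measurability on that null set is demanded.
\<close>
definition fisher_info ::
    "real set \<Rightarrow> (real \<Rightarrow> 'a measure) \<Rightarrow> (real \<Rightarrow> 'a \<Rightarrow> real) \<Rightarrow> real \<Rightarrow> real" where
  "fisher_info S P p \<theta> = (\<integral>x. (dloglik S p 1 x \<theta>)\<^sup>2 \<partial>completion (P \<theta>))"

locale regular_family = dominated_family \<Theta> \<mu> P p
  for \<Theta> :: "real set"
    and \<mu> :: "(real^'d) measure"
    and P :: "real \<Rightarrow> (real^'d) measure"
    and p :: "real \<Rightarrow> real^'d \<Rightarrow> real" +
  fixes \<theta>s \<delta> :: real
  assumes \<delta>_pos: "\<delta> > 0"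
    and interval: "{\<theta>s - \<delta>..\<theta>s + \<delta>} \<subseteq> \<Theta>"
    and score_integrable:
      "integrable (completion (P \<theta>s)) (\<lambda>x. dloglik {\<theta>s - \<delta>..\<theta>s + \<delta>} p 1 x \<theta>s)"
    and score_mean:
      "(\<integral>x. dloglik {\<theta>s - \<delta>..\<theta>s + \<delta>} p 1 x \<theta>s \<partial>completion (P \<theta>s)) = 0"
    and score_sq_integrable:
      "integrable (completion (P \<theta>s)) (\<lambda>x. (dloglik {\<theta>s - \<delta>..\<theta>s + \<delta>} p 1 x \<theta>s)\<^sup>2)"
    and d2_integrable:
      "integrable (completion (P \<theta>s)) (\<lambda>x. dloglik {\<theta>s - \<delta>..\<theta>s + \<delta>} p 2 x \<theta>s)"
    and fisher_info_eq:
      "fisher_info {\<theta>s - \<delta>..\<theta>s + \<delta>} P p \<theta>s =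
         - (\<integral>x. dloglik {\<theta>s - \<delta>..\<theta>s + \<delta>} p 2 x \<theta>s \<partial>completion (P \<theta>s))"
    and fisher_info_pos: "fisher_info {\<theta>s - \<delta>..\<theta>s + \<delta>} P p \<theta>s > 0"
    and score_third_moment:
      "integrable (completion (P \<theta>s)) (\<lambda>x. \<bar>dloglik {\<theta>s - \<delta>..\<theta>s + \<delta>} p 1 x \<theta>s\<bar> ^ 3)"
    and d2_third_moment:
      "integrable (completion (P \<theta>s)) (\<lambda>x. \<bar>dloglik {\<theta>s - \<delta>..\<theta>s + \<delta>} p 2 x \<theta>s\<bar> ^ 3)"
    and loglik_smooth:
      "AE x in \<mu>. (\<forall>\<theta>\<in>{\<theta>s - \<delta>..\<theta>s + \<delta>}. \<bar>loglik p x \<theta>\<bar> \<noteq> \<infinity>) \<and>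
         (\<lambda>\<theta>. real_of_ereal (loglik p x \<theta>)) thrice_differentiable_on {\<theta>s - \<delta>..\<theta>s + \<delta>}"
    and d3_third_moment:
      "(\<integral>\<^sup>+x. (SUP \<theta>\<in>{\<theta>s - \<delta>..\<theta>s + \<delta>}.
          ennreal (\<bar>dloglik {\<theta>s - \<delta>..\<theta>s + \<delta>} p 3 x \<theta>\<bar> ^ 3)) \<partial>completion (P \<theta>s)) < \<infinity>"

text \<open>
  Observations are indexed by a finite set \<open>I\<close>, with joint law the product of \<open>card I\<close>
  copies of \<open>Q\<close>. Since densities are determined only up to null sets, the maximum property is
  required almost surely.
\<close>
definition is_mle ::
    "real set \<Rightarrow> (real \<Rightarrow> 'a::topological_space \<Rightarrow> real) \<Rightarrow> 'a measure \<Rightarrow> nat set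
      \<Rightarrow> ((nat \<Rightarrow> 'a) \<Rightarrow> real) \<Rightarrow> bool" where
  "is_mle \<Theta> p Q I T \<longleftrightarrow>
     T \<in> borel_measurable (Pi\<^sub>M I (\<lambda>_. borel)) \<and>
     (AE x in Pi\<^sub>M I (\<lambda>_. Q).
        is_arg_max (\<lambda>\<theta>. \<Sum>i\<in>I. loglik p (x i) \<theta>) (\<lambda>\<theta>. \<theta> \<in> \<Theta>) (T x))"

definition sample_partition :: "nat \<Rightarrow> nat \<Rightarrow> (nat \<Rightarrow> nat set) \<Rightarrow> bool" where
  "sample_partition N k G \<longleftrightarrow>
     disjoint_family_on G {..<k} \<and> (\<Union>j<k. G j) = {..<N} \<and> (\<forall>j<k. N div k \<le> card (G j))"

definition median_mle ::
    "(nat set \<Rightarrow> (nat \<Rightarrow> 'a) \<Rightarrow> real) \<Rightarrow> nat \<Rightarrow> (nat \<Rightarrow> nat set) \<Rightarrow> (nat \<Rightarrow> 'a) \<Rightarrow> real" where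
  "median_mle mle k G x = median (map (\<lambda>j. mle (G j) (restrict x (G j))) [0..<k])"

text \<open>
  Joint law of an i.i.d. sample of size \<open>N\<close> and a random partition independent of it.
  A deterministic partition is the case \<open>\<rho> = return_pmf G\<close>.
\<close>
definition sample_space ::
    "nat \<Rightarrow> 'a measure \<Rightarrow> (nat \<Rightarrow> nat set) pmf \<Rightarrow> ((nat \<Rightarrow> 'a) \<times> (nat \<Rightarrow> nat set)) measure" where
  "sample_space N Q \<rho> = Pi\<^sub>M {..<N} (\<lambda>_. Q) \<Otimes>\<^sub>M measure_pmf \<rho>"

end

theory Submission
  imports Defs
begin

text \<open>
  The estimators of the groups are independent, so by Hoeffding's inequality the median leaves
  \<open>[\<theta>s - t, \<theta>s + t]\<close> with probability at most \<open>2 exp (- 2 k v\<^sup>2)\<close> as soon as each of them exceeds either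
  end point with probability at most \<open>1/2 - v\<close>. Take \<open>v = sqrt (s / k)\<close>.

  For one group, Wald's consistency argument first confines the estimator to a small neighbourhood
  of \<open>\<theta>s\<close>, up to probability \<open>O(1/n)\<close>. There the likelihood equation, expanded to second order with
  a Lipschitz constant \<open>m\<close> for the second derivative, shows that a deviation larger than \<open>t\<close> forces the
  i.i.d. sum of \<open>\<plusminus> Z + t U + t\<^sup>2 m\<close> to be nonnegative, where \<open>Z\<close> and \<open>U\<close> are the first two derivatives
  at \<open>\<theta>s\<close>. This sum is handled by the Berry--Esseen theorem, obtained by
  Esseen's smoothing with the Fejer kernel. The constants \<open>3\<close> and \<open>0.33\<close> enter through
  \<open>\<Phi>(3 u) - 1/2 \<ge> u\<close> for \<open>0 \<le> u \<le> 0.33\<close>.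

  All constants are chosen for one admissible presentation of the family; any other has
  almost surely the same log-likelihood increments.
\<close>

text \<open>Assumption (5) only keeps an estimator within \<open>\<delta>\<close> of
  \<open>\<theta>s\<close>; it does not exclude a competing maximum inside the interval. The
  hypothesis that no other parameter of the interval has the law \<open>P \<theta>s\<close> closes
  this gap: the Kullback-Leibler divergence is then positive there and, by compactness, bounded
  below away from \<open>\<theta>s\<close>. Only close to \<open>\<theta>s\<close> does the negative
  mean of \<open>U\<close> dominate the quadratic remainder. The Lipschitz constant \<open>m\<close>
  is random. Its third moment is finite, so the remainder can stay inside the i.i.d. sum and be
  treated by the normal approximation together with the score, uniformly in \<open>t\<close>. An
  additive error of order 1/sqrt n is affordable because it merely shifts the one-sided tail
  probability of a single group; the exponent in \<open>s\<close> is produced later, by the median.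
  The Fejer kernel suits the smoothing because it is nonnegative and integrable while its Fourier
  transform lives on [-1, 1]: characteristic functions need only be compared at bounded frequencies,
  where a Taylor expansion controls them.\<close>

section \<open>Smoothing with the Fejer kernel\<close>

text \<open>This is the square of sin(y/2)/(y/2), the Fourier transform of the triangle 1 -
  |\<zeta>| on [-1, 1]; the value at 0 is the limit.\<close>

definition fejer :: "real \<Rightarrow> real" where
  "fejer y = (if y = 0 then 1 else 2 * (1 - cos y) / y\<^sup>2)"

text \<open>The triangle is even, so only the cosine part of its Fourier transform survives.
  Splitting at 0 removes the absolute value, and \<open>G\<close> and \<open>H\<close> are
  antiderivatives found by integration by parts.\<close>

lemma has_integral_fejer:
  "((\<lambda>\<zeta>. (1 - \<bar>\<zeta>\<bar>) * cos (\<zeta> * y)) has_integral fejer y) {-1..1}"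
proof -
  define G where "G \<zeta> = (if y = 0 then \<zeta> - \<zeta>\<^sup>2 / 2 else (1 - \<zeta>) * sin (\<zeta> * y) / y - cos (\<zeta> * y) / y\<^sup>2)" for \<zeta>
  define H where "H \<zeta> = (if y = 0 then \<zeta> + \<zeta>\<^sup>2 / 2 else (1 + \<zeta>) * sin (\<zeta> * y) / y + cos (\<zeta> * y) / y\<^sup>2)" for \<zeta>
  have G: "(G has_real_derivative (1 - \<zeta>) * cos (\<zeta> * y)) (at \<zeta> within A)" for \<zeta> A
    unfolding G_def
    by (cases "y = 0") (auto intro!: derivative_eq_intros simp: field_simps power2_eq_square)
  have H: "(H has_real_derivative (1 + \<zeta>) * cos (\<zeta> * y)) (at \<zeta> within A)" for \<zeta> A
    unfolding H_def
    by (cases "y = 0") (auto intro!: derivative_eq_intros simp: field_simps power2_eq_square)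
  have 1: "((\<lambda>\<zeta>. (1 - \<zeta>) * cos (\<zeta> * y)) has_integral (G 1 - G 0)) {0..1}"
    using G by (intro fundamental_theorem_of_calculus)
      (auto simp: has_real_derivative_iff_has_vector_derivative)
  have 2: "((\<lambda>\<zeta>. (1 + \<zeta>) * cos (\<zeta> * y)) has_integral (H 0 - H (-1))) {-1..0}"
    using H by (intro fundamental_theorem_of_calculus)
      (auto simp: has_real_derivative_iff_has_vector_derivative)
  have e1: "((\<lambda>\<zeta>. (1 - \<bar>\<zeta>\<bar>) * cos (\<zeta> * y)) has_integral (G 1 - G 0)) {0..1}"
    using 1 by (rule has_integral_eq[rotated]) auto
  have e2: "((\<lambda>\<zeta>. (1 - \<bar>\<zeta>\<bar>) * cos (\<zeta> * y)) has_integral (H 0 - H (-1))) {-1..0}"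
    using 2 by (rule has_integral_eq[rotated]) auto
  have "((\<lambda>\<zeta>. (1 - \<bar>\<zeta>\<bar>) * cos (\<zeta> * y)) has_integral (H 0 - H (-1) + (G 1 - G 0))) {-1..1}"
    by (rule has_integral_combine[OF _ _ e2 e1]) auto
  moreover have "H 0 - H (-1) + (G 1 - G 0) = fejer y"
    by (auto simp: G_def H_def fejer_def field_simps)
  ultimately show ?thesis by simp
qed

lemma fejer_nonneg: "0 \<le> fejer y"
  by (auto simp: fejer_def)

lemma fejer_measurable [measurable]: "fejer \<in> borel_measurable borel"
  unfolding fejer_def[abs_def] by measurable

text \<open>Combines 1 - cos y \<le> y^2/2, good near 0, with 1 - cos y \<le> 2, good far out. The
  Cauchy-type majorant gives integrability.\<close>

lemma fejer_le: "fejer y \<le> 5 / (1 + y\<^sup>2)"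
proof (cases "y = 0")
  case False
  have c: "1 - cos y \<le> y\<^sup>2 / 2"
  proof -
    have "1 - cos y = 2 * (sin (y/2))\<^sup>2"
      using cos_double_sin[of "y/2"] by simp
    also have "(sin (y/2))\<^sup>2 \<le> (y/2)\<^sup>2"
      using abs_sin_x_le_abs_x[of "y/2"] by (simp only: abs_le_square_iff)
    finally show ?thesis by (simp add: power_divide)
  qed
  have c2: "1 - cos y \<le> 2" using cos_ge_minus_one[of y] by linarith
  have "2 * (1 - cos y) * (1 + y\<^sup>2) \<le> 5 * y\<^sup>2"
  proof -
    have "(1 - cos y) * y\<^sup>2 \<le> 2 * y\<^sup>2" using c2 by (intro mult_right_mono) auto
    then have "2 * (1 - cos y) * (1 + y\<^sup>2) \<le> 2 * (1 - cos y) + 4 * y\<^sup>2"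
      by (simp add: algebra_simps)
    also have "\<dots> \<le> 5 * y\<^sup>2" using c by simp
    finally show ?thesis .
  qed
  then show ?thesis using False
    by (simp add: fejer_def divide_simps add_pos_nonneg)
qed (simp add: fejer_def)

lemma integrable_fejer: "integrable lborel fejer"
proof -
  have "integrable lborel (\<lambda>y::real. 5 * inverse (1 + y\<^sup>2))"
    using integrable_inverse_1_plus_square by (simp add: set_integrable_def)
  then show ?thesis
    by (rule Bochner_Integration.integrable_bound)
      (use fejer_le fejer_nonneg in \<open>auto simp: divide_inverse\<close>)
qed

text \<open>A nonnegative function with zero integral vanishes almost everywhere, but the kernel is
  positive on (0, 1). The smoothing inequality divides by this mass.\<close>

lemma fejer_mass_pos: "0 < (\<integral>y. fejer y \<partial>lborel)"
proof -
  have "(\<integral>y. fejer y \<partial>lborel) \<noteq> 0"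
  proof
    assume "(\<integral>y. fejer y \<partial>lborel) = 0"
    then have "AE y in lborel. fejer y = 0"
      using integral_nonneg_eq_0_iff_AE[OF integrable_fejer] fejer_nonneg by simp
    moreover have "fejer y \<noteq> 0" if "0 < y" "y < 1" for y
    proof -
      have "cos y < cos 0" using that pi_gt3 by (intro cos_monotone_0_pi) auto
      then show ?thesis using that by (simp add: fejer_def)
    qed
    ultimately have "AE y in lborel. \<not> (0 < y \<and> y < (1::real))" by (auto elim: eventually_mono)
    then have "AE y in lborel. y \<notin> {0<..<1::real}" by simp
    then have "{0<..<1::real} \<in> null_sets lborel"
      by (subst AE_iff_null_sets) auto
    then have "emeasure lborel {0<..<1::real} = 0" by blast
    then show False by simp
  qed
  then show ?thesis using fejer_nonneg by (simp add: integral_nonneg_AE order_less_le)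
qed

text \<open>A smoothed step function whose expectation only sees frequencies in \<open>[-1, 1]\<close>.\<close>

definition fejer_prim :: "real \<Rightarrow> real" where
  "fejer_prim u = integral {-1..1} (\<lambda>\<zeta>. (1 - \<bar>\<zeta>\<bar>) * (u * sinc (\<zeta> * u)))"

text \<open>Written with \<open>sinc\<close>, the integrand sin(\<zeta> u)/\<zeta> extends
  continuously across \<zeta> = 0, so differentiation under the integral applies and yields the
  cosine integral of \<open>has_integral_fejer\<close>.\<close>

lemma fejer_prim_deriv: "(fejer_prim has_real_derivative fejer u) (at u)"
proof -
  have "((\<lambda>u. integral (cbox (-1) 1) ((\<lambda>u \<zeta>. (1 - \<bar>\<zeta>\<bar>) * (u * sinc (\<zeta> * u))) u)) has_real_derivative
     integral (cbox (-1) 1) ((\<lambda>u \<zeta>. (1 - \<bar>\<zeta>\<bar>) * cos (\<zeta> * u)) u)) (at u within UNIV)"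
  proof (rule leibniz_rule_field_derivative)
    fix u \<zeta> :: real
    have eq: "(\<lambda>u. (1 - \<bar>\<zeta>\<bar>) * (u * sinc (\<zeta> * u))) = (\<lambda>u. (1 - \<bar>\<zeta>\<bar>) * (if \<zeta> = 0 then u else sin (\<zeta> * u) / \<zeta>))"
      by (auto simp: fun_eq_iff)
    show "((\<lambda>u. (1 - \<bar>\<zeta>\<bar>) * (u * sinc (\<zeta> * u))) has_real_derivative (1 - \<bar>\<zeta>\<bar>) * cos (\<zeta> * u)) (at u within UNIV)"
      unfolding eq by (cases "\<zeta> = 0") (auto intro!: derivative_eq_intros)
    show "(\<lambda>\<zeta>. (1 - \<bar>\<zeta>\<bar>) * (u * sinc (\<zeta> * u))) integrable_on cbox (-1) 1"
      by (intro integrable_continuous continuous_intros)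
  next
    show "continuous_on (UNIV \<times> cbox (- 1) 1) (\<lambda>(x::real, t). (1 - \<bar>t\<bar>) * cos (t * x))"
      by (auto simp: split_beta intro!: continuous_intros)
  qed auto
  then show ?thesis
    using integral_unique[OF has_integral_fejer[of u]] by (simp add: fejer_prim_def[abs_def])
qed

lemma fejer_prim_0: "fejer_prim 0 = 0"
  by (simp add: fejer_prim_def)

text \<open>The difference of two half-line indicators encodes the oriented integral from 0 to
  \<open>u\<close> for either sign of \<open>u\<close>. In this form, averaging over u = x - w turns
  the first indicator into a distribution function.\<close>

lemma fejer_prim_eq:
  "fejer_prim u = (\<integral>y. fejer y * (indicator {..u} y - indicator {..0} y) \<partial>lborel)"
proof -
  have FTC: "set_lebesgue_integral lborel {a..b} fejer = fejer_prim b - fejer_prim a" if "a \<le> b" for a b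
  proof -
    have "(fejer has_integral (fejer_prim b - fejer_prim a)) {a..b}"
      using that fejer_prim_deriv
      by (intro fundamental_theorem_of_calculus)
         (auto simp: has_real_derivative_iff_has_vector_derivative[symmetric] intro: has_field_derivative_at_within)
    moreover have "set_integrable lborel {a..b} fejer"
      using integrable_fejer unfolding set_integrable_def by (intro integrable_mult_indicator) auto
    ultimately show ?thesis
      using set_borel_integral_eq_integral(2) integral_unique by metis
  qed
  show ?thesis
  proof (cases "0 \<le> u")
    case True
    have "fejer_prim u = (\<integral>y. indicator {0..u} y *\<^sub>R fejer y \<partial>lborel)"
      using FTC[OF True] by (simp add: fejer_prim_0 set_lebesgue_integral_def)
    also have "\<dots> = (\<integral>y. fejer y * (indicator {..u} y - indicator {..0} y) \<partial>lborel)"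
    proof (rule integral_cong_AE)
      show "AE y in lborel. indicator {0..u} y *\<^sub>R fejer y = fejer y * (indicator {..u} y - indicator {..0} y)"
        using AE_lborel_singleton[of "0::real"] by eventually_elim (use True in \<open>auto simp: indicator_def\<close>)
    qed auto
    finally show ?thesis .
  next
    case False
    have "- fejer_prim u = (\<integral>y. indicator {u..0} y *\<^sub>R fejer y \<partial>lborel)"
      using FTC[of u 0] False by (simp add: fejer_prim_0 set_lebesgue_integral_def)
    also have "\<dots> = (\<integral>y. - (fejer y * (indicator {..u} y - indicator {..0} y)) \<partial>lborel)"
    proof (rule integral_cong_AE)
      show "AE y in lborel. indicator {u..0} y *\<^sub>R fejer y = - (fejer y * (indicator {..u} y - indicator {..0} y))"
        using AE_lborel_singleton[of u] by eventually_elim (use False in \<open>auto simp: indicator_def\<close>)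
    qed auto
    finally show ?thesis by simp
  qed
qed

lemma fejer_prim_eq_set:
  "fejer_prim u = (LINT \<zeta>:{-1..1}|lborel. (1 - \<bar>\<zeta>\<bar>) * (u * sinc (\<zeta> * u)))"
  unfolding fejer_prim_def
  by (subst set_borel_integral_eq_integral(2))
     (intro borel_integrable_atLeastAtMost' continuous_intros, rule refl)

lemma fejer_prim_measurable [measurable]: "fejer_prim \<in> borel_measurable borel"
  using fejer_prim_deriv
  by (intro borel_measurable_continuous_onI) (auto intro!: DERIV_isCont continuous_at_imp_continuous_on)

text \<open>By Fubini, the average over \<open>w\<close> of the indicator of y \<le> x - w is the
  distribution function at x - y. The remaining indicator does not depend on \<open>M\<close> and
  cancels when two distributions are compared.\<close>

lemma (in real_distribution) integral_fejer_prim_cdf: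
  "(\<integral>w. fejer_prim (x - w) \<partial>M) = (\<integral>y. fejer y * (cdf M (x - y) - indicator {..0} y) \<partial>lborel)"
proof -
  interpret P: pair_sigma_finite lborel M ..
  have int: "integrable (lborel \<Otimes>\<^sub>M M) (\<lambda>(y, w). fejer y * (indicator {..x - w} y - indicator {..0} y))"
  proof (rule Bochner_Integration.integrable_bound)
    show "integrable (lborel \<Otimes>\<^sub>M M) (\<lambda>(y, w). fejer y)"
    proof (rule P.Fubini_integrable)
      show "(\<lambda>(y, w). fejer y) \<in> borel_measurable (lborel \<Otimes>\<^sub>M M)" by measurable
      show "integrable lborel (\<lambda>x. \<integral>y. norm (case (x, y) of (y, w) \<Rightarrow> fejer y) \<partial>M)"
        using integrable_fejer by (simp add: prob_space del: space_eq_univ)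
      show "AE xa in lborel. integrable M (\<lambda>y. case (xa, y) of (y, w) \<Rightarrow> fejer y)" by simp
    qed
    have [measurable]: "Measurable.pred (lborel \<Otimes>\<^sub>M M) (\<lambda>(y, w). y \<le> x - w)"
      by measurable
    have "(\<lambda>z. fejer (fst z) * ((if fst z \<le> x - snd z then 1 else 0) - indicator {..0} (fst z))) \<in> borel_measurable (lborel \<Otimes>\<^sub>M M)"
      by measurable
    then show "(\<lambda>(y, w). fejer y * (indicator {..x - w} y - indicator {..0} y)) \<in> borel_measurable (lborel \<Otimes>\<^sub>M M)"
      by (simp add: split_beta indicator_def of_bool_def cong: if_cong)
    show "AE z in lborel \<Otimes>\<^sub>M M. norm (case z of (y, w) \<Rightarrow> fejer y * (indicator {..x - w} y - indicator {..0} y))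
       \<le> norm (case z of (y, w) \<Rightarrow> fejer y)"
      by (intro AE_I2) (auto simp: indicator_def split: prod.splits)
  qed
  have "(\<integral>w. fejer_prim (x - w) \<partial>M) = (\<integral>w. (\<integral>y. fejer y * (indicator {..x - w} y - indicator {..0} y) \<partial>lborel) \<partial>M)"
    by (simp add: fejer_prim_eq)
  also have "\<dots> = (\<integral>y. (\<integral>w. fejer y * (indicator {..x - w} y - indicator {..0} y) \<partial>M) \<partial>lborel)"
    using P.Fubini_integral[OF int] by simp
  also have "\<dots> = (\<integral>y. fejer y * (cdf M (x - y) - indicator {..0} y) \<partial>lborel)"
  proof (rule Bochner_Integration.integral_cong[OF refl])
    fix y
    have "(indicator {..x - w} y :: real) = indicator {..x - y} w" for w
      by (auto simp: indicator_def)
    then have "(\<integral>w. fejer y * (indicator {..x - w} y - indicator {..0} y) \<partial>M)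
        = (\<integral>w. fejer y * (indicator {..x - y} w - indicator {..0} y) \<partial>M)" by simp
    also have "\<dots> = fejer y * ((\<integral>w. indicator {..x - y} w \<partial>M) - indicator {..0} y)"
      by (subst integral_mult_right_zero, subst Bochner_Integration.integral_diff)
         (auto simp: prob_space emeasure_eq_measure simp del: space_eq_univ)
    finally show "(\<integral>w. fejer y * (indicator {..x - w} y - indicator {..0} y) \<partial>M) =
       fejer y * (cdf M (x - y) - indicator {..0} y)"
      by (simp add: cdf_def)
  qed
  finally show ?thesis .
qed

text \<open>The same average on the frequency side: the mean of sin(\<zeta>(x - w)) is the imaginary
  part of exp(i \<zeta> x) times the conjugate characteristic function. Since |\<open>sinc\<close>|
  \<le> 1, the integrand is dominated by |x - w|, so a finite first moment permits Fubini in spite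
  of the division by \<zeta>.\<close>

lemma (in real_distribution) integral_fejer_prim_char:
  assumes int: "integrable M (\<lambda>w. w)"
  shows "set_integrable lborel {-1..1} (\<lambda>\<zeta>. (1 - \<bar>\<zeta>\<bar>) * (Im (iexp (\<zeta> * x) * cnj (char M \<zeta>)) / \<zeta>))"
    and "(\<integral>w. fejer_prim (x - w) \<partial>M) =
    (LINT \<zeta>:{-1..1}|lborel. (1 - \<bar>\<zeta>\<bar>) * (Im (iexp (\<zeta> * x) * cnj (char M \<zeta>)) / \<zeta>))"
proof -
  interpret P: pair_sigma_finite lborel M ..
  let ?f = "\<lambda>\<zeta> w. indicator {-1..1} \<zeta> *\<^sub>R ((1 - \<bar>\<zeta>\<bar>) * ((x - w) * sinc (\<zeta> * (x - w))))"
  have sinc_le: "\<bar>sinc u\<bar> \<le> 1" for u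
    using abs_sin_x_le_abs_x[of u] by (auto simp del: mult_zero_left simp: divide_le_eq)
  have f_le: "\<bar>?f \<zeta> w\<bar> \<le> indicator {-1..1} \<zeta> * \<bar>x - w\<bar>" for \<zeta> w
  proof -
    have "\<bar>1 - \<bar>\<zeta>\<bar>\<bar> * (\<bar>x - w\<bar> * \<bar>sinc (\<zeta> * (x - w))\<bar>) \<le> 1 * (\<bar>x - w\<bar> * 1)" if "\<zeta> \<in> {-1..1}"
      using that sinc_le by (intro mult_mono) (auto simp del: abs_mult simp: abs_sin_x_le_abs_x)
    then show ?thesis
      by (cases "\<zeta> \<in> {-1..1}")
         (simp_all only: abs_mult real_scaleR_def indicator_simps abs_one abs_zero mult_1_left mult_1_right mult_zero_left order_refl simp_thms)
  qed
  have int: "integrable (lborel \<Otimes>\<^sub>M M) (\<lambda>(\<zeta>, w). ?f \<zeta> w)"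
  proof (rule Bochner_Integration.integrable_bound)
    show "integrable (lborel \<Otimes>\<^sub>M M) (\<lambda>(\<zeta>, w). indicator {-1..1::real} \<zeta> * \<bar>x - w\<bar>)"
    proof (rule P.Fubini_integrable)
      show "(\<lambda>(\<zeta>, w). indicator {-1..1::real} \<zeta> * \<bar>x - w\<bar>) \<in> borel_measurable (lborel \<Otimes>\<^sub>M M)" by measurable
      have "integrable lborel (indicat_real {-1..1::real})"
        by (rule integrable_real_indicator) auto
      then have "integrable lborel (\<lambda>\<zeta>. (\<integral>w. \<bar>x - w\<bar> \<partial>M) * indicat_real {-1..1::real} \<zeta>)"
        by (rule integrable_mult_right)
      moreover have "(\<integral>w. norm (case (\<zeta>, w) of (\<zeta>, w) \<Rightarrow> indicator {-1..1} \<zeta> * \<bar>x - w\<bar>) \<partial>M) =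
          (\<integral>w. \<bar>x - w\<bar> \<partial>M) * indicat_real {-1..1} \<zeta>" for \<zeta> :: real
        by (simp add: abs_mult)
      ultimately show "integrable lborel (\<lambda>\<zeta>::real. \<integral>w. norm (case (\<zeta>, w) of (\<zeta>, w) \<Rightarrow> indicator {-1..1} \<zeta> * \<bar>x - w\<bar>) \<partial>M)"
        by (simp only:)
      show "AE \<zeta> in lborel. integrable M (\<lambda>w. case (\<zeta>, w) of (\<zeta>, w) \<Rightarrow> indicator {-1..1} \<zeta> * \<bar>x - w\<bar>)"
        using int by simp
    qed
    show "(\<lambda>(\<zeta>, w). ?f \<zeta> w) \<in> borel_measurable (lborel \<Otimes>\<^sub>M M)"
      by measurable
    show "AE z in lborel \<Otimes>\<^sub>M M. norm (case z of (\<zeta>, w) \<Rightarrow> ?f \<zeta> w)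
       \<le> norm (case z of (\<zeta>, w) \<Rightarrow> indicator {-1..1} \<zeta> * \<bar>x - w\<bar>)"
      using f_le by (intro AE_I2) (auto simp: abs_mult split: prod.splits)
  qed
  have ae: "AE \<zeta> in lborel. (\<integral>w. ?f \<zeta> w \<partial>M) =
       indicator {-1..1} \<zeta> *\<^sub>R ((1 - \<bar>\<zeta>\<bar>) * (Im (iexp (\<zeta> * x) * cnj (char M \<zeta>)) / \<zeta>))"
  proof -
    \<comment> \<open>At \<zeta> = 0 the quotient is 0 by convention while the \<open>sinc\<close>
      form gives x - w, so the two agree only almost everywhere.\<close>
    have "AE \<zeta> in lborel. \<zeta> \<noteq> (0::real)" by (rule AE_lborel_singleton)
    then show "AE \<zeta> in lborel. (\<integral>w. ?f \<zeta> w \<partial>M) =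
       indicator {-1..1} \<zeta> *\<^sub>R ((1 - \<bar>\<zeta>\<bar>) * (Im (iexp (\<zeta> * x) * cnj (char M \<zeta>)) / \<zeta>))"
    proof eventually_elim
      fix \<zeta> :: real assume z: "\<zeta> \<noteq> 0"
      have i: "integrable M (\<lambda>w. iexp (\<zeta> * w))" by (intro integrable_const_bound[of _ 1]) auto
      have "Im (iexp (\<zeta> * x) * cnj (char M \<zeta>)) = Im (\<integral>w. iexp (\<zeta> * x) * cnj (iexp (\<zeta> * w)) \<partial>M)"
        unfolding char_def by (subst integral_mult_right_zero) (simp only: Bochner_Integration.integral_cnj)
      also have "\<dots> = (\<integral>w. Im (iexp (\<zeta> * x) * cnj (iexp (\<zeta> * w))) \<partial>M)"
        by (rule integral_Im[symmetric], intro integrable_mult_right integrable_cnj i)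
      also have "\<dots> = (\<integral>w. sin (\<zeta> * (x - w)) \<partial>M)"
        by (intro Bochner_Integration.integral_cong refl)
           (simp add: Im_exp Re_exp right_diff_distrib sin_diff  mult.commute)
      finally have *: "Im (iexp (\<zeta> * x) * cnj (char M \<zeta>)) = (\<integral>w. sin (\<zeta> * (x - w)) \<partial>M)" .
      have "?f \<zeta> w = indicator {-1..1} \<zeta> * ((1 - \<bar>\<zeta>\<bar>) / \<zeta>) * sin (\<zeta> * (x - w))" for w
        using z by simp
      then have "(\<integral>w. ?f \<zeta> w \<partial>M) = (\<integral>w. indicator {-1..1} \<zeta> * ((1 - \<bar>\<zeta>\<bar>) / \<zeta>) * sin (\<zeta> * (x - w)) \<partial>M)"
        by presburger
      then show "(\<integral>w. ?f \<zeta> w \<partial>M) =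
       indicator {-1..1} \<zeta> *\<^sub>R ((1 - \<bar>\<zeta>\<bar>) * (Im (iexp (\<zeta> * x) * cnj (char M \<zeta>)) / \<zeta>))"
        unfolding * by simp
    qed
  qed
  have "integrable lborel (\<lambda>\<zeta>. \<integral>w. ?f \<zeta> w \<partial>M)"
    using P.integrable_fst[OF int] by simp
  moreover have ae_sym: "AE \<zeta> in lborel. indicator {-1..1} \<zeta> *\<^sub>R ((1 - \<bar>\<zeta>\<bar>) * (Im (iexp (\<zeta> * x) * cnj (char M \<zeta>)) / \<zeta>)) = (\<integral>w. ?f \<zeta> w \<partial>M)"
    using ae by (auto elim: eventually_mono)
  ultimately show "set_integrable lborel {-1..1} (\<lambda>\<zeta>. (1 - \<bar>\<zeta>\<bar>) * (Im (iexp (\<zeta> * x) * cnj (char M \<zeta>)) / \<zeta>))"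
    unfolding set_integrable_def by (subst integrable_cong_AE[OF _ _ ae_sym]) auto
  have "(\<integral>w. fejer_prim (x - w) \<partial>M) = (\<integral>w. (\<integral>\<zeta>. ?f \<zeta> w \<partial>lborel) \<partial>M)"
    by (simp add: fejer_prim_eq_set set_lebesgue_integral_def)
  also have "\<dots> = (\<integral>\<zeta>. (\<integral>w. ?f \<zeta> w \<partial>M) \<partial>lborel)"
    using P.Fubini_integral[OF int] by simp
  also have "\<dots> = (LINT \<zeta>:{-1..1}|lborel. (1 - \<bar>\<zeta>\<bar>) * (Im (iexp (\<zeta> * x) * cnj (char M \<zeta>)) / \<zeta>))"
    unfolding set_lebesgue_integral_def
    by (rule integral_cong_AE[OF _ _ ae]) auto
  finally show "(\<integral>w. fejer_prim (x - w) \<partial>M) = (LINT \<zeta>:{-1..1}|lborel. (1 - \<bar>\<zeta>\<bar>) * (Im (iexp (\<zeta> * x) * cnj (char M \<zeta>)) / \<zeta>))" .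
qed

lemma fejer_tail:
  assumes "e > 0"
  obtains h where "h > 0" "(\<integral>y. fejer y * indicator {y. h < \<bar>y\<bar>} y \<partial>lborel) < e"
proof -
    have "(\<lambda>n. \<integral>y. fejer y * indicator {y. real n < \<bar>y\<bar>} y \<partial>lborel) \<longlonglongrightarrow> (\<integral>y. (0::real) \<partial>(lborel::real measure))"
  proof (intro integral_dominated_convergence[where w=fejer])
    show "AE y in lborel. (\<lambda>n. fejer y * indicator {y. real n < \<bar>y\<bar>} y) \<longlonglongrightarrow> 0"
    proof (intro AE_I2 tendsto_eventually)
      fix y :: real
      obtain N where "\<bar>y\<bar> < real N" using reals_Archimedean2 by blast
      then show "\<forall>\<^sub>F n in sequentially. fejer y * indicator {y. real n < \<bar>y\<bar>} y = 0"
        by (intro eventually_sequentiallyI[of N]) auto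
    qed
    show "AE y in lborel. norm (fejer y * indicator {y. real n < \<bar>y\<bar>} y) \<le> fejer y" for n
      using fejer_nonneg by (intro AE_I2) (auto simp: indicator_def)
  qed (auto intro: integrable_fejer)
  then have "\<forall>\<^sub>F n in sequentially. (\<integral>y. fejer y * indicator {y. real n < \<bar>y\<bar>} y \<partial>lborel) < e"
    using assms by (intro order_tendstoD(2)) auto
  moreover have "\<forall>\<^sub>F n in sequentially. n > (0::nat)" by (rule eventually_gt_at_top)
  ultimately have "\<forall>\<^sub>F n in sequentially. n > 0 \<and> (\<integral>y. fejer y * indicator {y. real n < \<bar>y\<bar>} y \<partial>lborel) < e"
    by eventually_elim auto
  then obtain n :: nat where "n > 0" "(\<integral>y. fejer y * indicator {y. real n < \<bar>y\<bar>} y \<partial>lborel) < e"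
    by (auto simp: eventually_sequentially)
  then show ?thesis using that[of "real n"] by simp
qed

text \<open>Subtracting the two frequency representations leaves the difference of characteristic
  functions over \<zeta>, weighted by a triangle at most 1 and a phase of modulus 1.\<close>

lemma fejer_smoothed_diff:
  assumes M: "real_distribution M" and N: "real_distribution N"
    and iM: "integrable M (\<lambda>w. w)" and iN: "integrable N (\<lambda>w. w)"
    and g: "set_integrable lborel {-1..1} g"
    and g0: "\<And>\<zeta>. \<zeta> \<in> {-1..1} \<Longrightarrow> 0 \<le> g \<zeta>"
    and le: "\<And>\<zeta>. \<zeta> \<in> {-1..1} \<Longrightarrow> \<zeta> \<noteq> 0 \<Longrightarrow> norm (char M \<zeta> - char N \<zeta>) / \<bar>\<zeta>\<bar> \<le> g \<zeta>"
  shows "integrable lborel (\<lambda>y. fejer y * (cdf M (x - y) - cdf N (x - y)))" (is ?i)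
    and "\<bar>\<integral>y. fejer y * (cdf M (x - y) - cdf N (x - y)) \<partial>lborel\<bar> \<le> (LINT \<zeta>:{-1..1}|lborel. g \<zeta>)" (is ?b)
proof -
  interpret M: real_distribution M by fact
  interpret N: real_distribution N by fact
  have cdf_meas [measurable]: "cdf K \<in> borel_measurable borel" if "real_distribution K" for K
  proof -
    interpret K: real_distribution K by fact
    show ?thesis by (intro borel_measurable_mono) (auto simp: mono_def K.cdf_nondecreasing)
  qed
  note [measurable] = cdf_meas[OF M] cdf_meas[OF N]
  have int: "integrable lborel (\<lambda>y. fejer y * (cdf K (x - y) - indicator {..0} y))" if "real_distribution K" for K
  proof -
    interpret K: real_distribution K by fact
    note [measurable] = cdf_meas[OF that]
    have "\<bar>cdf K (x - y) - indicator {..0} y\<bar> \<le> 1" for y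
      using K.cdf_nonneg[of "x - y"] K.cdf_bounded_prob[of "x - y"] by (auto simp: indicator_def)
    then have "fejer y * \<bar>cdf K (x - y) - indicator {..0} y\<bar> \<le> fejer y" for y
      by (rule mult_left_le) (rule fejer_nonneg)
    then show ?thesis
      by (intro Bochner_Integration.integrable_bound[OF integrable_fejer])
         (auto simp: abs_mult fejer_nonneg)
  qed
  have eq: "fejer y * (cdf M (x - y) - cdf N (x - y)) =
     fejer y * (cdf M (x - y) - indicator {..0} y) - fejer y * (cdf N (x - y) - indicator {..0} y)" for y
    by (simp add: algebra_simps)
  show ?i unfolding eq using int[OF M] int[OF N] by auto
  have "(\<integral>y. fejer y * (cdf M (x - y) - cdf N (x - y)) \<partial>lborel) =
     (\<integral>w. fejer_prim (x - w) \<partial>M) - (\<integral>w. fejer_prim (x - w) \<partial>N)"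
    unfolding eq using int[OF M] int[OF N]
    by (subst Bochner_Integration.integral_diff) (auto simp: M.integral_fejer_prim_cdf N.integral_fejer_prim_cdf)
  also have "\<dots> = (LINT \<zeta>:{-1..1}|lborel. (1 - \<bar>\<zeta>\<bar>) * (Im (iexp (\<zeta> * x) * cnj (char M \<zeta>)) / \<zeta>)
      - (1 - \<bar>\<zeta>\<bar>) * (Im (iexp (\<zeta> * x) * cnj (char N \<zeta>)) / \<zeta>))"
    unfolding M.integral_fejer_prim_char(2)[OF iM] N.integral_fejer_prim_char(2)[OF iN]
    by (rule set_integral_diff(2)[symmetric]; rule M.integral_fejer_prim_char(1)[OF iM] N.integral_fejer_prim_char(1)[OF iN])
  finally have eq2: "(\<integral>y. fejer y * (cdf M (x - y) - cdf N (x - y)) \<partial>lborel) =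
    (LINT \<zeta>:{-1..1}|lborel. (1 - \<bar>\<zeta>\<bar>) * (Im (iexp (\<zeta> * x) * cnj (char M \<zeta>)) / \<zeta>)
      - (1 - \<bar>\<zeta>\<bar>) * (Im (iexp (\<zeta> * x) * cnj (char N \<zeta>)) / \<zeta>))" .
  have "norm (LINT \<zeta>:{-1..1}|lborel. (1 - \<bar>\<zeta>\<bar>) * (Im (iexp (\<zeta> * x) * cnj (char M \<zeta>)) / \<zeta>)
      - (1 - \<bar>\<zeta>\<bar>) * (Im (iexp (\<zeta> * x) * cnj (char N \<zeta>)) / \<zeta>)) \<le> (LINT \<zeta>:{-1..1}|lborel. g \<zeta>)"
    unfolding set_lebesgue_integral_def
  proof (rule Bochner_Integration.integral_norm_bound_integral)
    have "set_integrable lborel {-1..1} (\<lambda>\<zeta>. (1 - \<bar>\<zeta>\<bar>) * (Im (iexp (\<zeta> * x) * cnj (char M \<zeta>)) / \<zeta>)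
      - (1 - \<bar>\<zeta>\<bar>) * (Im (iexp (\<zeta> * x) * cnj (char N \<zeta>)) / \<zeta>))"
      by (intro set_integral_diff(1) M.integral_fejer_prim_char(1)[OF iM] N.integral_fejer_prim_char(1)[OF iN])
    then show "integrable lborel (\<lambda>\<zeta>. indicat_real {-1..1} \<zeta> *\<^sub>R ((1 - \<bar>\<zeta>\<bar>) * (Im (iexp (\<zeta> * x) * cnj (char M \<zeta>)) / \<zeta>)
      - (1 - \<bar>\<zeta>\<bar>) * (Im (iexp (\<zeta> * x) * cnj (char N \<zeta>)) / \<zeta>)))"
      unfolding set_integrable_def .
    show "integrable lborel (\<lambda>\<zeta>. indicat_real {-1..1} \<zeta> *\<^sub>R g \<zeta>)" using g unfolding set_integrable_def .
    fix \<zeta> :: real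
    have "norm ((1 - \<bar>\<zeta>\<bar>) * (Im (iexp (\<zeta> * x) * cnj (char M \<zeta>)) / \<zeta>)
      - (1 - \<bar>\<zeta>\<bar>) * (Im (iexp (\<zeta> * x) * cnj (char N \<zeta>)) / \<zeta>)) \<le> g \<zeta>" if z: "\<zeta> \<in> {-1..1}" "\<zeta> \<noteq> 0"
    proof -
      have "(1 - \<bar>\<zeta>\<bar>) * (Im (iexp (\<zeta> * x) * cnj (char M \<zeta>)) / \<zeta>)
        - (1 - \<bar>\<zeta>\<bar>) * (Im (iexp (\<zeta> * x) * cnj (char N \<zeta>)) / \<zeta>) =
        (1 - \<bar>\<zeta>\<bar>) * (Im (iexp (\<zeta> * x) * cnj (char M \<zeta> - char N \<zeta>)) / \<zeta>)"
        by (simp add: ring_distribs diff_divide_distrib add_divide_distrib)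
      also have "norm \<dots> \<le> 1 * (norm (char M \<zeta> - char N \<zeta>) / \<bar>\<zeta>\<bar>)"
        unfolding real_norm_def abs_mult abs_divide
      proof (intro mult_mono divide_right_mono)
        show "\<bar>Im (iexp (\<zeta> * x) * cnj (char M \<zeta> - char N \<zeta>))\<bar> \<le> norm (char M \<zeta> - char N \<zeta>)"
          using abs_Im_le_cmod[of "iexp (\<zeta> * x) * cnj (char M \<zeta> - char N \<zeta>)"]
          by (simp add: norm_mult del: complex_cnj_diff)
      qed (use z in auto)
      also have "\<dots> \<le> g \<zeta>" using le[OF z] by simp
      finally show ?thesis .
    qed
    then show "norm (indicat_real {-1..1} \<zeta> *\<^sub>R ((1 - \<bar>\<zeta>\<bar>) * (Im (iexp (\<zeta> * x) * cnj (char M \<zeta>)) / \<zeta>)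
      - (1 - \<bar>\<zeta>\<bar>) * (Im (iexp (\<zeta> * x) * cnj (char N \<zeta>)) / \<zeta>))) \<le> indicat_real {-1..1} \<zeta> *\<^sub>R g \<zeta>"
      using g0[of \<zeta>] by (cases "\<zeta> \<in> {-1..1}"; cases "\<zeta> = 0") auto
  qed
  then show ?b unfolding eq2 by simp
qed

text \<open>
  Near a point where the difference of the distribution functions is large it stays large on one
  side, since one of them is monotone and the other Lipschitz; so averaging against the kernel
  cannot destroy it.
\<close>
lemma esseen_smoothing:
  "\<exists>C>0. \<forall>M N g lam x. real_distribution M \<and> real_distribution N \<and>
    integrable M (\<lambda>w. w) \<and> integrable N (\<lambda>w. w) \<and> set_integrable lborel {-1..1} g \<and>
    (\<forall>\<zeta>\<in>{-1..1}. 0 \<le> g \<zeta> \<and> (\<zeta> \<noteq> 0 \<longrightarrow> norm (char M \<zeta> - char N \<zeta>) / \<bar>\<zeta>\<bar> \<le> g \<zeta>)) \<and>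
    (\<forall>x y. \<bar>cdf N x - cdf N y\<bar> \<le> lam * \<bar>x - y\<bar>) \<longrightarrow>
    \<bar>cdf M x - cdf N x\<bar> \<le> C * ((LINT \<zeta>:{-1..1}|lborel. g \<zeta>) + lam)"
proof -
  define m where "m = (\<integral>y. fejer y \<partial>lborel)"
  have m: "m > 0" using fejer_mass_pos by (simp add: m_def)
  \<comment> \<open>Outside [-h, h] the difference of distribution functions is only known to lie
    within \<open>\<eta>\<close>, which costs 2 \<open>\<eta>\<close> times the tail mass. The
    fraction 1/8 makes this at most \<open>\<eta>\<close> m / 4, small enough to be
    absorbed.\<close>
  obtain h where h: "h > 0" "(\<integral>y. fejer y * indicator {y. h < \<bar>y\<bar>} y \<partial>lborel) < m / 8"
    using fejer_tail[of "m / 8"] m by auto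
  define tl where "tl = (\<integral>y. fejer y * indicator {y. h < \<bar>y\<bar>} y \<partial>lborel)"
  have tl: "0 \<le> tl" "tl < m / 8" using h(2) fejer_nonneg by (auto simp: tl_def intro!: integral_nonneg_AE)
  have int_tl: "integrable lborel (\<lambda>y. fejer y * indicator {y. h < \<bar>y\<bar>} y)"
    using integrable_real_mult_indicator[OF _ integrable_fejer] by simp
  \<comment> \<open>Every |D x| will satisfy |D x| \<le> J/m + 2 h lam + \<open>\<eta>\<close>/4,
    where \<open>\<eta>\<close> is the supremum and J the integral of \<open>g\<close>. As
    \<open>\<eta>\<close> is finite, moving \<open>\<eta>\<close>/4 to the left gives the factor
    4/3; the sum 1/m + 2 h serves both coefficients at once.\<close>
  define C where "C = 4 / 3 * (1 / m + 2 * h)"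
  have "C > 0" using m h by (simp add: C_def add_pos_pos)
  moreover have "\<bar>cdf M x - cdf N x\<bar> \<le> C * ((LINT \<zeta>:{-1..1}|lborel. g \<zeta>) + lam)"
    if M: "real_distribution M" and N: "real_distribution N"
      and iM: "integrable M (\<lambda>w. w)" and iN: "integrable N (\<lambda>w. w)"
      and g: "set_integrable lborel {-1..1} g"
      and le: "\<forall>\<zeta>\<in>{-1..1}. 0 \<le> g \<zeta> \<and> (\<zeta> \<noteq> 0 \<longrightarrow> norm (char M \<zeta> - char N \<zeta>) / \<bar>\<zeta>\<bar> \<le> g \<zeta>)"
      and lip: "\<forall>x y. \<bar>cdf N x - cdf N y\<bar> \<le> lam * \<bar>x - y\<bar>"
    for M N g lam x
  proof -
    interpret M: real_distribution M by fact
    interpret N: real_distribution N by fact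
    define J where "J = (LINT \<zeta>:{-1..1}|lborel. g \<zeta>)"
    define D where "D x = cdf M x - cdf N x" for x
    define \<eta> where "\<eta> = (SUP x. \<bar>D x\<bar>)"
    have lam: "lam \<ge> 0" using lip[rule_format, of 0 1] by simp
    have J: "J \<ge> 0" unfolding J_def set_lebesgue_integral_def
      using le by (intro integral_nonneg_AE AE_I2) (auto simp: indicator_def)
    have D1: "\<bar>D x\<bar> \<le> 1" for x
      using M.cdf_nonneg[of x] M.cdf_bounded_prob[of x] N.cdf_nonneg[of x] N.cdf_bounded_prob[of x]
      by (auto simp: D_def)
    have D\<eta>: "\<bar>D x\<bar> \<le> \<eta>" for x unfolding \<eta>_def
      by (rule cSUP_upper) (auto intro!: bdd_aboveI[of _ 1] simp: D1)
    have lipD: "cdf N b \<le> cdf N a + 2 * h * lam" if "a \<le> b" "b - a \<le> 2 * h" for a b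
    proof -
      have "cdf N b - cdf N a \<le> lam * \<bar>b - a\<bar>" using lip[rule_format, of b a] by linarith
      also have "\<dots> \<le> lam * (2 * h)" using that lam by (intro mult_left_mono) auto
      finally show ?thesis by (simp add: algebra_simps)
    qed
    have sm: "integrable lborel (\<lambda>y. fejer y * D (x - y))" "\<bar>\<integral>y. fejer y * D (x - y) \<partial>lborel\<bar> \<le> J" for x
      using fejer_smoothed_diff[OF M N iM iN g, of x] le by (auto simp: D_def J_def)
    have low: "(\<integral>y. fejer y * (c - 2 * \<eta> * indicator {y. h < \<bar>y\<bar>} y) \<partial>lborel) = c * m - 2 * \<eta> * tl"
      "integrable lborel (\<lambda>y. fejer y * (c - 2 * \<eta> * indicator {y. h < \<bar>y\<bar>} y))" for c
    proof -
      have eq: "fejer y * (c - 2 * \<eta> * indicator {y. h < \<bar>y\<bar>} y) =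
        c * fejer y - 2 * \<eta> * (fejer y * indicator {y. h < \<bar>y\<bar>} y)" for y
        by (simp add: algebra_simps)
      show "integrable lborel (\<lambda>y. fejer y * (c - 2 * \<eta> * indicator {y. h < \<bar>y\<bar>} y))"
        unfolding eq using integrable_fejer int_tl by auto
      show "(\<integral>y. fejer y * (c - 2 * \<eta> * indicator {y. h < \<bar>y\<bar>} y) \<partial>lborel) = c * m - 2 * \<eta> * tl"
        unfolding eq using integrable_fejer int_tl by (subst Bochner_Integration.integral_diff) (auto simp: m_def tl_def)
    qed
    have \<eta>0: "0 \<le> \<eta>" using D\<eta>[of 0] by linarith
    have conc: "c \<le> J / m + 2 * h * lam + \<eta> / 4" if "(c - 2 * h * lam) * m - 2 * \<eta> * tl \<le> J" for c
    proof -
      have "2 * \<eta> * tl \<le> 2 * \<eta> * (m / 8)" using tl \<eta>0 by (intro mult_left_mono) auto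
      then have "(c - 2 * h * lam) * m \<le> J + \<eta> / 4 * m" using that by simp
      then have "c - 2 * h * lam \<le> (J + \<eta> / 4 * m) / m" using m by (simp add: pos_le_divide_eq)
      then show ?thesis using m by (simp add: add_divide_distrib)
    qed
    have "\<bar>D x\<bar> \<le> J / m + 2 * h * lam + \<eta> / 4" for x
    proof (rule abs_leI)
      show "D x \<le> J / m + 2 * h * lam + \<eta> / 4"
      proof (rule conc)
        \<comment> \<open>The kernel is centred at x + h: for |y| \<le> h the point x + h - y lies
          in [x, x + 2 h], where the distribution function of \<open>M\<close> has not decreased and
          that of \<open>N\<close> has grown by at most 2 h lam. For the lower bound the shift goes
          the other way.\<close>
        have "(D x - 2 * h * lam) * m - 2 * \<eta> * tl \<le> (\<integral>y. fejer y * D (x + h - y) \<partial>lborel)"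
          unfolding low(1)[symmetric]
        proof (rule integral_mono[OF low(2) sm(1)])
          fix y
          have "D x - 2 * h * lam - 2 * \<eta> * indicator {y. h < \<bar>y\<bar>} y \<le> D (x + h - y)"
          proof (cases "h < \<bar>y\<bar>")
            case True
            have "0 \<le> 2 * h * lam" using h lam by simp
            then show ?thesis using True D\<eta>[of x] D\<eta>[of "x + h - y"] by auto
          next
            case False
            then have "x \<le> x + h - y" "x + h - y - x \<le> 2 * h" by auto
            then show ?thesis
              using False M.cdf_nondecreasing[of x "x + h - y"] lipD[of x "x + h - y"] by (simp add: D_def)
          qed
          then show "fejer y * (D x - 2 * h * lam - 2 * \<eta> * indicator {y. h < \<bar>y\<bar>} y) \<le> fejer y * D (x + h - y)"
            by (intro mult_left_mono fejer_nonneg)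
        qed
        also have "\<dots> \<le> J" using sm(2)[of "x + h"] by linarith
        finally show "(D x - 2 * h * lam) * m - 2 * \<eta> * tl \<le> J" .
      qed
      show "- D x \<le> J / m + 2 * h * lam + \<eta> / 4"
      proof (rule conc)
        have "(- D x - 2 * h * lam) * m - 2 * \<eta> * tl \<le> (\<integral>y. - (fejer y * D (x - h - y)) \<partial>lborel)"
          unfolding low(1)[symmetric]
        proof (rule integral_mono[OF low(2)])
          show "integrable lborel (\<lambda>y. - (fejer y * D (x - h - y)))" using sm(1) by auto
          fix y
          have "- D x - 2 * h * lam - 2 * \<eta> * indicator {y. h < \<bar>y\<bar>} y \<le> - D (x - h - y)"
          proof (cases "h < \<bar>y\<bar>")
            case True
            have "0 \<le> 2 * h * lam" using h lam by simp
            then show ?thesis using True D\<eta>[of x] D\<eta>[of "x - h - y"] by auto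
          next
            case False
            then have "x - h - y \<le> x" "x - (x - h - y) \<le> 2 * h" by auto
            then show ?thesis
              using False M.cdf_nondecreasing[of "x - h - y" x] lipD[of "x - h - y" x] by (simp add: D_def)
          qed
          then have "fejer y * (- D x - 2 * h * lam - 2 * \<eta> * indicator {y. h < \<bar>y\<bar>} y) \<le> fejer y * (- D (x - h - y))"
            by (intro mult_left_mono fejer_nonneg)
          then show "fejer y * (- D x - 2 * h * lam - 2 * \<eta> * indicator {y. h < \<bar>y\<bar>} y) \<le> - (fejer y * D (x - h - y))"
            by simp
        qed
        also have "\<dots> \<le> J" using sm(2)[of "x - h"] by simp
        finally show "(- D x - 2 * h * lam) * m - 2 * \<eta> * tl \<le> J" .
      qed
    qed
    then have "\<eta> \<le> J / m + 2 * h * lam + \<eta> / 4"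
      unfolding \<eta>_def by (intro cSUP_least) auto
    then have "\<eta> \<le> 4 / 3 * (J / m + 2 * h * lam)" by simp
    also have "\<dots> \<le> C * (J + lam)"
    proof -
      have "0 \<le> (1/m) * lam" "0 \<le> 2 * h * J" using m lam h J by auto
      moreover have "C * (J + lam) = 4 / 3 * (J / m + 2 * h * lam) + 4 / 3 * ((1/m) * lam) + 4 / 3 * (2 * h * J)"
        unfolding C_def by (simp add: algebra_simps add_divide_distrib)
      ultimately show ?thesis by linarith
    qed
    finally show ?thesis using D\<eta>[of x] by (simp add: D_def J_def)
  qed
  ultimately show ?thesis by blast
qed

section \<open>The Berry--Esseen bound\<close>

text \<open>Telescoping factorization of a difference of powers. Keeping r^(n-1) instead of 1
  preserves the Gaussian decay in the frequency.\<close>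

lemma norm_power_diff_le:
  fixes a b :: "'a::{real_normed_field}"
  assumes "norm a \<le> r" "norm b \<le> r"
  shows "norm (a ^ n - b ^ n) \<le> real n * r ^ (n - 1) * norm (a - b)"
proof -
  have r: "0 \<le> r" using assms(1) norm_ge_zero order_trans by blast
  have "a ^ n - b ^ n = (a - b) * (\<Sum>i<n. b ^ (n - Suc i) * a ^ i)"
    by (rule power_diff_sumr2)
  also have "norm \<dots> \<le> norm (a - b) * (\<Sum>i<n. r ^ (n - 1))"
    unfolding norm_mult
  proof (intro mult_left_mono order_trans[OF norm_sum] sum_mono)
    fix i assume i: "i \<in> {..<n}"
    have "norm (b ^ (n - Suc i) * a ^ i) \<le> r ^ (n - Suc i) * r ^ i"
      unfolding norm_mult norm_power using assms r by (intro mult_mono power_mono) auto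
    also have "\<dots> = r ^ (n - 1)" using i by (simp add: power_add[symmetric])
    finally show "norm (b ^ (n - Suc i) * a ^ i) \<le> r ^ (n - 1)" .
  qed auto
  finally show ?thesis by (simp add: mult_ac)
qed

lemma exp_minus_bounds:
  fixes x :: real assumes "0 \<le> x"
  shows "1 - x \<le> exp (- x)" "exp (- x) \<le> 1 - x + x\<^sup>2 / 2"
proof -
  show "1 - x \<le> exp (- x)" using exp_ge_add_one_self[of "- x"] by simp
  have "(\<lambda>x::real. 1 - x + x\<^sup>2 / 2 - exp (- x)) 0 \<le> (\<lambda>x. 1 - x + x\<^sup>2 / 2 - exp (- x)) x"
  proof (rule DERIV_nonneg_imp_nondecreasing[OF assms])
    fix y :: real assume "0 \<le> y" "y \<le> x"
    have "((\<lambda>x::real. 1 - x + x\<^sup>2 / 2 - exp (- x)) has_real_derivative (- 1 + y + exp (- y))) (at y)"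
      by (auto intro!: derivative_eq_intros)
    moreover have "0 \<le> - 1 + y + exp (- y)" using exp_ge_add_one_self[of "- y"] by simp
    ultimately show "\<exists>z. ((\<lambda>x::real. 1 - x + x\<^sup>2 / 2 - exp (- x)) has_real_derivative z) (at y) \<and> 0 \<le> z" by blast
  qed
  then show "exp (- x) \<le> 1 - x + x\<^sup>2 / 2" by simp
qed

text \<open>The third-order Taylor estimate bounds the distance from the characteristic function to
  1 - u^2/2 by \<beta> |u|^3 / 6. On the range |u| \<beta> \<le> 1 this is at most u^2/6, so the
  modulus is at most 1 - u^2/3; comparing 1 - u^2/2 with the Gaussian costs another u^4/8.\<close>

lemma (in prob_space) char_near_normal:
  assumes X [measurable]: "random_variable borel X"
    and i3: "integrable M (\<lambda>x. \<bar>X x\<bar> ^ 3)"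
    and i1: "integrable M X" and i2: "integrable M (\<lambda>x. (X x)\<^sup>2)"
    and m: "expectation X = 0" and v: "expectation (\<lambda>x. (X x)\<^sup>2) = 1"
    and \<beta>: "expectation (\<lambda>x. \<bar>X x\<bar> ^ 3) \<le> \<beta>" "1 \<le> \<beta>"
    and u: "\<bar>u\<bar> * \<beta> \<le> 1"
  shows "norm (char (distr M borel X) u) \<le> exp (- u\<^sup>2 / 3)"
    and "norm (char (distr M borel X) u - exp (- u\<^sup>2 / 2)) \<le> \<beta> * \<bar>u\<bar> ^ 3"
proof -
  let ?\<phi> = "char (distr M borel X) u"
  have u1: "\<bar>u\<bar> \<le> 1"
  proof -
    have "\<bar>u\<bar> * 1 \<le> \<bar>u\<bar> * \<beta>" using \<beta> by (intro mult_left_mono) auto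
    then show ?thesis using u by simp
  qed
  have var: "variance X = 1" by (simp add: m v)
  have "norm (?\<phi> - (1 - u\<^sup>2 * 1 / 2)) \<le> (u\<^sup>2 / 6) * expectation (\<lambda>x. min (6 * (X x)\<^sup>2) (\<bar>u\<bar> * \<bar>X x\<bar>^3))"
    using char_approx3'[OF X i1 i2 m var refl, of u] by simp
  also have "\<dots> \<le> (u\<^sup>2 / 6) * expectation (\<lambda>x. \<bar>u\<bar> * \<bar>X x\<bar>^3)"
    using i2 i3 by (intro mult_left_mono integral_mono) auto
  also have "\<dots> \<le> (u\<^sup>2 / 6) * (\<bar>u\<bar> * \<beta>)"
    using \<beta> by (intro mult_left_mono) (auto intro!: mult_left_mono)
  finally have A: "norm (?\<phi> - (1 - u\<^sup>2 / 2)) \<le> (u\<^sup>2 / 6) * (\<bar>u\<bar> * \<beta>)" by simp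
  also have "\<dots> \<le> u\<^sup>2 / 6 * 1" using u by (intro mult_left_mono) auto
  finally have B: "norm (?\<phi> - (1 - u\<^sup>2 / 2)) \<le> u\<^sup>2 / 6" by simp
  have uu: "u\<^sup>2 \<le> 1" using u1 by (simp add: abs_square_le_1)
  have "norm ?\<phi> \<le> norm (?\<phi> - (1 - u\<^sup>2 / 2)) + norm (complex_of_real (1 - u\<^sup>2 / 2))"
    using norm_triangle_ineq[of "?\<phi> - (1 - u\<^sup>2 / 2)" "complex_of_real (1 - u\<^sup>2 / 2)"] by simp
  also have "norm (complex_of_real (1 - u\<^sup>2 / 2)) = 1 - u\<^sup>2 / 2" using uu by (simp only: norm_of_real)
  finally have "norm ?\<phi> \<le> 1 - u\<^sup>2 / 3" using B by simp
  also have "\<dots> \<le> exp (- u\<^sup>2 / 3)" using exp_minus_bounds(1)[of "u\<^sup>2 / 3"] by simp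
  finally show "norm ?\<phi> \<le> exp (- u\<^sup>2 / 3)" .
  have C: "norm (complex_of_real (1 - u\<^sup>2 / 2) - exp (- u\<^sup>2 / 2)) \<le> u^4 / 8"
  proof -
    have "norm (complex_of_real (1 - u\<^sup>2 / 2) - exp (- u\<^sup>2 / 2)) = \<bar>1 - u\<^sup>2 / 2 - exp (- u\<^sup>2 / 2)\<bar>"
      by (simp only: of_real_exp[symmetric] of_real_diff[symmetric] norm_of_real flip: of_real_minus of_real_divide)
    then show ?thesis using exp_minus_bounds[of "u\<^sup>2 / 2"] by (simp add: power_divide)
  qed
  have D: "u ^ 4 \<le> \<beta> * \<bar>u\<bar> ^ 3"
  proof -
    have "u ^ 4 = \<bar>u\<bar> * \<bar>u\<bar> ^ 3" by (simp add: eval_nat_numeral)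
    also have "\<dots> \<le> \<beta> * \<bar>u\<bar> ^ 3" using u1 \<beta> by (intro mult_right_mono) auto
    finally show ?thesis .
  qed
  have "norm (?\<phi> - exp (- u\<^sup>2 / 2)) \<le> norm (?\<phi> - (1 - u\<^sup>2 / 2)) + norm (complex_of_real (1 - u\<^sup>2 / 2) - exp (- u\<^sup>2 / 2))"
    using norm_triangle_ineq[of "?\<phi> - (1 - u\<^sup>2 / 2)" "complex_of_real (1 - u\<^sup>2 / 2) - exp (- u\<^sup>2 / 2)"] by simp
  also have "\<dots> \<le> (u\<^sup>2 / 6) * (\<bar>u\<bar> * \<beta>) + u ^ 4 / 8" using A C by linarith
  also have "(u\<^sup>2 / 6) * (\<bar>u\<bar> * \<beta>) = \<beta> * \<bar>u\<bar> ^ 3 / 6"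
    by (simp add: eval_nat_numeral)
  also have "\<beta> * \<bar>u\<bar> ^ 3 / 6 + u ^ 4 / 8 \<le> \<beta> * \<bar>u\<bar> ^ 3"
  proof -
    have "0 \<le> \<beta> * \<bar>u\<bar> ^ 3" using \<beta> by simp
    then show ?thesis using D by linarith
  qed
  finally show "norm (?\<phi> - exp (- u\<^sup>2 / 2)) \<le> \<beta> * \<bar>u\<bar> ^ 3" by simp
qed

text \<open>The density is at most 1/sqrt(2 pi), hence at most 1. After rescaling by
  \<open>T\<close> the Lipschitz constant becomes 1/T.\<close>

lemma std_normal_cdf_lipschitz:
  "\<bar>cdf std_normal_distribution x - cdf std_normal_distribution y\<bar> \<le> \<bar>x - y\<bar>"
proof -
  interpret N: real_distribution std_normal_distribution by (rule real_dist_normal_dist)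
  have *: "cdf std_normal_distribution b - cdf std_normal_distribution a \<le> b - a" if "a \<le> b" for a b
  proof (cases "a = b")
    case False
    have "std_normal_density z \<le> 1" for z
    proof -
      have "1 \<le> sqrt (2 * pi)" using pi_gt3 by simp
      moreover have "exp (- z\<^sup>2 / 2) \<le> 1" by simp
      ultimately have "1 / sqrt (2 * pi) * exp (- z\<^sup>2 / 2) \<le> 1 * 1"
        by (intro mult_mono) (auto simp: divide_le_eq)
      then show ?thesis by (simp add: std_normal_density_def)
    qed
    then have "(\<integral>\<^sup>+z. ennreal (std_normal_density z) * indicator {a<..b} z \<partial>lborel) \<le> (\<integral>\<^sup>+z. indicator {a<..b} z \<partial>lborel)"
      by (intro nn_integral_mono) (auto simp: indicator_def)
    then have "emeasure std_normal_distribution {a<..b} \<le> (\<integral>\<^sup>+z. indicator {a<..b} z \<partial>lborel)"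
      by (subst emeasure_density) auto
    also have "\<dots> = ennreal (b - a)" using that by simp
    finally have "measure std_normal_distribution {a<..b} \<le> b - a"
      using that by (simp add: N.emeasure_eq_measure)
    then show ?thesis using N.cdf_diff_eq[of a b] that False by simp
  qed simp
  show ?thesis
    using *[of x y] *[of y x] N.cdf_nondecreasing[of x y] N.cdf_nondecreasing[of y x] by linarith
qed

text \<open>An arctangent integral: its size 1/T is the Berry-Esseen rate. The value 288 is 144
  times 2, from arctan T < pi/2 < 2.\<close>

lemma integral_inverse_quadratic_le:
  fixes T :: real assumes T: "T > 0"
  shows "set_integrable lborel {-1..1} (\<lambda>\<zeta>. 72 / (1 + (T * \<zeta>)\<^sup>2))"
    and "(LINT \<zeta>:{-1..1}|lborel. 72 / (1 + (T * \<zeta>)\<^sup>2)) \<le> 288 / T"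
proof -
  have nz: "1 + (T * \<zeta>)\<^sup>2 \<noteq> 0" for \<zeta> by (metis add_pos_nonneg less_numeral_extra(1) less_numeral_extra(3) zero_le_power2)
  show i: "set_integrable lborel {-1..1} (\<lambda>\<zeta>. 72 / (1 + (T * \<zeta>)\<^sup>2))"
    by (intro borel_integrable_atLeastAtMost' continuous_intros ballI nz)
  have "((\<lambda>\<zeta>. 72 / (1 + (T * \<zeta>)\<^sup>2)) has_integral (72 / T * arctan (T * 1) - 72 / T * arctan (T * (-1)))) {-1..1}"
    using T nz by (intro fundamental_theorem_of_calculus)
      (auto simp: has_real_derivative_iff_has_vector_derivative[symmetric] divide_inverse intro!: derivative_eq_intros)
  then have "(LINT \<zeta>:{-1..1}|lborel. 72 / (1 + (T * \<zeta>)\<^sup>2)) = 72 / T * arctan (T * 1) - 72 / T * arctan (T * (-1))"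
    using set_borel_integral_eq_integral(2)[OF i] integral_unique by metis
  also have "\<dots> = 144 / T * arctan T" by (simp add: arctan_minus)
  also have "\<dots> \<le> 144 / T * 2"
    using arctan_ubound[of T] pi_less_4 T by (intro mult_left_mono) auto
  finally show "(LINT \<zeta>:{-1..1}|lborel. 72 / (1 + (T * \<zeta>)\<^sup>2)) \<le> 288 / T" by simp
qed

text \<open>Trades the Gaussian factor for a function with an elementary integral. With s = x^2/6
  the left side is 6 s exp(-s); the quadratic Taylor bound of exp s suffices, and 72 is dictated by
  36 s^2 = 72 s^2/2.\<close>

lemma square_exp_bound:
  fixes x :: real
  shows "x\<^sup>2 * exp (- x\<^sup>2 / 6) \<le> 72 / (1 + x\<^sup>2)"
proof -
  define s where "s = x\<^sup>2 / 6"
  have s: "s \<ge> 0" "x\<^sup>2 = 6 * s" by (auto simp: s_def)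
  have "6 * s * (1 + 6 * s) \<le> 72 * (1 + s + s\<^sup>2 / 2)" using s by (simp add: algebra_simps power2_eq_square)
  also have "\<dots> \<le> 72 * exp s" using exp_lower_Taylor_quadratic[OF s(1)] by simp
  finally have "6 * s * (1 + 6 * s) * exp (- s) \<le> 72 * exp s * exp (- s)" by (intro mult_right_mono) auto
  also have "\<dots> = 72" by (simp add: mult.assoc exp_minus_inverse)
  finally have "6 * s * exp (- s) * (1 + 6 * s) \<le> 72" by (simp only: mult_ac)
  then show ?thesis using s by (simp add: pos_le_divide_eq mult_ac)
qed

text \<open>With u = \<zeta>/\<beta> and n = card I, the frequency is in the range of
  \<open>char_near_normal\<close> and T \<zeta> = u sqrt n. Telescoping the n-th powers gives n
  exp(-(n-1) u^2/3) \<beta> |u|^3; dividing by |\<zeta>| = \<beta> |u| leaves n u^2 = (T \<zeta>)^2.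
  At least two summands are assumed because then n - 1 \<ge> n/2, so the exponent is at most -(T
  \<zeta>)^2/6.\<close>

lemma (in prob_space) char_iid_sum_diff_le:
  fixes X :: "'i \<Rightarrow> 'a \<Rightarrow> real"
  assumes ind: "indep_vars (\<lambda>_. borel) X I" and I: "finite I" "2 \<le> card I"
    and \<mu>: "\<And>i. i \<in> I \<Longrightarrow> distr M borel (X i) = \<mu>"
    and i1: "integrable \<mu> (\<lambda>x. x)" and i2: "integrable \<mu> (\<lambda>x. x\<^sup>2)" and i3: "integrable \<mu> (\<lambda>x. \<bar>x\<bar> ^ 3)"
    and m: "integral\<^sup>L \<mu> (\<lambda>x. x) = 0" and v: "integral\<^sup>L \<mu> (\<lambda>x. x\<^sup>2) = 1"
    and \<beta>: "integral\<^sup>L \<mu> (\<lambda>x. \<bar>x\<bar> ^ 3) \<le> \<beta>" "1 \<le> \<beta>"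
  defines "T \<equiv> sqrt (card I) / \<beta>"
  assumes \<zeta>: "\<zeta> \<in> {-1..1}" "\<zeta> \<noteq> 0"
  shows "norm (char (distr M borel (\<lambda>\<omega>. T * ((\<Sum>i\<in>I. X i \<omega>) / sqrt (card I)))) \<zeta>
      - char (distr std_normal_distribution borel (\<lambda>x. T * x)) \<zeta>) / \<bar>\<zeta>\<bar> \<le> 72 / (1 + (T * \<zeta>)\<^sup>2)"
proof -
  define n where "n = card I"
  have n: "n \<ge> 2" "real n > 0" using I by (auto simp: n_def)
  have [measurable]: "random_variable borel (X i)" if "i \<in> I" for i
    using ind that unfolding indep_vars_def2 by auto
  obtain i0 where i0: "i0 \<in> I" using I by fastforce
  interpret \<mu>: real_distribution \<mu>
    unfolding \<mu>[OF i0, symmetric] using i0 by (intro real_distribution_distr) auto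
  interpret N: real_distribution std_normal_distribution by (rule real_dist_normal_dist)
  define u where "u = \<zeta> / \<beta>"
  have T: "T * \<zeta> = u * sqrt n" by (simp add: T_def u_def n_def)
  have ub: "\<bar>u\<bar> * \<beta> \<le> 1" using \<zeta> \<beta> by (auto simp: u_def)
  have du: "distr \<mu> borel (\<lambda>x. x) = \<mu>"
    by (rule distr_id2) simp
  note near = \<mu>.char_near_normal[of "\<lambda>x. x", OF _ i3 i1 i2 m v \<beta> ub, unfolded du, simplified]
  have ch: "char (distr M borel (\<lambda>\<omega>. T * ((\<Sum>i\<in>I. X i \<omega>) / sqrt (card I)))) \<zeta> = char \<mu> u ^ n"
  proof -
    have "char (distr M borel (\<lambda>\<omega>. T * ((\<Sum>i\<in>I. X i \<omega>) / sqrt (card I)))) \<zeta> = char (distr M borel (\<lambda>\<omega>. \<Sum>i\<in>I. X i \<omega>)) u"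
    proof -
      have "\<zeta> * (T * (y / sqrt (card I))) = u * y" for y
      proof -
        have "\<zeta> * (T * (y / sqrt (card I))) = (T * \<zeta>) * y / sqrt n" by (simp add: n_def)
        also have "\<dots> = u * y" using n by (simp add: T)
        finally show ?thesis .
      qed
      then show ?thesis unfolding char_def by (simp add: integral_distr del: times_divide_eq_right flip: of_real_mult)
    qed
    also have "\<dots> = (\<Prod>i\<in>I. char (distr M borel (X i)) u)" by (rule char_distr_sum[OF ind])
    also have "\<dots> = (\<Prod>i\<in>I. char \<mu> u)" using \<mu> by (intro prod.cong) auto
    finally show ?thesis by (simp add: n_def)
  qed
  have chN: "char (distr std_normal_distribution borel (\<lambda>x. T * x)) \<zeta> = exp (- u\<^sup>2 / 2) ^ n"
  proof -
    have "char (distr std_normal_distribution borel (\<lambda>x. T * x)) \<zeta> = char std_normal_distribution (T * \<zeta>)"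
      unfolding char_def by (subst integral_distr) (auto simp: mult_ac)
    also have "\<dots> = exp (complex_of_real (real n * (- u\<^sup>2 / 2)))"
      unfolding char_std_normal_distribution T using n by (subst exp_of_real) (simp add: power_mult_distrib mult.commute)
    also have "\<dots> = exp (- u\<^sup>2 / 2) ^ n"
    proof -
      have "complex_of_real (real n * (- u\<^sup>2 / 2)) = of_nat n * complex_of_real (- u\<^sup>2 / 2)"
        by (simp only: of_real_mult of_real_of_nat_eq)
      then show ?thesis by (simp only: exp_of_nat_mult exp_of_real of_real_power)
    qed
    finally show ?thesis .
  qed
  have "- u\<^sup>2 / 2 \<le> - u\<^sup>2 / 3" using zero_le_power2[of u] by linarith
  then have b: "norm (complex_of_real (exp (- u\<^sup>2 / 2))) \<le> exp (- u\<^sup>2 / 3)"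
    by (simp only: norm_of_real abs_exp_cancel exp_le_cancel_iff)
  have "norm (char \<mu> u ^ n - complex_of_real (exp (- u\<^sup>2 / 2)) ^ n) \<le>
     real n * exp (- u\<^sup>2 / 3) ^ (n - 1) * norm (char \<mu> u - exp (- u\<^sup>2 / 2))"
    using near(1) b by (intro norm_power_diff_le) auto
  also have "\<dots> \<le> real n * exp (- u\<^sup>2 / 3) ^ (n - 1) * (\<beta> * \<bar>u\<bar> ^ 3)"
    using near(2) by (intro mult_left_mono) (auto simp: exp_of_real[symmetric])
  also have "exp (- u\<^sup>2 / 3) ^ (n - 1) = exp (real (n - 1) * (- u\<^sup>2 / 3))" by (rule exp_of_nat_mult[symmetric])
  also have "\<dots> \<le> exp (- (T * \<zeta>)\<^sup>2 / 6)"
  proof -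
    have "real n / 2 \<le> real (n - 1)" using n by (simp add: of_nat_diff)
    then have "u\<^sup>2 / 3 * (real n / 2) \<le> u\<^sup>2 / 3 * real (n - 1)" by (intro mult_left_mono) auto
    then show ?thesis using n by (simp add: T power_mult_distrib mult_ac)
  qed
  finally have "norm (char \<mu> u ^ n - complex_of_real (exp (- u\<^sup>2 / 2)) ^ n) \<le>
      real n * exp (- (T * \<zeta>)\<^sup>2 / 6) * (\<beta> * \<bar>u\<bar> ^ 3)" using \<beta> n by (simp add: mult_left_mono mult_right_mono)
  then have "norm (char \<mu> u ^ n - complex_of_real (exp (- u\<^sup>2 / 2)) ^ n) / \<bar>\<zeta>\<bar> \<le>
      real n * exp (- (T * \<zeta>)\<^sup>2 / 6) * (\<beta> * \<bar>u\<bar> ^ 3) / \<bar>\<zeta>\<bar>" by (rule divide_right_mono) simp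
  also have "\<dots> = (T * \<zeta>)\<^sup>2 * exp (- (T * \<zeta>)\<^sup>2 / 6)"
  proof -
    have "real n * (\<beta> * \<bar>u\<bar> ^ 3) / \<bar>\<zeta>\<bar> = real n * u\<^sup>2"
      using \<zeta> \<beta> by (simp add: u_def eval_nat_numeral field_simps)
    also have "\<dots> = (T * \<zeta>)\<^sup>2" unfolding T by (simp add: power_mult_distrib)
    finally have "real n * (\<beta> * \<bar>u\<bar> ^ 3) / \<bar>\<zeta>\<bar> = (T * \<zeta>)\<^sup>2" .
    then show ?thesis by (metis (no_types, lifting) mult.assoc mult.commute times_divide_eq_left)
  qed
  also have "\<dots> \<le> 72 / (1 + (T * \<zeta>)\<^sup>2)" by (rule square_exp_bound)
  finally show ?thesis unfolding ch chN by simp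
qed

text \<open>The smoothing inequality only sees frequencies in \<open>[-1, 1]\<close>, hence the rescaling by \<open>T\<close>.\<close>
lemma berry_esseen:
  "\<exists>C>0. \<forall>(M::'a measure) (X::'i \<Rightarrow> 'a \<Rightarrow> real) I \<mu> \<beta> x.
     prob_space M \<and> prob_space.indep_vars M (\<lambda>_. borel) X I \<and> finite I \<and> I \<noteq> {} \<and>
     (\<forall>i\<in>I. distr M borel (X i) = \<mu>) \<and>
     integrable \<mu> (\<lambda>x. x) \<and> integrable \<mu> (\<lambda>x. x\<^sup>2) \<and> integrable \<mu> (\<lambda>x. \<bar>x\<bar> ^ 3) \<and>
     integral\<^sup>L \<mu> (\<lambda>x. x) = 0 \<and> integral\<^sup>L \<mu> (\<lambda>x. x\<^sup>2) = 1 \<and> integral\<^sup>L \<mu> (\<lambda>x. \<bar>x\<bar> ^ 3) \<le> \<beta> \<and> 1 \<le> \<beta> \<longrightarrow>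
     \<bar>\<P>(\<omega> in M. (\<Sum>i\<in>I. X i \<omega>) / sqrt (card I) \<le> x) - cdf std_normal_distribution x\<bar> \<le> C * \<beta> / sqrt (card I)"
proof -
  from esseen_smoothing obtain C where C: "C > 0" and es: "\<And>M N g lam x. real_distribution M \<Longrightarrow> real_distribution N \<Longrightarrow>
    integrable M (\<lambda>w. w) \<Longrightarrow> integrable N (\<lambda>w. w) \<Longrightarrow> set_integrable lborel {-1..1} g \<Longrightarrow>
    (\<forall>\<zeta>\<in>{-1..1}. 0 \<le> g \<zeta> \<and> (\<zeta> \<noteq> 0 \<longrightarrow> norm (char M \<zeta> - char N \<zeta>) / \<bar>\<zeta>\<bar> \<le> g \<zeta>)) \<Longrightarrow>
    (\<forall>x y. \<bar>cdf N x - cdf N y\<bar> \<le> lam * \<bar>x - y\<bar>) \<Longrightarrow>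
    \<bar>cdf M x - cdf N x\<bar> \<le> C * ((LINT \<zeta>:{-1..1}|lborel. g \<zeta>) + lam)" by blast
  interpret N: real_distribution std_normal_distribution by (rule real_dist_normal_dist)
  \<comment> \<open>The summand 1 covers a single variable, where the bound is trivial because
    \<beta> \<ge> 1. Otherwise 289 adds the frequency integral 288/T and the Lipschitz constant
    1/T.\<close>
  have "\<bar>\<P>(\<omega> in M. (\<Sum>i\<in>I. X i \<omega>) / sqrt (card I) \<le> x) - cdf std_normal_distribution x\<bar> \<le> (1 + 289 * C) * \<beta> / sqrt (card I)"
    if M: "prob_space M" and ind: "prob_space.indep_vars M (\<lambda>_. borel) X I" and I: "finite I" "I \<noteq> {}"
     and \<mu>: "\<forall>i\<in>I. distr M borel (X i) = \<mu>"
     and i: "integrable \<mu> (\<lambda>x. x)" "integrable \<mu> (\<lambda>x. x\<^sup>2)" "integrable \<mu> (\<lambda>x. \<bar>x\<bar> ^ 3)"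
       "integral\<^sup>L \<mu> (\<lambda>x. x) = 0" "integral\<^sup>L \<mu> (\<lambda>x. x\<^sup>2) = 1"
     and \<beta>: "integral\<^sup>L \<mu> (\<lambda>x. \<bar>x\<bar> ^ 3) \<le> \<beta>" "1 \<le> \<beta>"
    for M :: "'a measure" and X :: "'i \<Rightarrow> 'a \<Rightarrow> real" and I \<mu> \<beta> x
  proof -
    interpret prob_space M by fact
    let ?W = "\<lambda>\<omega>. (\<Sum>i\<in>I. X i \<omega>) / sqrt (card I)"
    have X [measurable]: "random_variable borel (X i)" if "i \<in> I" for i
      using ind that unfolding indep_vars_def2 by auto
    have n0: "card I > 0" using I by (simp add: card_gt_0_iff)
    show ?thesis
    proof (cases "card I \<ge> 2")
      case False
      then have "card I = 1" using n0 by simp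
      then have "1 \<le> (1 + 289 * C) * \<beta> / sqrt (card I)"
        using C \<beta> mult_mono[of 1 "1 + 289 * C" 1 \<beta>] by simp
      moreover have "\<bar>\<P>(\<omega> in M. ?W \<omega> \<le> x) - cdf std_normal_distribution x\<bar> \<le> 1"
        using N.cdf_nonneg[of x] N.cdf_bounded_prob[of x] prob_le_1[of "{\<omega>\<in>space M. ?W \<omega> \<le> x}"]
        by (smt (verit) measure_nonneg)
      ultimately show ?thesis by linarith
    next
      case True
      define T where "T = sqrt (card I) / \<beta>"
      have T: "T > 0" using n0 \<beta> by (simp add: T_def)
      let ?M = "distr M borel (\<lambda>\<omega>. T * ?W \<omega>)" and ?N = "distr std_normal_distribution borel (\<lambda>x. T * x)"
      have cN: "cdf ?N y = cdf std_normal_distribution (y / T)" for y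
      proof -
        have "(\<lambda>x. T * x) -` {..y} = {..y / T}" using T by (auto simp: pos_le_divide_eq mult.commute)
        then show ?thesis by (simp add: cdf_def measure_distr)
      qed
      have cM: "cdf ?M (T * x) = \<P>(\<omega> in M. ?W \<omega> \<le> x)"
      proof -
        have "(\<lambda>\<omega>. T * ?W \<omega>) -` {..T * x} \<inter> space M = {\<omega>\<in>space M. ?W \<omega> \<le> x}"
          using T by (auto simp only: vimage_def atMost_iff mult_le_cancel_left_pos)
        then show ?thesis by (simp add: cdf_def measure_distr)
      qed
      have intX: "integrable M (X j)" if "j \<in> I" for j
      proof -
        have "integrable (distr M borel (X j)) (\<lambda>x. x)" using that \<mu> i(1) by simp
        then show ?thesis using that by (subst (asm) integrable_distr_eq) auto
      qed
      have "\<bar>cdf ?M (T * x) - cdf ?N (T * x)\<bar> \<le> C * ((LINT \<zeta>:{-1..1}|lborel. 72 / (1 + (T * \<zeta>)\<^sup>2)) + 1 / T)"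
      proof (rule es)
        show "real_distribution ?M" by simp
        show "real_distribution ?N" by (rule N.real_distribution_distr) simp
        show "integrable ?M (\<lambda>w. w)"
          by (subst integrable_distr_eq) (auto intro!: integrable_mult_right integrable_divide intX)
        show "integrable ?N (\<lambda>w. w)"
        proof (subst integrable_distr_eq)
          show "integrable std_normal_distribution (\<lambda>x. T * x)"
            by (rule integrable_mult_right) (use integrable_std_normal_distribution_moment[of 1] in \<open>simp only: power_one_right\<close>)
        qed auto
        show "set_integrable lborel {-1..1} (\<lambda>\<zeta>. 72 / (1 + (T * \<zeta>)\<^sup>2))" by (rule integral_inverse_quadratic_le(1)[OF T])
        show "\<forall>\<zeta>\<in>{-1..1}. 0 \<le> 72 / (1 + (T * \<zeta>)\<^sup>2) \<and> (\<zeta> \<noteq> 0 \<longrightarrow> norm (char ?M \<zeta> - char ?N \<zeta>) / \<bar>\<zeta>\<bar> \<le> 72 / (1 + (T * \<zeta>)\<^sup>2))"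
        proof (intro ballI conjI impI)
          fix \<zeta> :: real assume "\<zeta> \<in> {-1..1}" "\<zeta> \<noteq> 0"
          then show "norm (char ?M \<zeta> - char ?N \<zeta>) / \<bar>\<zeta>\<bar> \<le> 72 / (1 + (T * \<zeta>)\<^sup>2)"
            unfolding T_def using \<mu> by (intro char_iid_sum_diff_le[OF ind I(1) True _ i \<beta>]) auto
        qed simp
        show "\<forall>x y. \<bar>cdf ?N x - cdf ?N y\<bar> \<le> 1 / T * \<bar>x - y\<bar>"
        proof (intro allI)
          fix x y
          have "\<bar>cdf ?N x - cdf ?N y\<bar> \<le> \<bar>x / T - y / T\<bar>" unfolding cN by (rule std_normal_cdf_lipschitz)
          also have "\<dots> = 1 / T * \<bar>x - y\<bar>" using T by (simp add: abs_divide flip: diff_divide_distrib)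
          finally show "\<bar>cdf ?N x - cdf ?N y\<bar> \<le> 1 / T * \<bar>x - y\<bar>" .
        qed
      qed
      also have "\<dots> \<le> C * (288 / T + 1 / T)"
        using integral_inverse_quadratic_le(2)[OF T] C by (intro mult_left_mono) auto
      also have "\<dots> = 289 * C * \<beta> / sqrt (card I)" using \<beta> n0 by (simp add: T_def field_simps)
      also have "\<dots> \<le> (1 + 289 * C) * \<beta> / sqrt (card I)" using \<beta> by (intro divide_right_mono mult_right_mono) auto
      finally show ?thesis unfolding cM cN using T by simp
    qed
  qed
  moreover have "1 + 289 * C > 0" using C by simp
  ultimately show ?thesis by blast
qed

section \<open>Medians and independent groups\<close>

text \<open>Independence means that the joint law is the product of the marginals; here the joint
  map is the identity on the product space.\<close>

lemma indep_vars_PiM_coordinates: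
  assumes "prob_space Q" "finite I" "I \<noteq> {}"
  shows "prob_space.indep_vars (Pi\<^sub>M I (\<lambda>_. Q)) (\<lambda>_. Q) (\<lambda>i \<omega>. \<omega> i) I"
proof -
  interpret Q: prob_space Q by fact
  interpret P: prob_space "Pi\<^sub>M I (\<lambda>_. Q)" by (intro prob_space_PiM assms)
  have c: "distr (Pi\<^sub>M I (\<lambda>_. Q)) Q (\<lambda>\<omega>. \<omega> i) = Q" if "i \<in> I" for i
    using distr_PiM_component[of I "\<lambda>_. Q" i] assms(1) that by simp
  have "distr (Pi\<^sub>M I (\<lambda>_. Q)) (Pi\<^sub>M I (\<lambda>_. Q)) (\<lambda>x. \<lambda>i\<in>I. x i) = distr (Pi\<^sub>M I (\<lambda>_. Q)) (Pi\<^sub>M I (\<lambda>_. Q)) (\<lambda>x. x)"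
    by (intro distr_cong refl) (auto simp: space_PiM PiE_def extensional_def restrict_def fun_eq_iff)
  also have "\<dots> = Pi\<^sub>M I (\<lambda>_. Q)" by simp
  also have "\<dots> = Pi\<^sub>M I (\<lambda>i. distr (Pi\<^sub>M I (\<lambda>_. Q)) Q (\<lambda>\<omega>. \<omega> i))"
    using c by (intro PiM_cong refl) auto
  finally show ?thesis
    using P.indep_vars_iff_distr_eq_PiM'[OF assms(3), of "\<lambda>i \<omega>. \<omega> i" "\<lambda>_. Q"] by simp
qed

lemma card_nth_sort:
  "card {i. i < length xs \<and> P (sort xs ! i)} = card {i. i < length xs \<and> P (xs ! i)}"
proof -
  have "length (filter P (sort xs)) = length (filter P xs)"
    by (metis mset_filter mset_sort size_mset)
  then show ?thesis by (simp add: length_filter_conv_card)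
qed

text \<open>The upper middle entry is at least the average of the two middle entries, so it and all
  later entries of the sorted list exceed \<open>a\<close>; these are k - k div 2 entries, at least
  half.\<close>

lemma median_greater_imp_card:
  assumes "xs \<noteq> []" "a < median xs"
  shows "length xs \<le> 2 * card {i. i < length xs \<and> a < xs ! i}"
proof -
  let ?k = "length xs" and ?ys = "sort xs"
  have k: "?k > 0" using assms by simp
  have "?ys ! ((?k - 1) div 2) \<le> ?ys ! (?k div 2)"
    using k by (intro sorted_nth_mono) (auto intro: div_le_mono)
  then have a: "a < ?ys ! (?k div 2)" using assms(2) by (simp add: median_def Let_def)
  have "{?k div 2..<?k} \<subseteq> {i. i < ?k \<and> a < ?ys ! i}"
  proof
    fix i assume i: "i \<in> {?k div 2..<?k}"
    then have "?ys ! (?k div 2) \<le> ?ys ! i" by (intro sorted_nth_mono) auto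
    then show "i \<in> {i. i < ?k \<and> a < ?ys ! i}" using i a by auto
  qed
  then have "card {?k div 2..<?k} \<le> card {i. i < ?k \<and> a < ?ys ! i}" by (intro card_mono) auto
  then show ?thesis by (simp add: card_nth_sort)
qed

text \<open>Mirror image with the lower middle entry: the entries up to it number (k - 1) div 2 + 1,
  again at least half for both parities.\<close>

lemma median_less_imp_card:
  assumes "xs \<noteq> []" "median xs < a"
  shows "length xs \<le> 2 * card {i. i < length xs \<and> xs ! i < a}"
proof -
  let ?k = "length xs" and ?ys = "sort xs"
  have k: "?k > 0" using assms by simp
  have "?ys ! ((?k - 1) div 2) \<le> ?ys ! (?k div 2)"
    using k by (intro sorted_nth_mono) (auto intro: div_le_mono)
  then have a: "?ys ! ((?k - 1) div 2) < a" using assms(2) by (simp add: median_def Let_def)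
  have "{0..(?k - 1) div 2} \<subseteq> {i. i < ?k \<and> ?ys ! i < a}"
  proof
    fix i assume i: "i \<in> {0..(?k - 1) div 2}"
    moreover have "(?k - 1) div 2 < ?k" using k by linarith
    ultimately have "i < ?k" by simp
    have "?ys ! i \<le> ?ys ! ((?k - 1) div 2)"
      using i \<open>(?k - 1) div 2 < ?k\<close> by (intro sorted_nth_mono) auto
    then show "i \<in> {i. i < ?k \<and> ?ys ! i < a}" using \<open>i < ?k\<close> a by auto
  qed
  then have "card {0..(?k - 1) div 2} \<le> card {i. i < ?k \<and> ?ys ! i < a}" by (intro card_mono) auto
  then have "(?k - 1) div 2 + 1 \<le> card {i. i < ?k \<and> xs ! i < a}"
    using card_nth_sort[of xs "\<lambda>y. y < a"] by simp
  then show ?thesis by linarith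
qed

text \<open>The count is a sum of independent variables in [0, 1] with mean at most k (1/2 - v). A
  majority exceeds the mean by at least k v, and Hoeffding's inequality applies.\<close>

lemma (in prob_space) majority_prob_le:
  fixes T :: "nat \<Rightarrow> 'a \<Rightarrow> real"
  assumes ind: "indep_vars (\<lambda>_. borel) T {..<k}" and k: "0 < k"
    and B: "B \<in> sets borel" and v: "0 \<le> v"
    and p: "\<And>j. j < k \<Longrightarrow> \<P>(\<omega> in M. T j \<omega> \<in> B) \<le> 1 / 2 - v"
  shows "\<P>(\<omega> in M. k \<le> 2 * card {j. j < k \<and> T j \<omega> \<in> B}) \<le> exp (- 2 * (k * v\<^sup>2))"
proof -
  define X where "X j \<omega> = (indicator B (T j \<omega>) :: real)" for j \<omega>
  have [measurable]: "random_variable borel (T j)" if "j < k" for j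
    using ind that unfolding indep_vars_def2 by auto
  interpret Hoeffding_ineq M "{..<k}" X "\<lambda>_. 0" "\<lambda>_. 1" "\<Sum>i<k. expectation (X i)"
  proof unfold_locales
    show "indep_vars (\<lambda>_. borel) X {..<k}"
      unfolding X_def using B by (intro indep_vars_compose2[OF ind]) auto
  qed (auto simp: X_def indicator_def)
  have ex: "expectation (X j) = \<P>(\<omega> in M. T j \<omega> \<in> B)" if "j < k" for j
  proof -
    have "expectation (X j) = expectation (indicator {\<omega>\<in>space M. T j \<omega> \<in> B})"
      unfolding X_def by (intro Bochner_Integration.integral_cong refl) (auto simp: indicator_def)
    also have "\<dots> = prob ({\<omega>\<in>space M. T j \<omega> \<in> B} \<inter> space M)" by simp
    finally show ?thesis by (simp add: Int_absorb2 Collect_conj_eq Int_commute)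
  qed
  define \<epsilon> where "\<epsilon> = real k / 2 - (\<Sum>i<k. expectation (X i))"
  have "(\<Sum>i<k. expectation (X i)) \<le> (\<Sum>i<k. 1 / 2 - v)"
    using ex p by (intro sum_mono) auto
  then have e: "k * v \<le> \<epsilon>" by (simp add: \<epsilon>_def algebra_simps)
  then have e0: "0 \<le> \<epsilon>" using v by (meson mult_nonneg_nonneg of_nat_0_le_iff order_trans)
  have card_eq: "real (card {j. j < k \<and> T j \<omega> \<in> B}) = (\<Sum>j<k. X j \<omega>)" for \<omega>
  proof -
    have "{..<k} \<inter> {j. T j \<omega> \<in> B} = {j. j < k \<and> T j \<omega> \<in> B}" by auto
    then show ?thesis by (simp add: X_def indicator_def sum.If_cases)
  qed
  have "\<P>(\<omega> in M. k \<le> 2 * card {j. j < k \<and> T j \<omega> \<in> B}) = prob {\<omega>\<in>space M. (\<Sum>i<k. expectation (X i)) + \<epsilon> \<le> (\<Sum>j<k. X j \<omega>)}"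
  proof -
    have "k \<le> 2 * card {j. j < k \<and> T j \<omega> \<in> B} \<longleftrightarrow> (\<Sum>i<k. expectation (X i)) + \<epsilon> \<le> (\<Sum>j<k. X j \<omega>)" for \<omega>
      unfolding card_eq[symmetric] \<epsilon>_def by linarith
    then show ?thesis by simp
  qed
  also have "\<dots> \<le> exp (- 2 * \<epsilon>\<^sup>2 / (\<Sum>i<k. (1 - 0)\<^sup>2))"
    using e0 k by (intro Hoeffding_ineq_ge) auto
  also have "\<dots> \<le> exp (- 2 * (k * v\<^sup>2))"
  proof -
    have "(k * v)\<^sup>2 \<le> \<epsilon>\<^sup>2" using e v by (intro power_mono) auto
    then have "k * v\<^sup>2 \<le> \<epsilon>\<^sup>2 / k" using k by (simp add: pos_le_divide_eq power2_eq_square mult_ac)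
    then show ?thesis by simp
  qed
  finally show ?thesis .
qed

text \<open>If the median leaves the interval, at least half of the variables lie strictly beyond
  one common end point. The factor 2 is the union bound over the two end points.\<close>

lemma (in prob_space) median_concentration:
  fixes T :: "nat \<Rightarrow> 'a \<Rightarrow> real"
  assumes ind: "indep_vars (\<lambda>_. borel) T {..<k}" and k: "0 < k" and v: "0 \<le> v"
    and up: "\<And>j. j < k \<Longrightarrow> \<P>(\<omega> in M. T j \<omega> > m + t) \<le> 1 / 2 - v"
    and lo: "\<And>j. j < k \<Longrightarrow> \<P>(\<omega> in M. T j \<omega> < m - t) \<le> 1 / 2 - v"
    and A: "{\<omega>\<in>space M. \<bar>median (map (\<lambda>j. T j \<omega>) [0..<k]) - m\<bar> \<le> t} \<in> events"
  shows "\<P>(\<omega> in M. \<bar>median (map (\<lambda>j. T j \<omega>) [0..<k]) - m\<bar> \<le> t) \<ge> 1 - 2 * exp (- 2 * (k * v\<^sup>2))"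
proof -
  have [measurable]: "random_variable borel (T j)" if "j < k" for j
    using ind that unfolding indep_vars_def2 by auto
  let ?E = "\<lambda>B. {\<omega>\<in>space M. k \<le> 2 * card {j. j < k \<and> T j \<omega> \<in> B}}"
  have ev: "?E B \<in> events" if B: "B \<in> sets borel" for B
  proof -
    have r: "real (card {j. j < k \<and> T j \<omega> \<in> B}) = (\<Sum>j<k. indicator B (T j \<omega>))" for \<omega>
    proof -
      have "{..<k} \<inter> {j. T j \<omega> \<in> B} = {j. j < k \<and> T j \<omega> \<in> B}" by auto
      then show ?thesis by (simp add: indicator_def sum.If_cases)
    qed
    have "k \<le> 2 * card {j. j < k \<and> T j \<omega> \<in> B} \<longleftrightarrow> real k \<le> 2 * (\<Sum>j<k. indicator B (T j \<omega>))" for \<omega>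
      unfolding r[symmetric] by linarith
    then have "?E B = {\<omega>\<in>space M. real k \<le> 2 * (\<Sum>j<k. indicator B (T j \<omega>))}"
      by simp
    also have "\<dots> \<in> events" using B by measurable
    finally show ?thesis .
  qed
  let ?G = "{\<omega>\<in>space M. \<bar>median (map (\<lambda>j. T j \<omega>) [0..<k]) - m\<bar> \<le> t}"
  have "space M - ?G \<subseteq> ?E {m + t<..} \<union> ?E {..<m - t}"
  proof
    fix \<omega> assume w: "\<omega> \<in> space M - ?G"
    let ?xs = "map (\<lambda>j. T j \<omega>) [0..<k]"
    have c: "{i. i < length ?xs \<and> P (?xs ! i)} = {j. j < k \<and> P (T j \<omega>)}" for P
      by auto
    have ne: "?xs \<noteq> []" "length ?xs = k" using k by auto
    have "median ?xs > m + t \<or> median ?xs < m - t" using w by auto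
    then show "\<omega> \<in> ?E {m + t<..} \<union> ?E {..<m - t}"
    proof
      assume "median ?xs > m + t"
      from median_greater_imp_card[OF ne(1) this, unfolded c[of "\<lambda>y. m + t < y"]] show ?thesis
        using w by (simp add: ne)
    next
      assume "median ?xs < m - t"
      from median_less_imp_card[OF ne(1) this, unfolded c[of "\<lambda>y. y < m - t"]] show ?thesis
        using w by (simp add: ne)
    qed
  qed
  then have "prob (space M - ?G) \<le> prob (?E {m + t<..} \<union> ?E {..<m - t})"
    using ev by (intro finite_measure_mono) auto
  also have "\<dots> \<le> prob (?E {m + t<..}) + prob (?E {..<m - t})"
    using ev by (intro measure_Un_le) auto
  also have "\<dots> \<le> exp (- 2 * (k * v\<^sup>2)) + exp (- 2 * (k * v\<^sup>2))"
    using up lo by (intro add_mono majority_prob_le[OF ind k _ v]) auto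
  finally show ?thesis using prob_compl[OF A] by simp
qed

text \<open>An order statistic exceeds \<open>a\<close> exactly when at least k - i of the variables
  do, and that is a condition on a sum of indicators.\<close>

lemma nth_sort_measurable:
  fixes f :: "nat \<Rightarrow> 'a \<Rightarrow> real"
  assumes [measurable]: "\<And>j. j < k \<Longrightarrow> f j \<in> borel_measurable M" and i: "i < k"
  shows "(\<lambda>x. sort (map (\<lambda>j. f j x) [0..<k]) ! i) \<in> borel_measurable M"
proof (rule borel_measurableI_greater)
  fix a
  let ?ys = "\<lambda>x. sort (map (\<lambda>j. f j x) [0..<k])"
  have "a < ?ys x ! i \<longleftrightarrow> real (k - i) \<le> (\<Sum>j<k. indicator {a<..} (f j x))" for x
  proof -
    have c: "(\<Sum>j<k. indicator {a<..} (f j x)) = real (card {j. j < k \<and> a < ?ys x ! j})"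
    proof -
      have "{..<k} \<inter> {j. a < f j x} = {j. j < k \<and> a < f j x}" by auto
      then have "(\<Sum>j<k. indicator {a<..} (f j x)) = real (card {j. j < k \<and> a < f j x})"
        by (simp add: indicator_def sum.If_cases)
      also have "{j. j < k \<and> a < f j x} = {j. j < k \<and> a < map (\<lambda>j. f j x) [0..<k] ! j}" by auto
      also have "card \<dots> = card {j. j < k \<and> a < ?ys x ! j}"
        using card_nth_sort[of "map (\<lambda>j. f j x) [0..<k]" "\<lambda>y. a < y"] by simp
      finally show ?thesis .
    qed
    show ?thesis
    proof
      assume a: "a < ?ys x ! i"
      have "{i..<k} \<subseteq> {j. j < k \<and> a < ?ys x ! j}"
      proof
        fix j assume j: "j \<in> {i..<k}"
        then have "?ys x ! i \<le> ?ys x ! j" by (intro sorted_nth_mono) auto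
        then show "j \<in> {j. j < k \<and> a < ?ys x ! j}" using a j by auto
      qed
      then have "card {i..<k} \<le> card {j. j < k \<and> a < ?ys x ! j}" by (intro card_mono) auto
      then show "real (k - i) \<le> (\<Sum>j<k. indicator {a<..} (f j x))" unfolding c by simp
    next
      assume "real (k - i) \<le> (\<Sum>j<k. indicator {a<..} (f j x))"
      then have le: "k - i \<le> card {j. j < k \<and> a < ?ys x ! j}" unfolding c by linarith
      show "a < ?ys x ! i"
      proof (rule ccontr)
        assume n: "\<not> a < ?ys x ! i"
        have "{j. j < k \<and> a < ?ys x ! j} \<subseteq> {Suc i..<k}"
        proof
          fix j assume j: "j \<in> {j. j < k \<and> a < ?ys x ! j}"
          have "\<not> j \<le> i"
          proof
            assume "j \<le> i"
            then have "?ys x ! j \<le> ?ys x ! i" using i by (intro sorted_nth_mono) auto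
            then show False using j n by auto
          qed
          then show "j \<in> {Suc i..<k}" using j by auto
        qed
        then have "card {j. j < k \<and> a < ?ys x ! j} \<le> card {Suc i..<k}" by (intro card_mono) auto
        then show False using le i by simp
      qed
    qed
  qed
  then have "{x\<in>space M. a < ?ys x ! i} = {x\<in>space M. real (k - i) \<le> (\<Sum>j<k. indicator {a<..} (f j x))}" by simp
  also have "\<dots> \<in> sets M" by measurable
  finally show "{x\<in>space M. a < ?ys x ! i} \<in> sets M" .
qed

lemma median_measurable:
  fixes f :: "nat \<Rightarrow> 'a \<Rightarrow> real"
  assumes "\<And>j. j < k \<Longrightarrow> f j \<in> borel_measurable M" and "0 < k"
  shows "(\<lambda>x. median (map (\<lambda>j. f j x) [0..<k])) \<in> borel_measurable M"
  unfolding median_def Let_def length_map length_upt minus_nat.diff_0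
  using assms by (intro borel_measurable_divide borel_measurable_add nth_sort_measurable) auto

text \<open>
  Only countably many partitions matter, so the joint event is a countable union of rectangles.
\<close>
lemma prob_pair_pmf_ge:
  fixes \<rho> :: "'b pmf"
  assumes "prob_space M"
    and A: "\<And>G. G \<in> set_pmf \<rho> \<Longrightarrow> {x\<in>space M. R x G} \<in> sets M"
    and b: "\<And>G. G \<in> set_pmf \<rho> \<Longrightarrow> b \<le> \<P>(x in M. R x G)"
  shows "b \<le> \<P>(\<omega> in M \<Otimes>\<^sub>M measure_pmf \<rho>. snd \<omega> \<in> set_pmf \<rho> \<and> R (fst \<omega>) (snd \<omega>))"
proof -
  interpret M: prob_space M by fact
  interpret P: pair_prob_space "measure_pmf \<rho>" M ..
  interpret P': pair_prob_space M "measure_pmf \<rho>" ..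
  let ?E = "{\<omega> \<in> space (M \<Otimes>\<^sub>M measure_pmf \<rho>). snd \<omega> \<in> set_pmf \<rho> \<and> R (fst \<omega>) (snd \<omega>)}"
  have "?E = (\<Union>G\<in>set_pmf \<rho>. {x\<in>space M. R x G} \<times> {G})"
    by (auto simp: space_pair_measure)
  also have "\<dots> \<in> sets (M \<Otimes>\<^sub>M measure_pmf \<rho>)"
    using A by (intro sets.countable_UN') (auto intro!: pair_measureI)
  finally have E: "?E \<in> sets (M \<Otimes>\<^sub>M measure_pmf \<rho>)" .
  have "ennreal b = (\<integral>\<^sup>+G. ennreal b \<partial>measure_pmf \<rho>)"
    by simp
  also have "\<dots> \<le> (\<integral>\<^sup>+G. emeasure M ((\<lambda>x. (x, G)) -` ?E) \<partial>measure_pmf \<rho>)"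
  proof (intro nn_integral_mono_AE AE_pmfI)
    fix G assume G: "G \<in> set_pmf \<rho>"
    have "(\<lambda>x. (x, G)) -` ?E = {x\<in>space M. R x G}" using G by (auto simp: space_pair_measure)
    then show "ennreal b \<le> emeasure M ((\<lambda>x. (x, G)) -` ?E)"
      using b[OF G] by (simp add: M.emeasure_eq_measure ennreal_leI)
  qed
  also have "\<dots> = emeasure (M \<Otimes>\<^sub>M measure_pmf \<rho>) ?E"
    by (rule P'.emeasure_pair_measure_alt2[OF E, symmetric])
  finally show ?thesis by (simp add: P'.emeasure_eq_measure)
qed

text \<open>The coordinates in \<open>I\<close> have the product law over \<open>I\<close> as
  marginal. This carries a tail bound for one group over to the whole sample.\<close>

lemma prob_restrict_PiM:
  assumes "prob_space Q" "finite J" "I \<subseteq> J" and A: "{y\<in>space (Pi\<^sub>M I (\<lambda>_. Q)). R y} \<in> sets (Pi\<^sub>M I (\<lambda>_. Q))"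
  shows "\<P>(x in Pi\<^sub>M J (\<lambda>_. Q). R (restrict x I)) = \<P>(y in Pi\<^sub>M I (\<lambda>_. Q). R y)"
proof -
  interpret product_prob_space "\<lambda>_. Q" by (intro product_prob_spaceI assms)
  let ?A = "{y\<in>space (Pi\<^sub>M I (\<lambda>_. Q)). R y}"
  have m: "(\<lambda>f. restrict f I) \<in> measurable (Pi\<^sub>M J (\<lambda>_. Q)) (Pi\<^sub>M I (\<lambda>_. Q))"
    using assms by (intro measurable_restrict_subset)
  have "measure (Pi\<^sub>M I (\<lambda>_. Q)) ?A = measure (distr (Pi\<^sub>M J (\<lambda>_. Q)) (Pi\<^sub>M I (\<lambda>_. Q)) (\<lambda>f. restrict f I)) ?A"
    using distr_restrict[OF assms(3,2)] by simp
  also have "\<dots> = measure (Pi\<^sub>M J (\<lambda>_. Q)) ((\<lambda>f. restrict f I) -` ?A \<inter> space (Pi\<^sub>M J (\<lambda>_. Q)))"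
    by (rule measure_distr[OF m A])
  also have "(\<lambda>f. restrict f I) -` ?A \<inter> space (Pi\<^sub>M J (\<lambda>_. Q)) = {x\<in>space (Pi\<^sub>M J (\<lambda>_. Q)). R (restrict x I)}"
    using measurable_space[OF m] by blast
  finally show ?thesis by simp
qed

section \<open>Sums of i.i.d. variables\<close>

lemma arctan_le_Taylor5:
  fixes x :: real assumes "0 \<le> x"
  shows "arctan x \<le> x - x ^ 3 / 3 + x ^ 5 / 5"
proof -
  have "(\<lambda>x. x - x ^ 3 / 3 + x ^ 5 / 5 - arctan x) 0 \<le> (\<lambda>x. x - x ^ 3 / 3 + x ^ 5 / 5 - arctan x) x"
  proof (rule DERIV_nonneg_imp_nondecreasing[OF assms])
    fix y :: real
    have d: "((\<lambda>x. x - x ^ 3 / 3 + x ^ 5 / 5 - arctan x) has_real_derivative 1 - y\<^sup>2 + y ^ 4 - inverse (1 + y\<^sup>2)) (at y)"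
      by (auto intro!: derivative_eq_intros)
    have p: "1 + y\<^sup>2 > 0" by (simp add: add_pos_nonneg)
    have "(1 - y\<^sup>2 + y ^ 4) * (1 + y\<^sup>2) = 1 + (y ^ 3)\<^sup>2" by (simp add: algebra_simps eval_nat_numeral)
    then have "1 \<le> (1 - y\<^sup>2 + y ^ 4) * (1 + y\<^sup>2)" by simp
    then have "0 \<le> 1 - y\<^sup>2 + y ^ 4 - inverse (1 + y\<^sup>2)" using p by (simp add: inverse_eq_divide pos_divide_le_eq)
    then show "\<exists>z. ((\<lambda>x. x - x ^ 3 / 3 + x ^ 5 / 5 - arctan x) has_real_derivative z) (at y) \<and> 0 \<le> z"
      using d by blast
  qed
  then show ?thesis by simp
qed

text \<open>Euler's formula pi/4 = 5 arctan(1/7) + 2 arctan(3/79) with the fifth-order Taylor bound.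
  The normal estimate that follows has so little slack at 0.33 that pi must be bounded below
  3.15.\<close>

lemma pi_le: "pi \<le> 31417 / 10000"
proof -
  have "(1 / 7 :: real) - (1 / 7) ^ 3 / 3 + (1 / 7) ^ 5 / 5 \<le> 141898 / 1000000" by (simp add: power_divide)
  then have 1: "arctan (1 / 7) \<le> 141898 / 1000000" using arctan_le_Taylor5[of "1 / 7"] by linarith
  have "(3 / 79 :: real) - (3 / 79) ^ 3 / 3 + (3 / 79) ^ 5 / 5 \<le> 37957 / 1000000" by (simp add: power_divide)
  then have "arctan (3 / 79) \<le> 37957 / 1000000" using arctan_le_Taylor5[of "3 / 79"] by linarith
  with 1 show ?thesis using machin_Euler by linarith
qed

text \<open>Put x = 3 u. By symmetry, twice the tail is at most 1 minus the mass of [-x, x], and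
  exp(-y^2/2) \<ge> 1 - y^2/2 bounds that mass below by (2 x - x^3/3)/sqrt(2 pi). This is at least 2
  u as soon as sqrt(2 pi) \<le> 3 - 4.5 u^2, which still holds at u = 0.33.\<close>

lemma std_normal_cdf_minus_le:
  assumes u: "0 \<le> u" "u \<le> 0.33"
  shows "cdf std_normal_distribution (- (3 * u)) \<le> 1 / 2 - u"
proof -
  interpret N: real_distribution std_normal_distribution by (rule real_dist_normal_dist)
  define x where "x = 3 * u"
  have x0: "0 \<le> x" using u by (simp add: x_def)
  have sing: "measure std_normal_distribution {a} = 0" for a
  proof -
    have "emeasure std_normal_distribution {a} = 0"
      by (subst emeasure_density) (auto intro!: nn_integral_0_iff_AE[THEN iffD2] AE_I'[of "{a}"] simp: indicator_def)
    then show ?thesis by (simp add: measure_def)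
  qed
  have sym: "measure std_normal_distribution {x..} = measure std_normal_distribution {..- x}"
  proof -
    have "emeasure std_normal_distribution {x..} = (\<integral>\<^sup>+y. ennreal (std_normal_density y) * indicator {x..} y \<partial>lborel)"
      by (subst emeasure_density) auto
    also have "\<dots> = (\<integral>\<^sup>+y. ennreal (std_normal_density (- y)) * indicator {x..} (- y) \<partial>lborel)"
      by (subst nn_integral_real_affine[where t=0 and c="-1"]) auto
    also have "\<dots> = (\<integral>\<^sup>+y. ennreal (std_normal_density y) * indicator {..- x} y \<partial>lborel)"
      by (intro nn_integral_cong) (auto simp: std_normal_density_def indicator_def)
    also have "\<dots> = emeasure std_normal_distribution {..- x}"
      by (subst emeasure_density) auto
    finally show ?thesis by (simp add: measure_def)
  qed
  define s where "s = sqrt (2 * pi)"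
  have s0: "s > 0" by (simp add: s_def)
  have dens: "(1 - y\<^sup>2 / 2) / s \<le> std_normal_density y" for y
    using exp_minus_bounds(1)[of "y\<^sup>2 / 2"] by (simp add: std_normal_density_def divide_right_mono s_def)
  have mid: "(2 * x - x ^ 3 / 3) / s \<le> measure std_normal_distribution {-x..x}"
  proof -
    have "((\<lambda>y. (1 - y\<^sup>2 / 2) / s) has_integral
        ((x - x ^ 3 / 6) / s - ((- x) - (- x) ^ 3 / 6) / s)) {-x..x}"
      using x0 s0 by (intro fundamental_theorem_of_calculus)
        (auto simp: has_real_derivative_iff_has_vector_derivative[symmetric] intro!: derivative_eq_intros)
    moreover have i1: "set_integrable lborel {-x..x} (\<lambda>y. (1 - y\<^sup>2 / 2) / s)"
      by (intro borel_integrable_atLeastAtMost' continuous_intros) (use s0 in auto)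
    moreover have i2: "set_integrable lborel {-x..x} std_normal_density"
      unfolding set_integrable_def by (intro integrable_mult_indicator) auto
    ultimately have "(LINT y:{-x..x}|lborel. (1 - y\<^sup>2 / 2) / s) =
        (x - x ^ 3 / 6) / s - ((- x) - (- x) ^ 3 / 6) / s"
      using set_borel_integral_eq_integral(2)[OF i1] integral_unique by metis
    also have "\<dots> = (2 * x - x ^ 3 / 3) / s"
      by (simp add: diff_divide_distrib[symmetric])
    finally have "(2 * x - x ^ 3 / 3) / s = (LINT y:{-x..x}|lborel. (1 - y\<^sup>2 / 2) / s)" ..
    also have "\<dots> \<le> (LINT y:{-x..x}|lborel. std_normal_density y)"
      using i1 i2 dens by (intro set_integral_mono) auto
    also have "\<dots> = measure std_normal_distribution {-x..x}"
    proof -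
      have nn: "0 \<le> (LINT y:{-x..x}|lborel. std_normal_density y)"
        unfolding set_lebesgue_integral_def by (intro integral_nonneg_AE AE_I2) (simp add: indicator_def)
      have "emeasure std_normal_distribution {-x..x} = (\<integral>\<^sup>+y. ennreal (std_normal_density y) * indicator {-x..x} y \<partial>lborel)"
        by (subst emeasure_density) auto
      also have "\<dots> = (\<integral>\<^sup>+y. ennreal (indicator {-x..x} y *\<^sub>R std_normal_density y) \<partial>lborel)"
        by (intro nn_integral_cong) (auto simp: indicator_def)
      also have "\<dots> = ennreal (LINT y:{-x..x}|lborel. std_normal_density y)"
        unfolding set_lebesgue_integral_def using i2
        by (intro nn_integral_eq_integral) (auto simp: set_integrable_def indicator_def)
      finally show ?thesis using nn by (simp add: measure_def)
    qed
    finally show ?thesis .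
  qed
  have "measure std_normal_distribution {..- x} + measure std_normal_distribution {-x..x} + measure std_normal_distribution {x..} \<le> 1"
  proof -
    have "measure std_normal_distribution {-x..x} \<le> measure std_normal_distribution ({-x<..<x} \<union> ({-x} \<union> {x}))"
      by (intro N.finite_measure_mono) auto
    also have "\<dots> \<le> measure std_normal_distribution {-x<..<x} + (measure std_normal_distribution {-x} + measure std_normal_distribution {x})"
      by (intro order_trans[OF measure_Un_le] add_mono order_refl measure_Un_le) auto
    finally have a: "measure std_normal_distribution {-x..x} \<le> measure std_normal_distribution {-x<..<x}" by (simp add: sing)
    have b: "measure std_normal_distribution {x..} \<le> measure std_normal_distribution {x<..}"
    proof -
      have "measure std_normal_distribution {x..} \<le> measure std_normal_distribution ({x<..} \<union> {x})"
        by (intro N.finite_measure_mono) auto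
      also have "\<dots> \<le> measure std_normal_distribution {x<..} + measure std_normal_distribution {x}"
        by (intro measure_Un_le) auto
      finally show ?thesis by (simp add: sing)
    qed
    have "measure std_normal_distribution {..- x} + measure std_normal_distribution {-x<..<x} + measure std_normal_distribution {x<..}
      = measure std_normal_distribution ({..- x} \<union> {-x<..<x} \<union> {x<..})"
    proof -
      have "measure std_normal_distribution ({..- x} \<union> {-x<..<x} \<union> {x<..}) =
        measure std_normal_distribution ({..- x} \<union> {-x<..<x}) + measure std_normal_distribution {x<..}"
        using x0 by (intro N.finite_measure_Union) auto
      also have "measure std_normal_distribution ({..- x} \<union> {-x<..<x}) =
        measure std_normal_distribution {..- x} + measure std_normal_distribution {-x<..<x}"
        using x0 by (intro N.finite_measure_Union) auto
      finally show ?thesis by simp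
    qed
    also have "\<dots> \<le> 1" by (rule N.prob_le_1)
    finally show ?thesis using a b by linarith
  qed
  then have "2 * measure std_normal_distribution {..- x} \<le> 1 - (2 * x - x ^ 3 / 3) / s"
    using mid sym by linarith
  moreover have "2 * u \<le> (2 * x - x ^ 3 / 3) / s"
  proof -
    \<comment> \<open>The value 2.509 fits between sqrt(2 pi), about 2.5067, and 3 - 4.5 * 0.33^2 =
      2.50995.\<close>
    have s: "s \<le> 2.509" unfolding s_def
      using pi_le by (intro real_le_lsqrt) (auto simp: power2_eq_square)
    have "u\<^sup>2 \<le> 0.33\<^sup>2" using u by (intro power_mono) auto
    then have "2.509 \<le> 3 - 4.5 * u\<^sup>2" by (simp add: power2_eq_square)
    with s have "s \<le> 3 - 4.5 * u\<^sup>2" by linarith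
    then have "2 * u * s \<le> 2 * u * (3 - 4.5 * u\<^sup>2)" using u by (intro mult_left_mono) auto
    also have "\<dots> = 2 * x - x ^ 3 / 3" by (simp add: x_def eval_nat_numeral algebra_simps)
    finally show ?thesis using s0 by (simp add: pos_le_divide_eq)
  qed
  ultimately show ?thesis by (simp add: cdf_def x_def)
qed

section \<open>Moments and deviations of i.i.d. sums on product spaces\<close>

lemma AE_PiM_all:
  assumes "prob_space Q" "finite I" "AE x in Q. P x"
  shows "AE x in Pi\<^sub>M I (\<lambda>_. Q). \<forall>i\<in>I. P (x i)"
proof (rule AE_finite_allI[OF assms(2)])
  fix i assume "i \<in> I"
  then show "AE x in Pi\<^sub>M I (\<lambda>_. Q). P (x i)"
    using AE_PiM_component[of I "\<lambda>_. Q" i P] assms by simp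
qed

lemma iid_second_moment:
  fixes X :: "'a \<Rightarrow> real"
  assumes Q: "prob_space Q" and I: "finite I"
    and X [measurable]: "X \<in> borel_measurable Q" and X2: "integrable Q (\<lambda>x. (X x)\<^sup>2)"
    and m: "integral\<^sup>L Q X = 0"
  shows "integrable (Pi\<^sub>M I (\<lambda>_. Q)) (\<lambda>x. (\<Sum>i\<in>I. X (x i))\<^sup>2)"
    and "(\<integral>x. (\<Sum>i\<in>I. X (x i))\<^sup>2 \<partial>Pi\<^sub>M I (\<lambda>_. Q)) = card I * (\<integral>x. (X x)\<^sup>2 \<partial>Q)"
proof -
  interpret Q: prob_space Q by fact
  interpret product_sigma_finite "\<lambda>_. Q" ..
  have i1: "integrable Q X" by (rule Q.square_integrable_imp_integrable[OF X X2])
  have pw: "integrable (Pi\<^sub>M I (\<lambda>_. Q)) (\<lambda>x. X (x i) * X (x j))"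
     "(\<integral>x. X (x i) * X (x j) \<partial>Pi\<^sub>M I (\<lambda>_. Q)) = (if i = j then (\<integral>x. (X x)\<^sup>2 \<partial>Q) else 0)"
    if ij: "i \<in> I" "j \<in> I" for i j
  proof -
    \<comment> \<open>The product of two coordinates is written as a product over all of
      \<open>I\<close>, with factor 1 elsewhere and one squared factor if i = j, so that the
      integral factorizes.\<close>
    define f where "f l = (if l = i then if i = j then (\<lambda>x. (X x)\<^sup>2) else X else if l = j then X else (\<lambda>_. 1))" for l
    have int: "integrable Q (f l)" for l using X2 i1 by (simp add: f_def)
    have eq: "X (x i) * X (x j) = (\<Prod>l\<in>I. f l (x l))" for x
    proof -
      have "(\<Prod>l\<in>I. f l (x l)) = (\<Prod>l\<in>{i, j}. f l (x l))"
        using I ij by (intro prod.mono_neutral_right) (auto simp: f_def)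
      then show ?thesis by (auto simp: f_def power2_eq_square)
    qed
    show "integrable (Pi\<^sub>M I (\<lambda>_. Q)) (\<lambda>x. X (x i) * X (x j))"
      unfolding eq using int by (intro product_integrable_prod I)
    have "(\<integral>x. X (x i) * X (x j) \<partial>Pi\<^sub>M I (\<lambda>_. Q)) = (\<Prod>l\<in>I. integral\<^sup>L Q (f l))"
      unfolding eq using int by (intro product_integral_prod I)
    also have "\<dots> = (\<Prod>l\<in>{i, j}. integral\<^sup>L Q (f l))"
      using I ij by (intro prod.mono_neutral_right) (auto simp: f_def Q.prob_space)
    also have "\<dots> = (if i = j then (\<integral>x. (X x)\<^sup>2 \<partial>Q) else 0)" using m by (auto simp: f_def)
    finally show "(\<integral>x. X (x i) * X (x j) \<partial>Pi\<^sub>M I (\<lambda>_. Q)) = (if i = j then (\<integral>x. (X x)\<^sup>2 \<partial>Q) else 0)" .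
  qed
  have sq: "(\<Sum>i\<in>I. X (x i))\<^sup>2 = (\<Sum>i\<in>I. \<Sum>j\<in>I. X (x i) * X (x j))" for x
    by (simp add: power2_eq_square sum_product)
  show "integrable (Pi\<^sub>M I (\<lambda>_. Q)) (\<lambda>x. (\<Sum>i\<in>I. X (x i))\<^sup>2)"
    unfolding sq using pw by (intro Bochner_Integration.integrable_sum) auto
  have "(\<integral>x. (\<Sum>i\<in>I. X (x i))\<^sup>2 \<partial>Pi\<^sub>M I (\<lambda>_. Q)) = (\<Sum>i\<in>I. \<Sum>j\<in>I. \<integral>x. X (x i) * X (x j) \<partial>Pi\<^sub>M I (\<lambda>_. Q))"
    unfolding sq using pw by (subst Bochner_Integration.integral_sum, force intro: Bochner_Integration.integrable_sum)
      (auto intro!: sum.cong Bochner_Integration.integral_sum)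
  also have "\<dots> = (\<Sum>i\<in>I. \<Sum>j\<in>I. if i = j then (\<integral>x. (X x)\<^sup>2 \<partial>Q) else 0)"
    using pw(2) by (intro sum.cong refl) auto
  also have "\<dots> = card I * (\<integral>x. (X x)\<^sup>2 \<partial>Q)" using I by (simp add: sum.delta)
  finally show "(\<integral>x. (\<Sum>i\<in>I. X (x i))\<^sup>2 \<partial>Pi\<^sub>M I (\<lambda>_. Q)) = card I * (\<integral>x. (X x)\<^sup>2 \<partial>Q)" .
qed

text \<open>Chebyshev's inequality: a nonnegative sum exceeds its mean by at least e card I. The
  rate 1/card I is absorbed into the Berry-Esseen error 1/sqrt n.\<close>

lemma iid_sum_nonneg_prob_le:
  fixes X :: "'a \<Rightarrow> real"
  assumes Q: "prob_space Q" and I: "finite I" "I \<noteq> {}"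
    and X [measurable]: "X \<in> borel_measurable Q" and X2: "integrable Q (\<lambda>x. (X x)\<^sup>2)"
    and e: "0 < e" "integral\<^sup>L Q X \<le> - e"
  shows "\<P>(x in Pi\<^sub>M I (\<lambda>_. Q). 0 \<le> (\<Sum>i\<in>I. X (x i))) \<le> (\<integral>x. (X x - integral\<^sup>L Q X)\<^sup>2 \<partial>Q) / e\<^sup>2 / card I"
proof -
  interpret Q: prob_space Q by fact
  interpret P: prob_space "Pi\<^sub>M I (\<lambda>_. Q)" by (intro prob_space_PiM Q)
  define \<mu> where "\<mu> = integral\<^sup>L Q X"
  have i1: "integrable Q X" by (rule Q.square_integrable_imp_integrable[OF X X2])
  have n: "card I > 0" using I by (simp add: card_gt_0_iff)
  define Y where "Y x = X x - \<mu>" for x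
  have [measurable]: "Y \<in> borel_measurable Q" unfolding Y_def by measurable
  have Y2: "integrable Q (\<lambda>x. (Y x)\<^sup>2)"
    using X2 i1 unfolding Y_def power2_diff by (intro Bochner_Integration.integrable_diff Bochner_Integration.integrable_add) auto
  have Y0: "integral\<^sup>L Q Y = 0" using i1 by (simp add: Y_def[abs_def] \<mu>_def Q.prob_space)
  have "\<P>(x in Pi\<^sub>M I (\<lambda>_. Q). 0 \<le> (\<Sum>i\<in>I. X (x i))) \<le> \<P>(x in Pi\<^sub>M I (\<lambda>_. Q). \<bar>\<Sum>i\<in>I. Y (x i)\<bar> \<ge> card I * e)"
  proof (rule P.finite_measure_mono)
    show "{x \<in> space (Pi\<^sub>M I (\<lambda>_. Q)). 0 \<le> (\<Sum>i\<in>I. X (x i))} \<subseteq> {x \<in> space (Pi\<^sub>M I (\<lambda>_. Q)). \<bar>\<Sum>i\<in>I. Y (x i)\<bar> \<ge> card I * e}"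
    proof safe
      fix x assume "0 \<le> (\<Sum>i\<in>I. X (x i))"
      moreover have "(\<Sum>i\<in>I. Y (x i)) = (\<Sum>i\<in>I. X (x i)) - card I * \<mu>" by (simp add: Y_def sum_subtractf)
      moreover have "card I * \<mu> \<le> card I * (- e)" using e by (intro mult_left_mono) (auto simp: \<mu>_def)
      ultimately show "card I * e \<le> \<bar>\<Sum>i\<in>I. Y (x i)\<bar>" by simp
    qed
  qed measurable
  also have "\<dots> \<le> P.expectation (\<lambda>x. (\<Sum>i\<in>I. Y (x i))\<^sup>2) / (card I * e)\<^sup>2"
    using iid_second_moment(1)[OF Q I(1) _ Y2 Y0] n e by (intro P.second_moment_method) auto
  also have "\<dots> = (\<integral>x. (X x - integral\<^sup>L Q X)\<^sup>2 \<partial>Q) / e\<^sup>2 / card I"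
    using iid_second_moment(2)[OF Q I(1) _ Y2 Y0] n by (simp add: Y_def \<mu>_def power2_eq_square)
  finally show ?thesis .
qed

lemma berry_esseen_PiM:
  "\<exists>C>0. \<forall>(Q::'a measure) X (I::nat set) \<beta> y. prob_space Q \<and> X \<in> borel_measurable Q \<and>
     integrable Q (\<lambda>x. \<bar>X x\<bar> ^ 3) \<and> integrable Q (\<lambda>x. (X x)\<^sup>2) \<and> integral\<^sup>L Q X = 0 \<and> integral\<^sup>L Q (\<lambda>x. (X x)\<^sup>2) = 1 \<and>
     integral\<^sup>L Q (\<lambda>x. \<bar>X x\<bar> ^ 3) \<le> \<beta> \<and> 1 \<le> \<beta> \<and> finite I \<and> I \<noteq> {} \<longrightarrow>
     \<bar>\<P>(x in Pi\<^sub>M I (\<lambda>_. Q). (\<Sum>i\<in>I. X (x i)) / sqrt (card I) \<le> y) - cdf std_normal_distribution y\<bar> \<le> C * \<beta> / sqrt (card I)"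
proof -
  obtain C where C: "C > 0" and be: "\<forall>(M::(nat \<Rightarrow> 'a) measure) (X::nat \<Rightarrow> (nat \<Rightarrow> 'a) \<Rightarrow> real) I \<mu> \<beta> x.
     prob_space M \<and> prob_space.indep_vars M (\<lambda>_. borel) X I \<and> finite I \<and> I \<noteq> {} \<and>
     (\<forall>i\<in>I. distr M borel (X i) = \<mu>) \<and>
     integrable \<mu> (\<lambda>x. x) \<and> integrable \<mu> (\<lambda>x. x\<^sup>2) \<and> integrable \<mu> (\<lambda>x. \<bar>x\<bar> ^ 3) \<and>
     integral\<^sup>L \<mu> (\<lambda>x. x) = 0 \<and> integral\<^sup>L \<mu> (\<lambda>x. x\<^sup>2) = 1 \<and> integral\<^sup>L \<mu> (\<lambda>x. \<bar>x\<bar> ^ 3) \<le> \<beta> \<and> 1 \<le> \<beta> \<longrightarrow>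
     \<bar>\<P>(\<omega> in M. (\<Sum>i\<in>I. X i \<omega>) / sqrt (card I) \<le> x) - cdf std_normal_distribution x\<bar> \<le> C * \<beta> / sqrt (card I)"
    using berry_esseen[where 'a="nat \<Rightarrow> 'a" and 'i=nat] by auto
  have "\<bar>\<P>(x in Pi\<^sub>M I (\<lambda>_. Q). (\<Sum>i\<in>I. X (x i)) / sqrt (card I) \<le> y) - cdf std_normal_distribution y\<bar> \<le> C * \<beta> / sqrt (card I)"
    if Q: "prob_space Q" and X [measurable]: "X \<in> borel_measurable Q" and
      i: "integrable Q (\<lambda>x. \<bar>X x\<bar> ^ 3)" "integrable Q (\<lambda>x. (X x)\<^sup>2)" "integral\<^sup>L Q X = 0" "integral\<^sup>L Q (\<lambda>x. (X x)\<^sup>2) = 1" and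
      \<beta>: "integral\<^sup>L Q (\<lambda>x. \<bar>X x\<bar> ^ 3) \<le> \<beta>" "1 \<le> \<beta>" and I: "finite I" "I \<noteq> {}"
    for Q :: "'a measure" and X :: "'a \<Rightarrow> real" and I :: "nat set" and \<beta> y
  proof (rule be[rule_format, of "Pi\<^sub>M I (\<lambda>_. Q)" "\<lambda>i x. X (x i)" I "distr Q borel X" \<beta> y], intro conjI)
    interpret Q: prob_space Q by fact
    show P: "prob_space (Pi\<^sub>M I (\<lambda>_. Q))" by (intro prob_space_PiM Q)
    interpret P: prob_space "Pi\<^sub>M I (\<lambda>_. Q)" by fact
    show "P.indep_vars (\<lambda>_. borel) (\<lambda>i x. X (x i)) I"
      by (rule P.indep_vars_compose2[OF indep_vars_PiM_coordinates[OF Q I]]) simp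
    show "\<forall>i\<in>I. distr (Pi\<^sub>M I (\<lambda>_. Q)) borel (\<lambda>x. X (x i)) = distr Q borel X"
    proof
      fix j assume j: "j \<in> I"
      have "distr (Pi\<^sub>M I (\<lambda>_. Q)) borel (X \<circ> (\<lambda>x. x j)) = distr (distr (Pi\<^sub>M I (\<lambda>_. Q)) Q (\<lambda>x. x j)) borel X"
        using j by (intro distr_distr[symmetric]) auto
      also have "distr (Pi\<^sub>M I (\<lambda>_. Q)) Q (\<lambda>x. x j) = Q"
        using distr_PiM_component[of I "\<lambda>_. Q" j] j Q by simp
      finally show "distr (Pi\<^sub>M I (\<lambda>_. Q)) borel (\<lambda>x. X (x j)) = distr Q borel X" by (simp add: comp_def)
    qed
    show "integrable (distr Q borel X) (\<lambda>x. x)"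
      using Q.square_integrable_imp_integrable[OF X i(2)] by (simp add: integrable_distr_eq)
  qed (use I \<beta> i X in \<open>auto simp: integrable_distr_eq integral_distr\<close>)
  then show ?thesis using C by blast
qed

lemma (in prob_space) integrable_power_le3:
  fixes X :: "'a \<Rightarrow> real"
  assumes X [measurable]: "random_variable borel X" and i: "integrable M (\<lambda>x. \<bar>X x\<bar> ^ 3)"
  shows "integrable M X" "integrable M (\<lambda>x. (X x)\<^sup>2)"
proof -
  have b: "integrable M (\<lambda>x. 1 + \<bar>X x\<bar> ^ 3)" using i by simp
  have le: "a \<le> 1 + a ^ 3" "a\<^sup>2 \<le> 1 + a ^ 3" if "0 \<le> a" for a :: real
  proof -
    have "a \<le> 1 + a ^ 3 \<and> a\<^sup>2 \<le> 1 + a ^ 3"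
    proof (cases "a \<le> 1")
      case True
      then have "a\<^sup>2 \<le> 1" using that by (simp add: power_le_one)
      moreover have "0 \<le> a ^ 3" using that by simp
      ultimately show ?thesis using True by linarith
    next
      case False
      then have "a ^ 1 \<le> a ^ 3" "a\<^sup>2 \<le> a ^ 3" by (intro power_increasing; simp)+
      then show ?thesis by simp
    qed
    then show "a \<le> 1 + a ^ 3" "a\<^sup>2 \<le> 1 + a ^ 3" by auto
  qed
  show "integrable M X"
    by (rule Bochner_Integration.integrable_bound[OF b X]) (use le(1)[OF abs_ge_zero] in auto)
  show "integrable M (\<lambda>x. (X x)\<^sup>2)"
    by (rule Bochner_Integration.integrable_bound[OF b]) (use le(2)[OF abs_ge_zero] in auto)
qed

lemma (in prob_space) integrable_cube_add:
  fixes X Y :: "'a \<Rightarrow> real"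
  assumes [measurable]: "random_variable borel X" "random_variable borel Y"
    and "integrable M (\<lambda>x. \<bar>X x\<bar> ^ 3)" "integrable M (\<lambda>x. \<bar>Y x\<bar> ^ 3)"
  shows "integrable M (\<lambda>x. \<bar>X x + Y x\<bar> ^ 3)"
proof (rule Bochner_Integration.integrable_bound)
  show "integrable M (\<lambda>x. 8 * (\<bar>X x\<bar> ^ 3 + \<bar>Y x\<bar> ^ 3))" using assms by auto
  have "\<bar>a + b\<bar> ^ 3 \<le> 8 * (\<bar>a\<bar> ^ 3 + \<bar>b\<bar> ^ 3)" for a b :: real
  proof -
    have "\<bar>a + b\<bar> \<le> 2 * max \<bar>a\<bar> \<bar>b\<bar>" by linarith
    then have "\<bar>a + b\<bar> ^ 3 \<le> (2 * max \<bar>a\<bar> \<bar>b\<bar>) ^ 3" by (intro power_mono) auto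
    also have "\<dots> = 8 * (max \<bar>a\<bar> \<bar>b\<bar>) ^ 3" by (simp add: power_mult_distrib)
    also have "\<dots> \<le> 8 * (\<bar>a\<bar> ^ 3 + \<bar>b\<bar> ^ 3)" by (simp add: max_def)
    finally show ?thesis .
  qed
  then show "AE x in M. norm (\<bar>X x + Y x\<bar> ^ 3) \<le> norm (8 * (\<bar>X x\<bar> ^ 3 + \<bar>Y x\<bar> ^ 3))"
    by (intro AE_I2) (simp add: abs_mult power_abs)
qed measurable

lemma integrable_mult_squares:
  fixes X Y :: "'a \<Rightarrow> real"
  assumes [measurable]: "X \<in> borel_measurable M" "Y \<in> borel_measurable M"
    and "integrable M (\<lambda>x. (X x)\<^sup>2)" "integrable M (\<lambda>x. (Y x)\<^sup>2)"
  shows "integrable M (\<lambda>x. X x * Y x)"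
proof (rule Bochner_Integration.integrable_bound)
  show "integrable M (\<lambda>x. (X x)\<^sup>2 + (Y x)\<^sup>2)" using assms by auto
  have "\<bar>a * b\<bar> \<le> a\<^sup>2 + b\<^sup>2" for a b :: real
  proof -
    have "0 \<le> (\<bar>a\<bar> - \<bar>b\<bar>)\<^sup>2" by simp
    then have "2 * \<bar>a * b\<bar> \<le> a\<^sup>2 + b\<^sup>2" by (simp add: power2_diff abs_mult)
    then show ?thesis by linarith
  qed
  then show "AE x in M. norm (X x * Y x) \<le> norm ((X x)\<^sup>2 + (Y x)\<^sup>2)" by simp
qed measurable

text \<open>
  The exact variance of \<open>Z + t U + t\<^sup>2 m\<close> is \<open>F + O(t)\<close>, and \<open>t\<close> is of order \<open>1/sqrt n\<close>,
  so replacing it by \<open>F\<close> costs no more than the Berry--Esseen error.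
\<close>
lemma perturbed_score_sum_prob_le:
  fixes Z U m :: "'a \<Rightarrow> real" and F :: real
  assumes Q: "prob_space Q"
    and meas: "Z \<in> borel_measurable Q" "U \<in> borel_measurable Q" "m \<in> borel_measurable Q"
    and i3: "integrable Q (\<lambda>x. \<bar>Z x\<bar> ^ 3)" "integrable Q (\<lambda>x. \<bar>U x\<bar> ^ 3)" "integrable Q (\<lambda>x. \<bar>m x\<bar> ^ 3)"
    and mom: "integral\<^sup>L Q Z = 0" "integral\<^sup>L Q (\<lambda>x. (Z x)\<^sup>2) = F" "integral\<^sup>L Q U = - F" and F: "0 < F"
  shows "\<exists>C>0. \<exists>t0>0. \<forall>(I::nat set) (n::nat) u. finite I \<and> 1 \<le> n \<and> n \<le> card I \<and> 0 < u \<and> u \<le> 0.33 \<and>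
     3 * u / sqrt (n * F) \<le> t0 \<longrightarrow>
     \<P>(x in Pi\<^sub>M I (\<lambda>_. Q). 0 \<le> (\<Sum>i\<in>I. Z (x i) + 3 * u / sqrt (n * F) * U (x i) + (3 * u / sqrt (n * F))\<^sup>2 * m (x i)))
       \<le> 1 / 2 - u + C / sqrt n"
proof -
  interpret Q: prob_space Q by fact
  note [measurable] = meas
  note i1 = Q.integrable_power_le3(1)[OF meas(1) i3(1)] Q.integrable_power_le3(1)[OF meas(2) i3(2)] Q.integrable_power_le3(1)[OF meas(3) i3(3)]
  note i2 = Q.integrable_power_le3(2)[OF meas(1) i3(1)] Q.integrable_power_le3(2)[OF meas(2) i3(2)] Q.integrable_power_le3(2)[OF meas(3) i3(3)]
  obtain C0 where C0: "C0 > 0" and be: "\<forall>(Q::'a measure) X (I::nat set) \<beta> y. prob_space Q \<and> X \<in> borel_measurable Q \<and>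
     integrable Q (\<lambda>x. \<bar>X x\<bar> ^ 3) \<and> integrable Q (\<lambda>x. (X x)\<^sup>2) \<and> integral\<^sup>L Q X = 0 \<and> integral\<^sup>L Q (\<lambda>x. (X x)\<^sup>2) = 1 \<and>
     integral\<^sup>L Q (\<lambda>x. \<bar>X x\<bar> ^ 3) \<le> \<beta> \<and> 1 \<le> \<beta> \<and> finite I \<and> I \<noteq> {} \<longrightarrow>
     \<bar>\<P>(x in Pi\<^sub>M I (\<lambda>_. Q). (\<Sum>i\<in>I. X (x i)) / sqrt (card I) \<le> y) - cdf std_normal_distribution y\<bar> \<le> C0 * \<beta> / sqrt (card I)"
    using berry_esseen_PiM by auto
  interpret N: real_distribution std_normal_distribution by (rule real_dist_normal_dist)
  define EM where "EM = integral\<^sup>L Q m"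
  define EZU where "EZU = integral\<^sup>L Q (\<lambda>x. Z x * U x)"
  define EZm where "EZm = integral\<^sup>L Q (\<lambda>x. Z x * m x)"
  define EUU where "EUU = integral\<^sup>L Q (\<lambda>x. (U x)\<^sup>2)"
  define EUm where "EUm = integral\<^sup>L Q (\<lambda>x. U x * m x)"
  define Emm where "Emm = integral\<^sup>L Q (\<lambda>x. (m x)\<^sup>2)"
  define c where "c = F + \<bar>EM\<bar>"
  \<comment> \<open>Bounds the change of the variance of Z + t U + t^2 m per unit of
    \<open>t\<close>: one term for each mixed moment in the expansion of the square, using t^j \<le>
    t, and c^2 for the squared mean.\<close>
  define K2 where "K2 = 2 * \<bar>EZU\<bar> + 2 * \<bar>EZm\<bar> + \<bar>EUU\<bar> + 2 * \<bar>EUm\<bar> + \<bar>Emm\<bar> + c\<^sup>2"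
  \<comment> \<open>Dominates the centred summand for every t \<le> 1, so the normalized third
    moment has a bound \<open>\<beta>\<close> independent of \<open>n\<close> and
    \<open>u\<close>.\<close>
  define G where "G x = \<bar>Z x\<bar> + (\<bar>U x\<bar> + (\<bar>m x\<bar> + c))" for x
  have c0: "c > 0" using F by (simp add: c_def add_pos_nonneg)
  have K20: "K2 > 0" using c0 by (simp add: K2_def add_nonneg_pos)
  have [measurable]: "G \<in> borel_measurable Q" unfolding G_def by measurable
  have G3: "integrable Q (\<lambda>x. (G x) ^ 3)"
  proof -
    have "integrable Q (\<lambda>x. \<bar>\<bar>Z x\<bar> + (\<bar>U x\<bar> + (\<bar>m x\<bar> + c))\<bar> ^ 3)"
      using i3 by (intro Q.integrable_cube_add) auto
    moreover have "\<bar>\<bar>Z x\<bar> + (\<bar>U x\<bar> + (\<bar>m x\<bar> + c))\<bar> = G x" for x using c0 by (simp add: G_def)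
    ultimately show ?thesis by simp
  qed
  define K3 where "K3 = integral\<^sup>L Q (\<lambda>x. (G x) ^ 3)"
  define s0 where "s0 = sqrt (F / 2)"
  have s0: "s0 > 0" using F by (simp add: s0_def)
  define \<beta> where "\<beta> = max 1 (K3 / s0 ^ 3)"
  \<comment> \<open>Relative loss in the ratio of drift to standard deviation, which stays at least
    t sqrt F (1 - t K4): the first term comes from the mean of \<open>m\<close>, the second from the
    variance.\<close>
  define K4 where "K4 = \<bar>EM\<bar> / F + K2 / (2 * F)"
  have K4: "K4 > 0" using F K20 by (simp add: K4_def add_nonneg_pos)
  \<comment> \<open>Three requirements: powers of \<open>t\<close> are at most \<open>t\<close>, the
    drift keeps at least half of t F, and the variance stays above F/2. The added 1 avoids dividing
    by a vanishing mean of \<open>m\<close>.\<close>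
  define t0 where "t0 = min 1 (min (F / (2 * (\<bar>EM\<bar> + 1))) (F / (2 * K2)))"
  have t0: "t0 > 0" using F K20 by (simp add: t0_def)
  define C where "C = C0 * \<beta> + K4 / sqrt F"
  have "0 < C0 * \<beta>" using C0 by (simp add: \<beta>_def)
  moreover have "0 < K4 / sqrt F" using K4 F by simp
  ultimately have C: "C > 0" by (simp add: C_def)
  have "\<P>(x in Pi\<^sub>M I (\<lambda>_. Q). 0 \<le> (\<Sum>i\<in>I. Z (x i) + t * U (x i) + t\<^sup>2 * m (x i))) \<le> 1 / 2 - u + C / sqrt n"
    if I: "finite I" and n: "1 \<le> n" "n \<le> card I" and u: "0 < u" "u \<le> 0.33" and t_def: "t = 3 * u / sqrt (n * F)" and tt0: "t \<le> t0"
    for I :: "nat set" and n :: nat and u t :: real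
  proof -
    have nF: "0 < real n * F" using n F by simp
    have t: "0 < t" unfolding t_def using u nF by simp
    have t1: "t \<le> 1" using tt0 by (simp add: t0_def)
    have tEM: "t * \<bar>EM\<bar> \<le> F / 2"
    proof -
      have "t * \<bar>EM\<bar> \<le> F / (2 * (\<bar>EM\<bar> + 1)) * (\<bar>EM\<bar> + 1)"
        using tt0 t F by (intro mult_mono) (auto simp: t0_def)
      also have "\<dots> = F / 2" by (simp add: field_simps)
      finally show ?thesis .
    qed
    have tK2: "t * K2 \<le> F / 2"
    proof -
      have "t * K2 \<le> F / (2 * K2) * K2" using tt0 K20 by (intro mult_right_mono) (auto simp: t0_def)
      also have "\<dots> = F / 2" using K20 by simp
      finally show ?thesis .
    qed
    define V where "V x = Z x + t * U x + t\<^sup>2 * m x" for x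
    have [measurable]: "V \<in> borel_measurable Q" unfolding V_def by measurable
    define \<mu> where "\<mu> = integral\<^sup>L Q V"
    have \<mu>: "\<mu> = - t * F + t\<^sup>2 * EM"
      unfolding \<mu>_def V_def[abs_def] using i1 mom by (simp add: EM_def)
    have iV: "integrable Q V" unfolding V_def[abs_def] using i1 by auto
    have tt: "t\<^sup>2 \<le> t" using t t1 by (simp add: power2_eq_square mult_left_le)
    have \<mu>_neg: "\<mu> \<le> - (t * (F - t * \<bar>EM\<bar>))"
    proof -
      have "t\<^sup>2 * EM \<le> t\<^sup>2 * \<bar>EM\<bar>" by (intro mult_left_mono) auto
      then show ?thesis unfolding \<mu> by (simp add: algebra_simps power2_eq_square)
    qed
    have \<mu>_abs: "\<bar>\<mu>\<bar> \<le> t * c"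
    proof -
      have "\<bar>\<mu>\<bar> \<le> t * F + t\<^sup>2 * \<bar>EM\<bar>" unfolding \<mu> using t F by (intro order_trans[OF abs_triangle_ineq]) (auto simp: abs_mult)
      also have "\<dots> \<le> t * F + t * \<bar>EM\<bar>" using tt by (simp add: mult_right_mono)
      finally show ?thesis by (simp add: c_def algebra_simps)
    qed
    have \<mu>2: "\<mu>\<^sup>2 \<le> t * c\<^sup>2"
    proof -
      have "\<mu>\<^sup>2 \<le> (t * c)\<^sup>2" using \<mu>_abs by (metis abs_ge_zero power2_abs power_mono)
      also have "\<dots> \<le> t * c\<^sup>2" using tt by (simp add: power_mult_distrib mult_right_mono)
      finally show ?thesis .
    qed
    have Vsq: "(V x)\<^sup>2 = (Z x)\<^sup>2 + 2 * t * (Z x * U x) + 2 * t\<^sup>2 * (Z x * m x) + t\<^sup>2 * (U x)\<^sup>2 + 2 * t ^ 3 * (U x * m x) + t ^ 4 * (m x)\<^sup>2" for x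
      by (simp add: V_def algebra_simps eval_nat_numeral)
    have pr: "integrable Q (\<lambda>x. Z x * U x)" "integrable Q (\<lambda>x. Z x * m x)" "integrable Q (\<lambda>x. U x * m x)"
      using i2 by (intro integrable_mult_squares; simp)+
    have iV2: "integrable Q (\<lambda>x. (V x)\<^sup>2)" unfolding Vsq using i2 pr by auto
    have EV2: "integral\<^sup>L Q (\<lambda>x. (V x)\<^sup>2) = F + 2 * t * EZU + 2 * t\<^sup>2 * EZm + t\<^sup>2 * EUU + 2 * t ^ 3 * EUm + t ^ 4 * Emm"
      unfolding Vsq using i2 pr mom by (simp add: EZU_def EZm_def EUU_def EUm_def Emm_def)
    have t3: "t ^ 3 \<le> t" "t ^ 4 \<le> t"
      using power_decreasing[of 1 3 t] power_decreasing[of 1 4 t] t t1 by auto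
    define var where "var = integral\<^sup>L Q (\<lambda>x. (V x)\<^sup>2) - \<mu>\<^sup>2"
    have var: "\<bar>var - F\<bar> \<le> t * K2"
    proof -
      define aZU aZm aUU aUm amm where "aZU = \<bar>EZU\<bar>" and "aZm = \<bar>EZm\<bar>" and "aUU = \<bar>EUU\<bar>" and "aUm = \<bar>EUm\<bar>" and "amm = \<bar>Emm\<bar>"
      note ab = aZU_def aZm_def aUU_def aUm_def amm_def
      have B: "\<bar>t\<^sup>2 * EZm\<bar> \<le> t * aZm" "\<bar>t * EZU\<bar> \<le> t * aZU" "\<bar>t\<^sup>2 * EUU\<bar> \<le> t * aUU"
         "\<bar>t ^ 3 * EUm\<bar> \<le> t * aUm" "\<bar>t ^ 4 * Emm\<bar> \<le> t * amm"
        unfolding abs_mult ab using tt t3 t by (auto intro!: mult_right_mono)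
      note B' = B[THEN abs_le_D1] B[THEN abs_le_D2]
      have K: "t * K2 = 2 * (t * aZU) + 2 * (t * aZm) + t * aUU + 2 * (t * aUm) + t * amm + t * c\<^sup>2"
        by (simp add: K2_def ab algebra_simps)
      have v: "var - F = 2 * (t * EZU) + 2 * (t\<^sup>2 * EZm) + t\<^sup>2 * EUU + 2 * (t ^ 3 * EUm) + t ^ 4 * Emm - \<mu>\<^sup>2"
        by (simp add: var_def EV2)
      have "0 \<le> \<mu>\<^sup>2" "0 \<le> t * c\<^sup>2" using t by simp_all
      then show ?thesis unfolding K v using B' \<mu>2 by (intro abs_leI; linarith)
    qed
    have var_low: "F / 2 \<le> var" using var tK2 by linarith
    have var_pos: "0 < var" using var_low F by linarith
    define \<sigma> where "\<sigma> = sqrt var"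
    have \<sigma>: "\<sigma> > 0" "\<sigma>\<^sup>2 = var" "s0 \<le> \<sigma>" using var_pos var_low by (auto simp: \<sigma>_def s0_def)
    \<comment> \<open>The minus sign turns the event that the sum is nonnegative into a lower tail,
      the form that a distribution function measures.\<close>
    define X where "X x = - (V x - \<mu>) / \<sigma>" for x
    have Xm [measurable]: "X \<in> borel_measurable Q" unfolding X_def by measurable
    have X_le: "\<bar>X x\<bar> ^ 3 \<le> (G x) ^ 3 / s0 ^ 3" for x
    proof -
      have "\<bar>V x - \<mu>\<bar> \<le> G x"
      proof -
        have "\<bar>t * U x\<bar> \<le> 1 * \<bar>U x\<bar>" "\<bar>t\<^sup>2 * m x\<bar> \<le> 1 * \<bar>m x\<bar>"
          unfolding abs_mult using t t1 tt by (intro mult_right_mono; simp)+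
        moreover have "\<bar>\<mu>\<bar> \<le> 1 * c" using \<mu>_abs mult_right_mono[OF t1, of c] c0 by linarith
        moreover have "\<bar>V x - \<mu>\<bar> \<le> \<bar>Z x\<bar> + (\<bar>t * U x\<bar> + (\<bar>t\<^sup>2 * m x\<bar> + \<bar>\<mu>\<bar>))"
          unfolding V_def by (rule order_trans[OF abs_triangle_ineq4])
            (use abs_triangle_ineq[of "Z x + t * U x" "t\<^sup>2 * m x"] abs_triangle_ineq[of "Z x" "t * U x"] in simp)
        ultimately show ?thesis unfolding G_def by simp
      qed
      then have "\<bar>X x\<bar> \<le> G x / s0"
        unfolding X_def abs_divide abs_minus_cancel using \<sigma> s0 by (intro frac_le) auto
      then have "\<bar>X x\<bar> ^ 3 \<le> (G x / s0) ^ 3" by (intro power_mono) auto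
      then show ?thesis by (simp add: power_divide)
    qed
    have iX3: "integrable Q (\<lambda>x. \<bar>X x\<bar> ^ 3)"
    proof (rule Bochner_Integration.integrable_bound)
      show "integrable Q (\<lambda>x. (G x) ^ 3 / s0 ^ 3)" using G3 by simp
      have "\<bar>X x\<bar> ^ 3 \<le> \<bar>(G x) ^ 3 / s0 ^ 3\<bar>" for x
        using X_le[of x] by (rule order_trans) (rule abs_ge_self)
      then show "AE x in Q. norm (\<bar>X x\<bar> ^ 3) \<le> norm ((G x) ^ 3 / s0 ^ 3)" by simp
    qed measurable
    have X3: "integral\<^sup>L Q (\<lambda>x. \<bar>X x\<bar> ^ 3) \<le> \<beta>"
    proof -
      have "integral\<^sup>L Q (\<lambda>x. \<bar>X x\<bar> ^ 3) \<le> integral\<^sup>L Q (\<lambda>x. (G x) ^ 3 / s0 ^ 3)"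
        using iX3 G3 X_le by (intro integral_mono) auto
      then show ?thesis by (simp add: \<beta>_def K3_def)
    qed
    have X0: "integral\<^sup>L Q X = 0"
      unfolding X_def[abs_def] using iV by (simp add: \<mu>_def Q.prob_space)
    have Xsq: "(X x)\<^sup>2 = ((V x)\<^sup>2 - 2 * \<mu> * V x + \<mu>\<^sup>2) / var" for x
      unfolding X_def using \<sigma>(2) by (simp add: power_divide power2_diff power2_minus[of "V x - \<mu>", symmetric] mult_ac)
    have X2: "integrable Q (\<lambda>x. (X x)\<^sup>2)" unfolding Xsq using iV iV2 by auto
    have X2': "integral\<^sup>L Q (\<lambda>x. (X x)\<^sup>2) = 1"
    proof -
      have "integral\<^sup>L Q (\<lambda>x. (X x)\<^sup>2) = (integral\<^sup>L Q (\<lambda>x. (V x)\<^sup>2) - 2 * \<mu> * \<mu> + \<mu>\<^sup>2) / var"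
        unfolding Xsq using iV iV2 by (simp add: \<mu>_def Q.prob_space)
      also have "\<dots> = 1" using var_pos by (simp add: var_def power2_eq_square)
      finally show ?thesis .
    qed
    define N' where "N' = card I"
    have N': "N' > 0" "real n \<le> real N'" "I \<noteq> {}" using n I by (auto simp: N'_def)
    define y where "y = sqrt N' * (\<mu> / \<sigma>)"
    have ev: "0 \<le> (\<Sum>i\<in>I. V (x i)) \<longleftrightarrow> (\<Sum>i\<in>I. X (x i)) / sqrt (card I) \<le> y" for x
    proof -
      have "(\<Sum>i\<in>I. X (x i)) = - ((\<Sum>i\<in>I. V (x i)) - N' * \<mu>) / \<sigma>"
        by (simp add: X_def sum_subtractf N'_def sum_negf flip: sum_divide_distrib)
      moreover have "(\<Sum>i\<in>I. X (x i)) / sqrt N' \<le> y \<longleftrightarrow> (\<Sum>i\<in>I. X (x i)) \<le> y * sqrt N'"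
        using N' by (intro pos_divide_le_eq) simp
      ultimately have "(\<Sum>i\<in>I. X (x i)) / sqrt N' \<le> y \<longleftrightarrow> - ((\<Sum>i\<in>I. V (x i)) - N' * \<mu>) / \<sigma> \<le> y * sqrt N'"
        by simp
      also have "y * sqrt N' = N' * \<mu> / \<sigma>" by (simp add: y_def)
      also have "- ((\<Sum>i\<in>I. V (x i)) - N' * \<mu>) / \<sigma> \<le> N' * \<mu> / \<sigma> \<longleftrightarrow> 0 \<le> (\<Sum>i\<in>I. V (x i))"
        using \<sigma> by (simp add: divide_le_cancel)
      finally show ?thesis by (simp add: N'_def)
    qed
    have y: "y \<le> - (3 * u) + K4 / sqrt (n * F)"
    proof -
      define a where "a = F - t * \<bar>EM\<bar>"
      have a: "0 < a" using tEM F by (simp add: a_def)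
      have "\<mu> \<le> - (t * a)" using \<mu>_neg by (simp add: a_def)
      then have "y \<le> sqrt N' * (- (t * a) / \<sigma>)" unfolding y_def using \<sigma> N'
        by (intro mult_left_mono divide_right_mono) auto
      \<comment> \<open>The drift is negative, so a group with more than \<open>n\<close>
        observations only improves the bound.\<close>
      also have "\<dots> \<le> sqrt n * (- (t * a) / \<sigma>)"
        using N' t a \<sigma> by (simp add: mult_right_mono divide_right_mono)
      also have "\<dots> \<le> sqrt n * (- (t * (F - t * F * K4)) / sqrt F)"
      proof -
        have h1: "\<sigma> \<le> sqrt F * (1 + t * K2 / (2 * F))"
        proof -
          have "var \<le> F * (1 + t * K2 / F)" using var F by (simp add: algebra_simps)
          also have "\<dots> \<le> F * (1 + t * K2 / (2 * F))\<^sup>2"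
            using F by (intro mult_left_mono) (simp_all add: power2_sum)
          finally have "\<sigma> \<le> sqrt (F * (1 + t * K2 / (2 * F))\<^sup>2)" by (simp add: \<sigma>_def)
          also have "\<dots> = sqrt F * (1 + t * K2 / (2 * F))" using t K20 F by (simp add: real_sqrt_mult)
          finally show ?thesis .
        qed
        have h2: "F - t * F * K4 \<le> a * (1 - t * K2 / (2 * F))"
        proof -
          have "a * (1 - t * K2 / (2 * F)) = F - t * \<bar>EM\<bar> - t * K2 / 2 + t * \<bar>EM\<bar> * (t * K2) / (2 * F)"
            using F by (simp add: a_def field_simps)
          moreover have "0 \<le> t * \<bar>EM\<bar> * (t * K2) / (2 * F)" using t K20 F by simp
          moreover have "t * F * K4 = t * \<bar>EM\<bar> + t * K2 / 2" using F by (simp add: K4_def field_simps)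
          ultimately show ?thesis by linarith
        qed
        have h3: "(1 - t * K2 / (2 * F)) * (1 + t * K2 / (2 * F)) \<le> 1"
          by (simp add: algebra_simps flip: power2_eq_square)
        \<comment> \<open>The factors 1 - q and 1 + q, one from \<open>h2\<close> and one from
          \<open>h1\<close>, have product at most 1; this replaces a division by 1 + q.\<close>
        have "(F - t * F * K4) * \<sigma> \<le> a * sqrt F"
        proof -
          define q where "q = t * K2 / (2 * F)"
          have q: "0 \<le> q" "q \<le> 1" using t K20 F tK2 by (auto simp: q_def divide_le_eq)
          have "(F - t * F * K4) * \<sigma> \<le> a * (1 - q) * \<sigma>" using h2 \<sigma> unfolding q_def by (intro mult_right_mono) auto
          also have "\<dots> \<le> a * (1 - q) * (sqrt F * (1 + q))" using h1 a q unfolding q_def[symmetric] by (intro mult_left_mono) auto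
          also have "\<dots> = a * sqrt F * ((1 - q) * (1 + q))" by (simp add: mult_ac)
          also have "\<dots> \<le> a * sqrt F * 1" using h3 a F unfolding q_def[symmetric] by (intro mult_left_mono) auto
          finally show ?thesis by simp
        qed
        then have "(F - t * F * K4) / sqrt F \<le> a / \<sigma>"
          using F \<sigma> by (simp add: divide_simps mult.commute)
        then have "t * ((F - t * F * K4) / sqrt F) \<le> t * (a / \<sigma>)" using t by (intro mult_left_mono) auto
        then have "- (t * a) / \<sigma> \<le> - (t * (F - t * F * K4)) / sqrt F" by simp
        then show ?thesis by (intro mult_left_mono) auto
      qed
      also have "\<dots> = - (sqrt n * sqrt F * t) + sqrt n * sqrt F * t * t * K4"
      proof -
        have "sqrt F * sqrt F = F" using F by simp
        then have e: "F / sqrt F = sqrt F" using F by (simp add: divide_simps)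
        have "- (t * (F - t * F * K4)) / sqrt F = - (t * (F / sqrt F) * (1 - t * K4))" by (simp add: algebra_simps diff_divide_distrib add_divide_distrib)
        then have "sqrt n * (- (t * (F - t * F * K4)) / sqrt F) = sqrt n * (- (t * sqrt F * (1 - t * K4)))"
          unfolding e by (rule arg_cong)
        also have "\<dots> = - (sqrt n * sqrt F * t) + sqrt n * sqrt F * t * t * K4" by (simp add: algebra_simps)
        finally show ?thesis .
      qed
      also have "sqrt n * sqrt F * t = 3 * u" using n F by (simp add: t_def real_sqrt_mult)
      \<comment> \<open>Since 3 u \<le> 0.99 and t = 3 u / sqrt(n F), the second-order term is at
        most K4 / sqrt(n F), an error of Berry-Esseen order.\<close>
      also have "3 * u * t * K4 \<le> K4 / sqrt (n * F)"
      proof -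
        have "3 * u * (3 * u) \<le> 0.99 * 0.99" using u by (intro mult_mono) auto
        then have "3 * u * (3 * u) \<le> 1" by simp
        then have "3 * u * (3 * u) * (K4 / sqrt (n * F)) \<le> 1 * (K4 / sqrt (n * F))" using K4 nF by (intro mult_right_mono) auto
        then show ?thesis by (simp add: t_def)
      qed
      finally show ?thesis by simp
    qed
    have "\<P>(x in Pi\<^sub>M I (\<lambda>_. Q). 0 \<le> (\<Sum>i\<in>I. V (x i))) \<le> cdf std_normal_distribution y + C0 * \<beta> / sqrt (card I)"
    proof -
      have "\<bar>\<P>(x in Pi\<^sub>M I (\<lambda>_. Q). (\<Sum>i\<in>I. X (x i)) / sqrt (card I) \<le> y) - cdf std_normal_distribution y\<bar> \<le> C0 * \<beta> / sqrt (card I)"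
        by (rule be[rule_format], intro conjI) (use Q Xm iX3 X2 X0 X2' X3 I N' in \<open>auto simp: \<beta>_def\<close>)
      then show ?thesis unfolding ev by linarith
    qed
    also have "C0 * \<beta> / sqrt (card I) \<le> C0 * \<beta> / sqrt n"
      using \<open>0 < C0 * \<beta>\<close> n by (intro divide_left_mono) auto
    also have "cdf std_normal_distribution y \<le> cdf std_normal_distribution (- (3 * u)) + K4 / sqrt (n * F)"
    proof -
      have "cdf std_normal_distribution y \<le> cdf std_normal_distribution (- (3 * u) + K4 / sqrt (n * F))"
        by (rule N.cdf_nondecreasing[OF y])
      also have "\<dots> \<le> cdf std_normal_distribution (- (3 * u)) + K4 / sqrt (n * F)"
        using std_normal_cdf_lipschitz[of "- (3 * u) + K4 / sqrt (n * F)" "- (3 * u)"] K4 nF by simp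
      finally show ?thesis .
    qed
    also have "cdf std_normal_distribution (- (3 * u)) \<le> 1 / 2 - u"
      using u by (intro std_normal_cdf_minus_le) auto
    finally have "\<P>(x in Pi\<^sub>M I (\<lambda>_. Q). 0 \<le> (\<Sum>i\<in>I. V (x i))) \<le> 1 / 2 - u + K4 / sqrt (n * F) + C0 * \<beta> / sqrt n" by simp
    also have "\<dots> = 1 / 2 - u + C / sqrt n"
      by (simp add: C_def add_divide_distrib real_sqrt_mult mult.commute)
    finally show ?thesis by (simp add: V_def)
  qed
  then show ?thesis using C t0 by blast
qed

section \<open>Tails of maximum likelihood estimators\<close>

text \<open>Frees the probabilistic argument from densities. \<open>L\<close> is the log-likelihood
  and \<open>L1\<close> its derivative; \<open>Z\<close>, \<open>U\<close>, \<open>m\<close> are the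
  Borel functions that get integrated, and \<open>expand\<close> links the two groups almost
  surely.\<close>

locale score_expansion = prob_space Q for Q :: "'a measure" +
  fixes \<theta>s \<delta> F :: real and L L1 :: "real \<Rightarrow> 'a \<Rightarrow> real" and Z U m :: "'a \<Rightarrow> real"
  assumes \<delta>_pos: "0 < \<delta>"
    and L_measurable: "\<And>\<theta>. \<theta> \<in> {\<theta>s - \<delta>..\<theta>s + \<delta>} \<Longrightarrow> L \<theta> \<in> borel_measurable Q"
    and Z_measurable: "Z \<in> borel_measurable Q" and U_measurable: "U \<in> borel_measurable Q"
    and m_measurable: "m \<in> borel_measurable Q"
    and Z3: "integrable Q (\<lambda>x. \<bar>Z x\<bar> ^ 3)" and U3: "integrable Q (\<lambda>x. \<bar>U x\<bar> ^ 3)"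
    and m3: "integrable Q (\<lambda>x. \<bar>m x\<bar> ^ 3)"
    and EZ: "integral\<^sup>L Q Z = 0" and EZ2: "integral\<^sup>L Q (\<lambda>x. (Z x)\<^sup>2) = F" and EU: "integral\<^sup>L Q U = - F"
    and F_pos: "0 < F"
    and expand: "AE x in Q. 0 \<le> m x \<and> (\<forall>\<theta>\<in>{\<theta>s - \<delta>..\<theta>s + \<delta>}.
        ((\<lambda>\<theta>. L \<theta> x) has_real_derivative L1 \<theta> x) (at \<theta> within {\<theta>s - \<delta>..\<theta>s + \<delta>}) \<and>
        \<bar>L1 \<theta> x - Z x - U x * (\<theta> - \<theta>s)\<bar> \<le> m x * (\<theta> - \<theta>s)\<^sup>2)"
begin

abbreviation (input) "S \<equiv> {\<theta>s - \<delta>..\<theta>s + \<delta>}"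

lemmas meas [measurable] = Z_measurable U_measurable m_measurable

lemmas integrables = integrable_power_le3[OF Z_measurable Z3] integrable_power_le3[OF U_measurable U3]
  integrable_power_le3[OF m_measurable m3]

text \<open>An envelope of \<open>L1\<close> over the interval, read off from the expansion with
  |\<theta> - \<theta>s| \<le> \<delta>; thus a Lipschitz constant of the log-likelihood. As
  \<open>m\<close> is nonnegative only almost surely, its absolute value makes \<open>B\<close>
  nonnegative everywhere.\<close>

definition B :: "'a \<Rightarrow> real" where "B x = \<bar>Z x\<bar> + \<delta> * \<bar>U x\<bar> + \<delta>\<^sup>2 * \<bar>m x\<bar>"

lemma B_measurable [measurable]: "B \<in> borel_measurable Q"
  unfolding B_def by measurable

lemma B_nonneg: "0 \<le> B x"
  using \<delta>_pos by (simp add: B_def)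

lemma B3: "integrable Q (\<lambda>x. \<bar>B x\<bar> ^ 3)"
proof -
  have "integrable Q (\<lambda>x. \<bar>(\<bar>Z x\<bar> + \<delta> * \<bar>U x\<bar>) + \<delta>\<^sup>2 * \<bar>m x\<bar>\<bar> ^ 3)"
    using Z3 U3 m3 by (intro integrable_cube_add) (auto simp: abs_mult power_mult_distrib)
  then show ?thesis by (simp add: B_def)
qed

lemma B_integrable: "integrable Q B" "integrable Q (\<lambda>x. (B x)\<^sup>2)"
  using integrable_power_le3[OF B_measurable B3] by auto

lemma L_lipschitz: "AE x in Q. \<forall>\<theta>\<in>S. \<forall>\<theta>'\<in>S. \<bar>L \<theta> x - L \<theta>' x\<bar> \<le> B x * \<bar>\<theta> - \<theta>'\<bar>"
  using expand
proof eventually_elim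
  case (elim x)
  have "\<bar>L1 \<theta> x\<bar> \<le> B x" if \<theta>: "\<theta> \<in> S" for \<theta>
  proof -
    have d: "\<bar>\<theta> - \<theta>s\<bar> \<le> \<delta>" using \<theta> by auto
    have "\<bar>L1 \<theta> x\<bar> \<le> \<bar>Z x\<bar> + \<bar>U x * (\<theta> - \<theta>s)\<bar> + \<bar>L1 \<theta> x - Z x - U x * (\<theta> - \<theta>s)\<bar>" by linarith
    also have "\<dots> \<le> \<bar>Z x\<bar> + \<delta> * \<bar>U x\<bar> + \<delta>\<^sup>2 * \<bar>m x\<bar>"
    proof (intro add_mono order_refl)
      show "\<bar>U x * (\<theta> - \<theta>s)\<bar> \<le> \<delta> * \<bar>U x\<bar>" using mult_left_mono[OF d, of "\<bar>U x\<bar>"] by (simp add: abs_mult mult.commute)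
      have "(\<theta> - \<theta>s)\<^sup>2 \<le> \<delta>\<^sup>2" using d by (metis abs_ge_zero power2_abs power_mono)
      then have "\<bar>m x\<bar> * (\<theta> - \<theta>s)\<^sup>2 \<le> \<bar>m x\<bar> * \<delta>\<^sup>2" by (intro mult_left_mono) auto
      then show "\<bar>L1 \<theta> x - Z x - U x * (\<theta> - \<theta>s)\<bar> \<le> \<delta>\<^sup>2 * \<bar>m x\<bar>" using elim \<theta> by (fastforce simp: mult.commute)
    qed
    finally show ?thesis by (simp add: B_def)
  qed
  then show ?case
    using elim field_differentiable_bound[of S "\<lambda>\<theta>. L \<theta> x" "\<lambda>\<theta>. L1 \<theta> x" "B x"] by auto
qed

lemma \<theta>s_in: "\<theta>s \<in> S" using \<delta>_pos by simp

lemma L_diff_integrable: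
  assumes "\<theta> \<in> S"
  shows "integrable Q (\<lambda>x. L \<theta> x - L \<theta>s x)" "integrable Q (\<lambda>x. \<bar>L \<theta> x - L \<theta>s x\<bar> ^ 3)"
proof -
  note [measurable] = L_measurable[OF assms] L_measurable[OF \<theta>s_in]
  have le: "AE x in Q. \<bar>L \<theta> x - L \<theta>s x\<bar> \<le> \<delta> * B x"
    using L_lipschitz
  proof eventually_elim
    case (elim x)
    have "\<bar>L \<theta> x - L \<theta>s x\<bar> \<le> B x * \<bar>\<theta> - \<theta>s\<bar>" using elim assms \<theta>s_in by blast
    also have "\<dots> \<le> B x * \<delta>" using assms B_nonneg by (intro mult_left_mono) auto
    finally show ?case by (simp add: mult.commute)
  qed
  have le3: "AE x in Q. \<bar>L \<theta> x - L \<theta>s x\<bar> ^ 3 \<le> \<delta> ^ 3 * \<bar>B x\<bar> ^ 3"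
    using le
  proof eventually_elim
    case (elim x)
    then have "\<bar>L \<theta> x - L \<theta>s x\<bar> ^ 3 \<le> (\<delta> * B x) ^ 3" by (intro power_mono) auto
    then show ?case using B_nonneg[of x] by (simp add: power_mult_distrib)
  qed
  show "integrable Q (\<lambda>x. L \<theta> x - L \<theta>s x)"
  proof (rule Bochner_Integration.integrable_bound)
    show "integrable Q (\<lambda>x. \<delta> * B x)" using B_integrable by simp
    show "AE x in Q. norm (L \<theta> x - L \<theta>s x) \<le> norm (\<delta> * B x)" using le by eventually_elim simp
  qed measurable
  show "integrable Q (\<lambda>x. \<bar>L \<theta> x - L \<theta>s x\<bar> ^ 3)"
  proof (rule Bochner_Integration.integrable_bound)
    show "integrable Q (\<lambda>x. \<delta> ^ 3 * \<bar>B x\<bar> ^ 3)" using B3 by simp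
    show "AE x in Q. norm (\<bar>L \<theta> x - L \<theta>s x\<bar> ^ 3) \<le> norm (\<delta> ^ 3 * \<bar>B x\<bar> ^ 3)" using le3 \<delta>_pos by (simp add: power_abs abs_mult)
  qed measurable
qed

text \<open>The pointwise Lipschitz bound, integrated. Continuity turns pointwise negativity of the
  mean increments into a uniform gap on compact sets.\<close>

lemma KL_continuous: "continuous_on S (\<lambda>\<theta>. \<integral>x. L \<theta> x - L \<theta>s x \<partial>Q)"
proof -
  have "\<bar>(\<integral>x. L \<theta> x - L \<theta>s x \<partial>Q) - (\<integral>x. L \<theta>' x - L \<theta>s x \<partial>Q)\<bar> \<le> (\<integral>x. B x \<partial>Q) * \<bar>\<theta> - \<theta>'\<bar>"
    if "\<theta> \<in> S" "\<theta>' \<in> S" for \<theta> \<theta>'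
  proof -
    note [measurable] = L_measurable[OF that(1)] L_measurable[OF that(2)] L_measurable[OF \<theta>s_in]
    have "(\<integral>x. L \<theta> x - L \<theta>s x \<partial>Q) - (\<integral>x. L \<theta>' x - L \<theta>s x \<partial>Q) = (\<integral>x. (L \<theta> x - L \<theta>s x) - (L \<theta>' x - L \<theta>s x) \<partial>Q)"
      by (rule Bochner_Integration.integral_diff[symmetric]; rule L_diff_integrable(1); rule that)
    also have "\<bar>\<dots>\<bar> \<le> (\<integral>x. B x * \<bar>\<theta> - \<theta>'\<bar> \<partial>Q)"
    proof -
      have "\<bar>\<integral>x. (L \<theta> x - L \<theta>s x) - (L \<theta>' x - L \<theta>s x) \<partial>Q\<bar> \<le> (\<integral>x. \<bar>(L \<theta> x - L \<theta>s x) - (L \<theta>' x - L \<theta>s x)\<bar> \<partial>Q)"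
        by (rule integral_abs_bound)
      also have "\<dots> \<le> (\<integral>x. B x * \<bar>\<theta> - \<theta>'\<bar> \<partial>Q)"
      proof (rule integral_mono_AE)
        show "integrable Q (\<lambda>x. \<bar>(L \<theta> x - L \<theta>s x) - (L \<theta>' x - L \<theta>s x)\<bar>)"
          by (rule integrable_abs, rule Bochner_Integration.integrable_diff; rule L_diff_integrable(1); rule that)
        show "integrable Q (\<lambda>x. B x * \<bar>\<theta> - \<theta>'\<bar>)" using B_integrable by simp
        show "AE x in Q. \<bar>(L \<theta> x - L \<theta>s x) - (L \<theta>' x - L \<theta>s x)\<bar> \<le> B x * \<bar>\<theta> - \<theta>'\<bar>"
          using L_lipschitz by eventually_elim (use that in auto)
      qed
      finally show ?thesis .
    qed
    finally show ?thesis by simp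
  qed
  then have "(\<integral>x. B x \<partial>Q)-lipschitz_on S (\<lambda>\<theta>. \<integral>x. L \<theta> x - L \<theta>s x \<partial>Q)"
    using B_nonneg by (intro lipschitz_onI) (auto simp: dist_real_def intro!: integral_nonneg_AE)
  then show ?thesis by (rule lipschitz_on_continuous_on)
qed

end

text \<open>The integral is minus the Kullback-Leibler divergence. It is added in a second locale
  because proving its sign uses the integrability of the increments, itself derived in
  \<open>score_expansion\<close>.\<close>

locale score_model = score_expansion +
  assumes KL: "\<And>\<theta>. \<theta> \<in> {\<theta>s - \<delta>..\<theta>s + \<delta>} \<Longrightarrow> \<theta> \<noteq> \<theta>s \<Longrightarrow> (\<integral>x. L \<theta> x - L \<theta>s x \<partial>Q) < 0"
begin

text \<open>Wald's consistency argument: finitely many parameters suffice, by the Lipschitz bound.\<close>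
lemma consistency:
  assumes r: "0 < r" "r < \<delta>"
  shows "\<exists>K\<ge>0. \<forall>I::nat set. finite I \<longrightarrow> I \<noteq> {} \<longrightarrow> (\<exists>E\<in>sets (Pi\<^sub>M I (\<lambda>_. Q)). measure (Pi\<^sub>M I (\<lambda>_. Q)) E \<le> K / card I \<and>
    (AE x in Pi\<^sub>M I (\<lambda>_. Q). x \<notin> E \<longrightarrow> (\<forall>\<theta>\<in>S. r \<le> \<bar>\<theta> - \<theta>s\<bar> \<longrightarrow> (\<Sum>i\<in>I. L \<theta> (x i)) < (\<Sum>i\<in>I. L \<theta>s (x i)))))"
proof -
  define A where "A = S \<inter> {\<theta>. r \<le> \<bar>\<theta> - \<theta>s\<bar>}"
  define \<kappa> where "\<kappa> \<theta> = (\<integral>x. L \<theta> x - L \<theta>s x \<partial>Q)" for \<theta>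
  have A: "compact A" unfolding A_def
    by (intro compact_Int_closed closed_Collect_le continuous_intros) auto
  have "\<theta>s + \<delta> \<in> A" using r by (auto simp: A_def)
  then have ne: "A \<noteq> {}" by auto
  have AS: "A \<subseteq> S" by (auto simp: A_def)
  have "continuous_on A \<kappa>" using KL_continuous AS unfolding \<kappa>_def by (rule continuous_on_subset)
  then obtain \<theta>m where \<theta>m: "\<theta>m \<in> A" "\<And>\<theta>. \<theta> \<in> A \<Longrightarrow> \<kappa> \<theta> \<le> \<kappa> \<theta>m"
    using continuous_attains_sup[OF A ne] by blast
  define k0 where "k0 = - \<kappa> \<theta>m"
  have k0: "0 < k0" using KL[of \<theta>m] \<theta>m(1) r by (auto simp: k0_def \<kappa>_def A_def)
  define EB where "EB = integral\<^sup>L Q B"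
  have EB: "0 \<le> EB" using B_nonneg by (auto simp: EB_def intro!: integral_nonneg_AE)
  \<comment> \<open>Mesh of the net: if the average of \<open>B\<close> stays below EB + 1, moving
    to the nearest net point changes the mean log-likelihood by at most k0/4, less than the margin
    k0/2 kept at the net points.\<close>
  define \<eta> where "\<eta> = k0 / (4 * (EB + 1))"
  have \<eta>: "0 < \<eta>" using k0 EB by (simp add: \<eta>_def)
  obtain D where D: "D \<subseteq> A" "finite D" "A \<subseteq> (\<Union>d\<in>D. ball d \<eta>)"
    using compactE_image[OF A, of A "\<lambda>d. ball d \<eta>"] \<eta> by (metis UN_I centre_in_ball open_ball subsetI)
  \<comment> \<open>The bad events are nonnegative sums of \<open>X d\<close> (a net point loses
    less than half of the gap) and of \<open>XB\<close> (the Lipschitz constants are too large on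
    average). Both summands have negative mean, so Chebyshev applies.\<close>
  define X where "X d x = L d x - L \<theta>s x + k0 / 2" for d x
  define XB where "XB x = B x - (EB + 1)" for x
  have X_meas: "X d \<in> borel_measurable Q" if "d \<in> D" for d
    unfolding X_def using that D(1) AS L_measurable \<theta>s_in by (intro borel_measurable_add borel_measurable_diff) auto
  have X_int: "integrable Q (\<lambda>x. (X d x)\<^sup>2)" "integral\<^sup>L Q (X d) \<le> - (k0 / 2)" if "d \<in> D" for d
  proof -
    have dS: "d \<in> S" "d \<in> A" using that D AS by auto
    note [measurable] = L_measurable[OF dS(1)] L_measurable[OF \<theta>s_in]
    note i = L_diff_integrable[OF dS(1)]
    have i2: "integrable Q (\<lambda>x. (L d x - L \<theta>s x)\<^sup>2)" by (rule integrable_power_le3(2)[OF _ i(2)]) measurable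
    have "(X d x)\<^sup>2 = (L d x - L \<theta>s x)\<^sup>2 + k0 * (L d x - L \<theta>s x) + k0\<^sup>2 / 4" for x
      by (simp add: X_def power2_sum power_divide)
    then show "integrable Q (\<lambda>x. (X d x)\<^sup>2)" using i(1) i2 by simp
    have "integral\<^sup>L Q (X d) = \<kappa> d + k0 / 2"
      unfolding X_def[abs_def] \<kappa>_def using i(1) by (simp add: prob_space del: Bochner_Integration.integral_diff)
    then show "integral\<^sup>L Q (X d) \<le> - (k0 / 2)" using \<theta>m(2)[OF dS(2)] by (simp add: k0_def)
  qed
  have XB: "XB \<in> borel_measurable Q" "integrable Q (\<lambda>x. (XB x)\<^sup>2)" "integral\<^sup>L Q XB \<le> - 1"
  proof -
    show "XB \<in> borel_measurable Q" unfolding XB_def by measurable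
    have "(XB x)\<^sup>2 = (B x)\<^sup>2 - 2 * (EB + 1) * B x + (EB + 1)\<^sup>2" for x by (simp add: XB_def power2_diff)
    then show "integrable Q (\<lambda>x. (XB x)\<^sup>2)" using B_integrable by simp
    show "integral\<^sup>L Q XB \<le> - 1" unfolding XB_def[abs_def] using B_integrable by (simp add: EB_def prob_space)
  qed
  define v where "v Y e = (\<integral>x. (Y x - integral\<^sup>L Q Y)\<^sup>2 \<partial>Q) / e\<^sup>2" for Y :: "'a \<Rightarrow> real" and e :: real
  have v0: "0 \<le> v Y e" for Y e unfolding v_def by (intro divide_nonneg_nonneg integral_nonneg_AE) auto
  define K where "K = (\<Sum>d\<in>D. v (X d) (k0 / 2)) + v XB 1"
  show ?thesis
  proof (intro exI[of _ K] allI impI conjI)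
    show "K \<ge> 0" unfolding K_def using v0 by (intro add_nonneg_nonneg sum_nonneg) auto
  next
    fix I :: "nat set" assume I: "finite I" "I \<noteq> {}"
    let ?P = "Pi\<^sub>M I (\<lambda>_. Q)"
    interpret P: prob_space ?P by (intro prob_space_PiM prob_space_axioms)
    have n: "card I > 0" using I by (simp add: card_gt_0_iff)
    define Ev where "Ev Y = {x\<in>space ?P. 0 \<le> (\<Sum>i\<in>I. Y (x i))}" for Y :: "'a \<Rightarrow> real"
    have Ev: "Ev Y \<in> sets ?P" if [measurable]: "Y \<in> borel_measurable Q" for Y unfolding Ev_def by measurable
    define E where "E = (\<Union>d\<in>D. Ev (X d)) \<union> Ev XB"
    have "E \<in> sets ?P" unfolding E_def using Ev X_meas XB D(2) by (intro sets.Un sets.finite_UN) auto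
    moreover have "measure ?P E \<le> K / card I"
    proof -
      have "measure ?P E \<le> measure ?P (\<Union>d\<in>D. Ev (X d)) + measure ?P (Ev XB)"
        unfolding E_def using Ev X_meas XB D(2) by (intro measure_Un_le sets.finite_UN) auto
      also have "measure ?P (\<Union>d\<in>D. Ev (X d)) \<le> (\<Sum>d\<in>D. measure ?P (Ev (X d)))"
        using Ev X_meas D(2) by (intro measure_UNION_le) auto
      also have "\<dots> \<le> (\<Sum>d\<in>D. v (X d) (k0 / 2) / card I)"
        unfolding v_def Ev_def using X_meas X_int k0
        by (intro sum_mono iid_sum_nonneg_prob_le[OF prob_space_axioms I]) auto
      also have "measure ?P (Ev XB) \<le> v XB 1 / card I"
        unfolding v_def Ev_def using XB by (intro iid_sum_nonneg_prob_le[OF prob_space_axioms I]) auto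
      finally show ?thesis by (simp add: K_def add_divide_distrib sum_divide_distrib)
    qed
    moreover have "AE x in ?P. x \<notin> E \<longrightarrow> (\<forall>\<theta>\<in>S. r \<le> \<bar>\<theta> - \<theta>s\<bar> \<longrightarrow> (\<Sum>i\<in>I. L \<theta> (x i)) < (\<Sum>i\<in>I. L \<theta>s (x i)))"
      using AE_PiM_all[OF prob_space_axioms I(1) L_lipschitz] AE_space
    proof eventually_elim
      case (elim x)
      show ?case
      proof (intro impI ballI)
        fix \<theta> assume xE: "x \<notin> E" and \<theta>: "\<theta> \<in> S" "r \<le> \<bar>\<theta> - \<theta>s\<bar>"
        then have "\<theta> \<in> A" by (simp add: A_def)
        then obtain d where d: "d \<in> D" "\<bar>\<theta> - d\<bar> < \<eta>" using D(3) by (force simp: dist_real_def abs_minus_commute)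
        have dS: "d \<in> S" using d D AS by auto
        have "(\<Sum>i\<in>I. X d (x i)) < 0" using xE d(1) elim(2) by (auto simp: E_def Ev_def not_le)
        then have 1: "(\<Sum>i\<in>I. L d (x i)) - (\<Sum>i\<in>I. L \<theta>s (x i)) + card I * (k0 / 2) < 0"
          by (simp add: X_def sum.distrib sum_subtractf)
        have "(\<Sum>i\<in>I. XB (x i)) < 0" using xE elim(2) by (auto simp: E_def Ev_def not_le)
        then have 2: "(\<Sum>i\<in>I. B (x i)) < card I * (EB + 1)"
          by (simp add: XB_def sum_subtractf)
        have "(\<Sum>i\<in>I. L \<theta> (x i)) - (\<Sum>i\<in>I. L d (x i)) = (\<Sum>i\<in>I. L \<theta> (x i) - L d (x i))" by (simp add: sum_subtractf)
        also have "\<dots> \<le> (\<Sum>i\<in>I. B (x i) * \<eta>)"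
        proof (rule sum_mono)
          fix i assume "i \<in> I"
          then have "L \<theta> (x i) - L d (x i) \<le> B (x i) * \<bar>\<theta> - d\<bar>" using elim(1) \<theta>(1) dS by (meson abs_le_D1)
          also have "\<dots> \<le> B (x i) * \<eta>" using d B_nonneg by (intro mult_left_mono) auto
          finally show "L \<theta> (x i) - L d (x i) \<le> B (x i) * \<eta>" .
        qed
        also have "\<dots> = (\<Sum>i\<in>I. B (x i)) * \<eta>" by (simp add: sum_distrib_right)
        also have "\<dots> \<le> card I * (EB + 1) * \<eta>" using 2 \<eta> by (intro mult_right_mono) auto
        also have "\<dots> = card I * (k0 / 4)"
        proof -
          have "(EB + 1) * \<eta> = k0 / 4" unfolding \<eta>_def using EB by (simp add: divide_simps)
          then show ?thesis by (simp only: mult.assoc)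
        qed
        also have "\<dots> < card I * (k0 / 2)" using k0 n by (intro mult_strict_left_mono) auto
        finally show "(\<Sum>i\<in>I. L \<theta> (x i)) < (\<Sum>i\<in>I. L \<theta>s (x i))" using 1 by linarith
      qed
    qed
    ultimately show "\<exists>E\<in>sets ?P. measure ?P E \<le> K / card I \<and>
      (AE x in ?P. x \<notin> E \<longrightarrow> (\<forall>\<theta>\<in>S. r \<le> \<bar>\<theta> - \<theta>s\<bar> \<longrightarrow> (\<Sum>i\<in>I. L \<theta> (x i)) < (\<Sum>i\<in>I. L \<theta>s (x i))))" by blast
  qed
qed

text \<open>
  The remainder quadratic is convex in the deviation, so its sign on \<open>[t, r]\<close> is decided at the
  two deterministic end points, where it is an i.i.d. sum.
\<close>
lemma interior_maximum_imp_sums: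
  assumes I: "finite I" and \<epsilon>: "\<bar>\<epsilon>\<bar> = 1" and t: "0 < t"
    and ex: "\<forall>i\<in>I. 0 \<le> m (x i) \<and> (\<forall>\<theta>\<in>S. ((\<lambda>\<theta>. L \<theta> (x i)) has_real_derivative L1 \<theta> (x i)) (at \<theta> within S) \<and>
        \<bar>L1 \<theta> (x i) - Z (x i) - U (x i) * (\<theta> - \<theta>s)\<bar> \<le> m (x i) * (\<theta> - \<theta>s)\<^sup>2)"
    and max: "\<forall>\<theta>\<in>S. (\<Sum>i\<in>I. L \<theta> (x i)) \<le> (\<Sum>i\<in>I. L \<theta>' (x i))"
    and \<theta>': "\<bar>\<theta>' - \<theta>s\<bar> < \<delta>" "\<bar>\<theta>' - \<theta>s\<bar> \<le> r" "t \<le> \<epsilon> * (\<theta>' - \<theta>s)"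
  shows "0 \<le> (\<Sum>i\<in>I. \<epsilon> * Z (x i) + t * U (x i) + t\<^sup>2 * m (x i)) \<or> 0 \<le> (\<Sum>i\<in>I. \<epsilon> * Z (x i) + r * U (x i) + r\<^sup>2 * m (x i))"
proof -
  have \<theta>'S: "\<theta>' \<in> S" "\<theta>' \<in> interior S" using \<theta>'(1) by (auto simp: abs_less_iff)
  have at: "at \<theta>' within S = at \<theta>'" by (rule at_within_interior[OF \<theta>'S(2)])
  have der: "((\<lambda>\<theta>. \<Sum>i\<in>I. L \<theta> (x i)) has_real_derivative (\<Sum>i\<in>I. L1 \<theta>' (x i))) (at \<theta>')"
    using ex \<theta>'S(1) at by (intro DERIV_sum) metis
  define d where "d = min (\<theta>' - (\<theta>s - \<delta>)) (\<theta>s + \<delta> - \<theta>')"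
  have "(\<Sum>i\<in>I. L1 \<theta>' (x i)) = 0"
  proof (rule DERIV_local_max[OF der])
    show "0 < d" using \<theta>'(1) by (auto simp: d_def abs_less_iff)
    show "\<forall>y. \<bar>\<theta>' - y\<bar> < d \<longrightarrow> (\<Sum>i\<in>I. L y (x i)) \<le> (\<Sum>i\<in>I. L \<theta>' (x i))"
    proof (intro allI impI)
      fix y assume "\<bar>\<theta>' - y\<bar> < d"
      then have "y \<in> S" by (auto simp: d_def abs_less_iff)
      then show "(\<Sum>i\<in>I. L y (x i)) \<le> (\<Sum>i\<in>I. L \<theta>' (x i))" using max by blast
    qed
  qed
  define D where "D = \<epsilon> * (\<theta>' - \<theta>s)"
  have \<epsilon>2: "\<epsilon> * \<epsilon> = 1" using \<epsilon> by (metis abs_mult_self_eq mult_1)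
  have Dsq: "D\<^sup>2 = (\<theta>' - \<theta>s)\<^sup>2" by (simp add: D_def power2_eq_square \<epsilon>2 mult_ac)
  have D: "t \<le> D" "D \<le> r" using \<theta>' \<epsilon> by (auto simp: D_def) (metis abs_ge_self abs_mult mult_1 order_trans)
  define a b c where "a = (\<Sum>i\<in>I. \<epsilon> * Z (x i))" and "b = (\<Sum>i\<in>I. U (x i))" and "c = (\<Sum>i\<in>I. m (x i))"
  have c: "0 \<le> c" unfolding c_def using ex by (intro sum_nonneg) auto
  have q: "(\<Sum>i\<in>I. \<epsilon> * Z (x i) + y * U (x i) + y\<^sup>2 * m (x i)) = a + b * y + c * y\<^sup>2" for y
    by (simp add: a_def b_def c_def sum.distrib sum_distrib_left sum_distrib_right mult.commute)
  have "0 \<le> (\<Sum>i\<in>I. \<epsilon> * Z (x i) + D * U (x i) + D\<^sup>2 * m (x i))"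
  proof -
    have "(\<Sum>i\<in>I. \<epsilon> * L1 \<theta>' (x i)) \<le> (\<Sum>i\<in>I. \<epsilon> * Z (x i) + D * U (x i) + D\<^sup>2 * m (x i))"
    proof (rule sum_mono)
      fix i assume i: "i \<in> I"
      have "\<epsilon> * (L1 \<theta>' (x i) - Z (x i) - U (x i) * (\<theta>' - \<theta>s)) \<le> \<bar>L1 \<theta>' (x i) - Z (x i) - U (x i) * (\<theta>' - \<theta>s)\<bar>"
        using \<epsilon> by (metis abs_ge_self abs_mult mult_1)
      also have "\<dots> \<le> m (x i) * (\<theta>' - \<theta>s)\<^sup>2" using ex i \<theta>'S by blast
      finally show "\<epsilon> * L1 \<theta>' (x i) \<le> \<epsilon> * Z (x i) + D * U (x i) + D\<^sup>2 * m (x i)"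
        unfolding Dsq by (simp add: D_def algebra_simps)
    qed
    then show ?thesis using \<open>(\<Sum>i\<in>I. L1 \<theta>' (x i)) = 0\<close> by (simp flip: sum_distrib_left)
  qed
  then have qD: "0 \<le> a + b * D + c * D\<^sup>2" unfolding q .
  show ?thesis
  proof (rule ccontr)
    assume "\<not> ?thesis"
    then have n: "a + b * t + c * t\<^sup>2 < 0" "a + b * r + c * r\<^sup>2 < 0" unfolding q by auto
    \<comment> \<open>Linear interpolation of the quadratic between \<open>t\<close> and
      \<open>r\<close>, with its exact convexity defect. Being free of division, it also covers t =
      D = r.\<close>
    have "(r - t) * (a + b * D + c * D\<^sup>2) = (r - D) * (a + b * t + c * t\<^sup>2) + (D - t) * (a + b * r + c * r\<^sup>2) - c * (r - t) * (D - t) * (r - D)"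
      by (simp add: algebra_simps power2_eq_square)
    moreover have "0 \<le> c * (r - t) * (D - t) * (r - D)" using c D by simp
    moreover have "(r - D) * (a + b * t + c * t\<^sup>2) \<le> 0" "(D - t) * (a + b * r + c * r\<^sup>2) \<le> 0"
      using n D by (auto intro: mult_nonneg_nonpos)
    moreover have "0 \<le> (r - t) * (a + b * D + c * D\<^sup>2)" using D qD by simp
    ultimately have "(r - D) * (a + b * t + c * t\<^sup>2) = 0" "(D - t) * (a + b * r + c * r\<^sup>2) = 0" by linarith+
    then have "r = D" "D = t" using n by auto
    then show False using n qD by simp
  qed
qed

text \<open>The sign \<open>\<epsilon>\<close> covers both directions, since \<epsilon> Z has the
  moments of \<open>Z\<close>. A deviation beyond \<open>t\<close> implies one of four events: the
  estimator is at least \<open>\<delta>\<close> away, Wald's exceptional event occurs, the sum at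
  the fixed radius \<open>r\<close> is nonnegative (Chebyshev), or the sum at \<open>t\<close> is
  (Berry-Esseen, the main term).\<close>

lemma signed_tail:
  assumes \<epsilon>: "\<bar>\<epsilon>\<bar> = 1"
  shows "\<exists>C>0. \<forall>(I::nat set) (n::nat) u T. finite I \<and> 1 \<le> n \<and> n \<le> card I \<and> 0 < u \<and> u \<le> 0.33 \<and> C / sqrt n \<le> 0.33 \<and>
     T \<in> borel_measurable (Pi\<^sub>M I (\<lambda>_. Q)) \<and>
     (AE x in Pi\<^sub>M I (\<lambda>_. Q). \<bar>T x - \<theta>s\<bar> < \<delta> \<longrightarrow> (\<forall>\<theta>\<in>S. (\<Sum>i\<in>I. L \<theta> (x i)) \<le> (\<Sum>i\<in>I. L (T x) (x i)))) \<longrightarrow>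
     \<P>(x in Pi\<^sub>M I (\<lambda>_. Q). 3 * u / sqrt (n * F) < \<epsilon> * (T x - \<theta>s))
       \<le> 1 / 2 - u + C / sqrt n + \<P>(x in Pi\<^sub>M I (\<lambda>_. Q). \<delta> \<le> \<bar>T x - \<theta>s\<bar>)"
proof -
  have \<epsilon>2: "\<epsilon>\<^sup>2 = 1" using \<epsilon> by (metis one_power2 power2_abs)
  \<comment> \<open>Makes the mean -r F + r^2 E m of the summand at \<open>r\<close> at most -r F/2,
    and keeps \<open>r\<close> strictly inside the interval.\<close>
  define r where "r = min (\<delta> / 2) (F / (2 * (\<bar>integral\<^sup>L Q m\<bar> + 1)))"
  have r0: "0 < r" using \<delta>_pos F_pos by (simp add: r_def)
  have "r \<le> \<delta> / 2" unfolding r_def by (rule min.cobounded1)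
  with r0 have r: "0 < r" "r < \<delta>" using \<delta>_pos by auto
  have rm: "r * \<bar>integral\<^sup>L Q m\<bar> \<le> F / 2"
  proof -
    have "r * \<bar>integral\<^sup>L Q m\<bar> \<le> F / (2 * (\<bar>integral\<^sup>L Q m\<bar> + 1)) * (\<bar>integral\<^sup>L Q m\<bar> + 1)"
      using r F_pos by (intro mult_mono) (auto simp: r_def)
    also have "\<dots> = F / 2" by (simp add: field_simps)
    finally show ?thesis .
  qed
  obtain K1 where K1: "0 \<le> K1" and con: "\<And>I::nat set. finite I \<Longrightarrow> I \<noteq> {} \<Longrightarrow> (\<exists>E\<in>sets (Pi\<^sub>M I (\<lambda>_. Q)). measure (Pi\<^sub>M I (\<lambda>_. Q)) E \<le> K1 / card I \<and>
    (AE x in Pi\<^sub>M I (\<lambda>_. Q). x \<notin> E \<longrightarrow> (\<forall>\<theta>\<in>S. r \<le> \<bar>\<theta> - \<theta>s\<bar> \<longrightarrow> (\<Sum>i\<in>I. L \<theta> (x i)) < (\<Sum>i\<in>I. L \<theta>s (x i)))))"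
    using consistency[OF r] by blast
  define Y where "Y y x = \<epsilon> * Z x + y * U x + y\<^sup>2 * m x" for y x
  have Y_meas [measurable]: "Y y \<in> borel_measurable Q" for y unfolding Y_def by measurable
  have EY: "integral\<^sup>L Q (Y r) \<le> - (r * F / 2)"
  proof -
    have "integral\<^sup>L Q (Y r) = - r * F + r\<^sup>2 * integral\<^sup>L Q m"
      unfolding Y_def[abs_def] using integrables by (simp add: EZ EU)
    also have "r\<^sup>2 * integral\<^sup>L Q m \<le> r * (r * \<bar>integral\<^sup>L Q m\<bar>)"
      by (simp add: power2_eq_square mult.assoc mult_left_mono r(1) less_imp_le)
    also have "\<dots> \<le> r * (F / 2)" using rm r by (intro mult_left_mono) auto
    finally show ?thesis by (simp add: mult.commute)
  qed
  have Y2: "integrable Q (\<lambda>x. (Y r x)\<^sup>2)"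
  proof -
    have "integrable Q (\<lambda>x. \<bar>(\<epsilon> * Z x + r * U x) + r\<^sup>2 * m x\<bar> ^ 3)"
      using Z3 U3 m3 by (intro integrable_cube_add) (auto simp: abs_mult power_mult_distrib)
    then show ?thesis using integrable_power_le3(2)[OF Y_meas, of r] by (simp add: Y_def)
  qed
  define K2 where "K2 = (\<integral>x. (Y r x - integral\<^sup>L Q (Y r))\<^sup>2 \<partial>Q) / (r * F / 2)\<^sup>2"
  have K2: "0 \<le> K2" unfolding K2_def by (intro divide_nonneg_nonneg integral_nonneg_AE) auto
  have "\<exists>C>0. \<exists>t0>0. \<forall>(I::nat set) (n::nat) u. finite I \<and> 1 \<le> n \<and> n \<le> card I \<and> 0 < u \<and> u \<le> 0.33 \<and>
     3 * u / sqrt (n * F) \<le> t0 \<longrightarrow>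
     \<P>(x in Pi\<^sub>M I (\<lambda>_. Q). 0 \<le> (\<Sum>i\<in>I. \<epsilon> * Z (x i) + 3 * u / sqrt (n * F) * U (x i) + (3 * u / sqrt (n * F))\<^sup>2 * m (x i)))
       \<le> 1 / 2 - u + C / sqrt n"
    using Z3 U3 m3 EZ EZ2 EU F_pos \<epsilon>2
    by (intro perturbed_score_sum_prob_le prob_space_axioms) (auto simp: abs_mult power_mult_distrib)
  then obtain C1 t0 where C1: "0 < C1" and t0: "0 < t0" and be: "\<And>(I::nat set) (n::nat) u. finite I \<Longrightarrow> 1 \<le> n \<Longrightarrow> n \<le> card I \<Longrightarrow> 0 < u \<Longrightarrow> u \<le> 0.33 \<Longrightarrow>
     3 * u / sqrt (n * F) \<le> t0 \<Longrightarrow>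
     \<P>(x in Pi\<^sub>M I (\<lambda>_. Q). 0 \<le> (\<Sum>i\<in>I. Y (3 * u / sqrt (n * F)) (x i))) \<le> 1 / 2 - u + C1 / sqrt n"
    unfolding Y_def by blast
  \<comment> \<open>The last summand makes C / sqrt n \<le> 0.33 force \<open>n\<close> to be so
    large that t \<le> t0; the smallness condition thereby serves as the condition of large
    \<open>n\<close>.\<close>
  define C where "C = C1 + K1 + K2 + 1 / (t0 * sqrt F)"
  have C: "0 < C" using C1 K1 K2 t0 F_pos by (simp add: C_def add_pos_nonneg)
  have "\<P>(x in Pi\<^sub>M I (\<lambda>_. Q). t < \<epsilon> * (T x - \<theta>s)) \<le> 1 / 2 - u + C / sqrt n + \<P>(x in Pi\<^sub>M I (\<lambda>_. Q). \<delta> \<le> \<bar>T x - \<theta>s\<bar>)"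
    if I: "finite I" and n: "1 \<le> n" "n \<le> card I" and u: "0 < u" "u \<le> 0.33" and Cn: "C / sqrt n \<le> 0.33"
     and T [measurable]: "T \<in> borel_measurable (Pi\<^sub>M I (\<lambda>_. Q))"
     and max: "AE x in Pi\<^sub>M I (\<lambda>_. Q). \<bar>T x - \<theta>s\<bar> < \<delta> \<longrightarrow> (\<forall>\<theta>\<in>S. (\<Sum>i\<in>I. L \<theta> (x i)) \<le> (\<Sum>i\<in>I. L (T x) (x i)))"
     and t_def: "t = 3 * u / sqrt (n * F)"
    for I :: "nat set" and n :: nat and u t :: real and T
  proof -
    let ?P = "Pi\<^sub>M I (\<lambda>_. Q)"
    interpret P: prob_space ?P by (intro prob_space_PiM prob_space_axioms)
    have ne: "I \<noteq> {}" using n by auto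
    have sn: "1 \<le> sqrt n" using n by simp
    have snn: "1 / real (card I) \<le> 1 / sqrt n"
    proof -
      have "sqrt n \<le> sqrt n * sqrt n" using mult_left_mono[OF sn, of "sqrt n"] by simp
      also have "\<dots> = n" by simp
      finally have "sqrt n \<le> real (card I)" using n by linarith
      moreover have "0 < sqrt n" "0 < real (card I)" using n by auto
      ultimately show ?thesis by (intro divide_left_mono mult_pos_pos) auto
    qed
    have t: "0 < t" using u n F_pos by (simp add: t_def)
    have tt0: "t \<le> t0"
    proof -
      have "1 / (t0 * sqrt F) \<le> C" using C1 K1 K2 by (simp add: C_def)
      also have "C \<le> 0.33 * sqrt n" using Cn sn by (simp add: pos_divide_le_eq)
      finally have "1 \<le> 0.33 * sqrt n * (t0 * sqrt F)" using t0 F_pos by (simp add: pos_divide_le_eq)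
      then have "3 * u * 1 \<le> 0.99 * (0.33 * sqrt n * (t0 * sqrt F))" using u by (intro mult_mono) auto
      also have "\<dots> \<le> 1 * (sqrt n * (t0 * sqrt F))" using t0 F_pos by simp
      finally have "3 * u \<le> t0 * sqrt (n * F)" by (simp add: real_sqrt_mult mult_ac)
      then show ?thesis unfolding t_def using n F_pos by (simp add: pos_divide_le_eq)
    qed
    obtain E where E: "E \<in> sets ?P" "measure ?P E \<le> K1 / card I"
      and Emax: "AE x in ?P. x \<notin> E \<longrightarrow> (\<forall>\<theta>\<in>S. r \<le> \<bar>\<theta> - \<theta>s\<bar> \<longrightarrow> (\<Sum>i\<in>I. L \<theta> (x i)) < (\<Sum>i\<in>I. L \<theta>s (x i)))"
      using con[OF I ne] by blast
    let ?D = "{x\<in>space ?P. \<delta> \<le> \<bar>T x - \<theta>s\<bar>}" and ?V = "\<lambda>y. {x\<in>space ?P. 0 \<le> (\<Sum>i\<in>I. Y y (x i))}"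
    have V: "?V y \<in> sets ?P" for y by measurable
    have D: "?D \<in> sets ?P" by measurable
    have "\<P>(x in ?P. t < \<epsilon> * (T x - \<theta>s)) \<le> measure ?P ((?V t \<union> ?D) \<union> (E \<union> ?V r))"
    proof (rule P.finite_measure_mono_AE)
      show "AE x in ?P. x \<in> {x\<in>space ?P. t < \<epsilon> * (T x - \<theta>s)} \<longrightarrow> x \<in> (?V t \<union> ?D) \<union> (E \<union> ?V r)"
        using Emax max AE_PiM_all[OF prob_space_axioms I expand]
      proof eventually_elim
        case (elim x)
        show ?case
        proof (intro impI, rule ccontr)
          assume a: "x \<in> {x\<in>space ?P. t < \<epsilon> * (T x - \<theta>s)}" and b: "x \<notin> (?V t \<union> ?D) \<union> (E \<union> ?V r)"
          from a b have \<delta>: "\<bar>T x - \<theta>s\<bar> < \<delta>" and xE: "x \<notin> E" by auto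
          then have mx: "\<forall>\<theta>\<in>S. (\<Sum>i\<in>I. L \<theta> (x i)) \<le> (\<Sum>i\<in>I. L (T x) (x i))" using elim(2) by blast
          have "\<bar>T x - \<theta>s\<bar> < r"
          proof (rule ccontr)
            assume "\<not> \<bar>T x - \<theta>s\<bar> < r"
            moreover have "T x \<in> S" using \<delta> by auto
            ultimately have "(\<Sum>i\<in>I. L (T x) (x i)) < (\<Sum>i\<in>I. L \<theta>s (x i))" using elim(1) xE by auto
            then show False using mx \<theta>s_in by fastforce
          qed
          then have "0 \<le> (\<Sum>i\<in>I. Y t (x i)) \<or> 0 \<le> (\<Sum>i\<in>I. Y r (x i))"
            unfolding Y_def using a \<delta> elim(3) mx by (intro interior_maximum_imp_sums[OF I \<epsilon> t]) auto
          then show False using a b by auto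
        qed
      qed
    qed (intro sets.Un E(1) V D)
    also have "\<dots> \<le> (measure ?P (?V t) + measure ?P ?D) + (measure ?P E + measure ?P (?V r))"
      by (rule order_trans[OF measure_Un_le]) (intro add_mono measure_Un_le sets.Un E(1) V D)+
    also have "measure ?P (?V t) \<le> 1 / 2 - u + C1 / sqrt n"
      unfolding t_def using tt0 by (intro be I n u) (simp add: t_def)
    also have "measure ?P (?V r) \<le> K2 / card I"
      unfolding K2_def using r F_pos EY Y2 by (intro iid_sum_nonneg_prob_le[OF prob_space_axioms I ne]) auto
    also have "K2 / card I \<le> K2 / sqrt n" using mult_left_mono[OF snn K2] by simp
    also have "measure ?P E \<le> K1 / sqrt n" using E(2) mult_left_mono[OF snn K1] by simp
    finally have "\<P>(x in ?P. t < \<epsilon> * (T x - \<theta>s)) \<le> 1 / 2 - u + (C1 + K1 + K2) / sqrt n + measure ?P ?D"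
      by (simp add: add_divide_distrib)
    also have "(C1 + K1 + K2) / sqrt n \<le> C / sqrt n"
      using t0 F_pos sn by (intro divide_right_mono) (auto simp: C_def)
    finally show ?thesis by simp
  qed
  then show ?thesis using C by blast
qed

lemma two_sided_tail:
  "\<exists>C>0. \<forall>(I::nat set) (n::nat) u T. finite I \<and> 1 \<le> n \<and> n \<le> card I \<and> 0 < u \<and> u \<le> 0.33 \<and> C / sqrt n \<le> 0.33 \<and>
     T \<in> borel_measurable (Pi\<^sub>M I (\<lambda>_. Q)) \<and>
     (AE x in Pi\<^sub>M I (\<lambda>_. Q). \<bar>T x - \<theta>s\<bar> < \<delta> \<longrightarrow> (\<forall>\<theta>\<in>S. (\<Sum>i\<in>I. L \<theta> (x i)) \<le> (\<Sum>i\<in>I. L (T x) (x i)))) \<longrightarrow>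
     \<P>(x in Pi\<^sub>M I (\<lambda>_. Q). T x > \<theta>s + 3 * u / sqrt (n * F))
       \<le> 1 / 2 - u + C / sqrt n + \<P>(x in Pi\<^sub>M I (\<lambda>_. Q). \<delta> \<le> \<bar>T x - \<theta>s\<bar>) \<and>
     \<P>(x in Pi\<^sub>M I (\<lambda>_. Q). T x < \<theta>s - 3 * u / sqrt (n * F))
       \<le> 1 / 2 - u + C / sqrt n + \<P>(x in Pi\<^sub>M I (\<lambda>_. Q). \<delta> \<le> \<bar>T x - \<theta>s\<bar>)"
proof -
  let ?tail = "\<lambda>\<epsilon> C. \<forall>(I::nat set) (n::nat) u T. finite I \<and> 1 \<le> n \<and> n \<le> card I \<and> 0 < u \<and> u \<le> 0.33 \<and> C / sqrt n \<le> 0.33 \<and>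
     T \<in> borel_measurable (Pi\<^sub>M I (\<lambda>_. Q)) \<and>
     (AE x in Pi\<^sub>M I (\<lambda>_. Q). \<bar>T x - \<theta>s\<bar> < \<delta> \<longrightarrow> (\<forall>\<theta>\<in>S. (\<Sum>i\<in>I. L \<theta> (x i)) \<le> (\<Sum>i\<in>I. L (T x) (x i)))) \<longrightarrow>
     \<P>(x in Pi\<^sub>M I (\<lambda>_. Q). 3 * u / sqrt (n * F) < \<epsilon> * (T x - \<theta>s))
       \<le> 1 / 2 - u + C / sqrt n + \<P>(x in Pi\<^sub>M I (\<lambda>_. Q). \<delta> \<le> \<bar>T x - \<theta>s\<bar>)"
  obtain C1 where C1: "C1 > 0" "?tail 1 C1" using signed_tail[of 1] by auto
  obtain C2 where C2: "C2 > 0" "?tail (- 1) C2" using signed_tail[of "- 1"] by auto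
  define C where "C = max C1 C2"
  have C: "C > 0" "C1 \<le> C" "C2 \<le> C" using C1 C2 by (auto simp: C_def)
  have le: "C1 / sqrt n \<le> C / sqrt n" "C2 / sqrt n \<le> C / sqrt n" for n :: nat
    using C by (auto intro!: divide_right_mono)
  show ?thesis
  proof (intro exI[of _ C] conjI[OF C(1)] allI impI, elim conjE)
    fix I :: "nat set" and n :: nat and u :: real and T
    assume I: "finite I" and n: "1 \<le> n" "n \<le> card I" and u: "0 < u" "u \<le> 0.33" and Cn: "C / sqrt n \<le> 0.33"
     and T: "T \<in> borel_measurable (Pi\<^sub>M I (\<lambda>_. Q))"
     and max: "AE x in Pi\<^sub>M I (\<lambda>_. Q). \<bar>T x - \<theta>s\<bar> < \<delta> \<longrightarrow> (\<forall>\<theta>\<in>S. (\<Sum>i\<in>I. L \<theta> (x i)) \<le> (\<Sum>i\<in>I. L (T x) (x i)))"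
    let ?D = "\<P>(x in Pi\<^sub>M I (\<lambda>_. Q). \<delta> \<le> \<bar>T x - \<theta>s\<bar>)"
    have "\<P>(x in Pi\<^sub>M I (\<lambda>_. Q). 3 * u / sqrt (n * F) < 1 * (T x - \<theta>s)) \<le> 1 / 2 - u + C1 / sqrt n + ?D"
      using order_trans[OF le(1) Cn] I n u T max by (intro C1(2)[rule_format]) auto
    moreover have "\<P>(x in Pi\<^sub>M I (\<lambda>_. Q). 3 * u / sqrt (n * F) < - 1 * (T x - \<theta>s)) \<le> 1 / 2 - u + C2 / sqrt n + ?D"
      using order_trans[OF le(2) Cn] I n u T max by (intro C2(2)[rule_format]) auto
    moreover have "3 * u / sqrt (n * F) < 1 * (T x - \<theta>s) \<longleftrightarrow> T x > \<theta>s + 3 * u / sqrt (n * F)"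
      "3 * u / sqrt (n * F) < - 1 * (T x - \<theta>s) \<longleftrightarrow> T x < \<theta>s - 3 * u / sqrt (n * F)" for x by auto
    ultimately show "\<P>(x in Pi\<^sub>M I (\<lambda>_. Q). T x > \<theta>s + 3 * u / sqrt (n * F)) \<le> 1 / 2 - u + C / sqrt n + ?D \<and>
      \<P>(x in Pi\<^sub>M I (\<lambda>_. Q). T x < \<theta>s - 3 * u / sqrt (n * F)) \<le> 1 / 2 - u + C / sqrt n + ?D"
      using le[of n] by simp
  qed
qed

end

section \<open>Regular families\<close>

text \<open>
  A derivative relative to a closed interval is a limit along one fixed sequence per point, hence
  has a Borel version.
\<close>
lemma ex_borel_derivative:
  fixes f :: "real \<Rightarrow> 'a \<Rightarrow> real"
  assumes lu: "l < u" and f: "\<And>a. a \<in> {l..u} \<Longrightarrow> f a \<in> borel_measurable M"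
  shows "\<exists>g. (\<forall>a\<in>{l..u}. g a \<in> borel_measurable M) \<and>
    (\<forall>a\<in>{l..u}. \<forall>x D. ((\<lambda>a. f a x) has_real_derivative D) (at a within {l..u}) \<longrightarrow> g a x = D)"
proof -
  \<comment> \<open>Each point is approached along the segment towards \<open>u\<close>, and
    \<open>u\<close> itself from the left, so that the sequence stays in the interval and off the
    point.\<close>
  define e where "e a = (if a = u then l else u)" for a
  define pt where "pt a i = a + (e a - a) / (real i + 2)" for a and i :: nat
  have pt: "pt a i \<in> {l..u}" "pt a i \<noteq> a" if "a \<in> {l..u}" for a i
  proof -
    have frac: "0 \<le> c / (real i + 2)" "c / (real i + 2) \<le> c" if "0 \<le> c" for c :: real
      using that by (auto simp: divide_le_eq mult_le_cancel_left1)
    show "pt a i \<in> {l..u}"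
    proof (cases "a = u")
      case True
      have "pt a i = u - (u - l) / (real i + 2)" using True by (simp add: pt_def e_def diff_divide_distrib)
      then show ?thesis unfolding atLeastAtMost_iff using frac[of "u - l"] lu by linarith
    next
      case False
      have "pt a i = a + (u - a) / (real i + 2)" using False by (simp add: pt_def e_def)
      moreover have "l \<le> a" "a \<le> u" using that by auto
      ultimately show ?thesis unfolding atLeastAtMost_iff using frac[of "u - a"] by linarith
    qed
    show "pt a i \<noteq> a" using that lu by (auto simp: pt_def e_def)
  qed
  have lim_pt: "pt a \<longlonglongrightarrow> a" for a
  proof -
    have "(\<lambda>i. a + (e a - a) / (real i + 2)) \<longlonglongrightarrow> a + 0"
      by (intro tendsto_add tendsto_const tendsto_divide_0[OF tendsto_const] filterlim_at_top_imp_at_infinity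
          filterlim_tendsto_add_at_top[of "\<lambda>_. 2", simplified add.commute]) (auto intro: filterlim_real_sequentially)
    then show ?thesis by (simp add: pt_def[abs_def])
  qed
  define g where "g a x = lim (\<lambda>i. (f (pt a i) x - f a x) / (pt a i - a))" for a x
  have "g a \<in> borel_measurable M" if "a \<in> {l..u}" for a
    unfolding g_def using f pt(1)[OF that] that
    by (intro borel_measurable_lim_metric borel_measurable_divide borel_measurable_diff) auto
  moreover have "g a x = D" if a: "a \<in> {l..u}" and D: "((\<lambda>a. f a x) has_real_derivative D) (at a within {l..u})" for a x D
  proof -
    have "((\<lambda>y. (f y x - f a x) / (y - a)) \<longlongrightarrow> D) (at a within {l..u})"
      using D by (simp add: has_field_derivative_iff)
    moreover have "filterlim (pt a) (at a within {l..u}) sequentially"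
      using lim_pt pt[OF a] by (auto simp: filterlim_at)
    ultimately have "(\<lambda>i. (f (pt a i) x - f a x) / (pt a i - a)) \<longlonglongrightarrow> D"
      by (rule filterlim_compose)
    then show ?thesis unfolding g_def by (rule limI)
  qed
  ultimately show ?thesis by blast
qed

text \<open>The moment hypotheses concern the completed law, as the derivatives need not be Borel on
  a null set. A Borel version has the same moments under the law itself, where products and
  independence are handled.\<close>

lemma completion_moment:
  fixes f g :: "'a \<Rightarrow> real"
  assumes ae: "AE x in M. f x = g x" and g: "g \<in> borel_measurable M" and f: "integrable (completion M) f"
  shows "integrable M g" "integral\<^sup>L M g = integral\<^sup>L (completion M) f"
proof -
  have ae': "AE x in completion M. f x = g x" using ae by (rule AE_completion)
  have gc: "g \<in> borel_measurable (completion M)" using g by (rule measurable_completion)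
  have fc: "f \<in> borel_measurable (completion M)" using f by (rule borel_measurable_integrable)
  have "integrable (completion M) g" using f by (subst (asm) integrable_cong_AE[OF fc gc ae'])
  then show "integrable M g" using integrable_completion[OF g] by simp
  show "integral\<^sup>L M g = integral\<^sup>L (completion M) f"
    using integral_cong_AE[OF fc gc ae'] integral_completion[OF g] by simp
qed

context regular_family
begin

abbreviation (input) "S \<equiv> {\<theta>s - \<delta>..\<theta>s + \<delta>}"
abbreviation (input) "Q \<equiv> P \<theta>s"

definition ll :: "real \<Rightarrow> real^'d \<Rightarrow> real" where "ll \<theta> x = real_of_ereal (loglik p x \<theta>)"

lemma S_sub: "\<theta> \<in> S \<Longrightarrow> \<theta> \<in> \<Theta>"
  using interval by blast

lemma \<theta>s_mem: "\<theta>s \<in> S" "\<theta>s \<in> \<Theta>"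
  using \<delta>_pos interval by auto

lemma sets_P: "\<theta> \<in> \<Theta> \<Longrightarrow> sets (P \<theta>) = sets borel"
  by (simp add: density sets_mu)

lemma prob_Q: "prob_space Q"
  using prob \<theta>s_mem by blast

lemma p_meas: "\<theta> \<in> \<Theta> \<Longrightarrow> p \<theta> \<in> borel_measurable \<mu>"
  using p_measurable measurable_cong_sets[OF sets_mu refl] by blast

lemma ll_measurable: "\<theta> \<in> S \<Longrightarrow> ll \<theta> \<in> borel_measurable Q"
proof -
  assume \<theta>: "\<theta> \<in> S"
  note [measurable] = p_measurable[OF S_sub[OF \<theta>]]
  have "ll \<theta> = (\<lambda>x. if p \<theta> x = 0 then 0 else ln (p \<theta> x))" by (auto simp: ll_def loglik_def)
  also have "\<dots> \<in> borel_measurable borel" by measurable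
  finally show ?thesis using measurable_cong_sets[OF sets_P[OF \<theta>s_mem(2)] refl] by blast
qed

lemma AE_mu_Q: "AE x in \<mu>. R x \<Longrightarrow> AE x in Q. R x"
  using p_meas[OF \<theta>s_mem(2)] unfolding density[OF \<theta>s_mem(2)]
  by (subst AE_density) (auto elim: eventually_mono)

definition good :: "real^'d \<Rightarrow> bool" where
  "good x \<longleftrightarrow> (\<forall>\<theta>\<in>S. \<bar>loglik p x \<theta>\<bar> \<noteq> \<infinity>) \<and> (\<lambda>\<theta>. real_of_ereal (loglik p x \<theta>)) thrice_differentiable_on S"

lemma AE_good: "AE x in \<mu>. good x" "AE x in Q. good x"
  using loglik_smooth AE_mu_Q unfolding good_def by auto

lemma good_pos: "good x \<Longrightarrow> \<theta> \<in> S \<Longrightarrow> 0 < p \<theta> x"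
  and good_loglik: "good x \<Longrightarrow> \<theta> \<in> S \<Longrightarrow> loglik p x \<theta> = ereal (ll \<theta> x)"
  and good_ll: "good x \<Longrightarrow> \<theta> \<in> S \<Longrightarrow> ll \<theta> x = ln (p \<theta> x)"
proof -
  assume g: "good x" and \<theta>: "\<theta> \<in> S"
  have "p \<theta> x \<noteq> 0" using g \<theta> by (force simp: good_def loglik_def)
  then show "0 < p \<theta> x" using p_nonneg[OF S_sub[OF \<theta>], of x] by simp
  show "loglik p x \<theta> = ereal (ll \<theta> x)" "ll \<theta> x = ln (p \<theta> x)" using \<open>p \<theta> x \<noteq> 0\<close> by (auto simp: ll_def loglik_def)
qed

lemma good_deriv:
  assumes "good x" "k < 3" "\<theta> \<in> S"
  shows "(dloglik S p k x has_real_derivative dloglik S p (Suc k) x \<theta>) (at \<theta> within S)"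
proof -
  have "(deriv_within S ^^ k) (\<lambda>\<theta>. real_of_ereal (loglik p x \<theta>)) differentiable (at \<theta> within S)"
    using assms unfolding good_def thrice_differentiable_on_def differentiable_on_def by blast
  then show ?thesis
    by (simp add: dloglik_def deriv_within_def has_real_derivative_iff_has_vector_derivative vector_derivative_works)
qed

lemma dloglik_0: "dloglik S p 0 x = (\<lambda>\<theta>. ll \<theta> x)"
  by (simp add: dloglik_def ll_def)

lemma good_continuous: "good x \<Longrightarrow> continuous_on S (\<lambda>\<theta>. ll \<theta> x)"
  using good_deriv[of x 0] unfolding dloglik_0 by (intro DERIV_continuous_on) auto

text \<open>The mean value theorem for either order of the two points. The distance clause allows a
  Lipschitz bound at the intermediate point to be replaced by one at \<open>a\<close>.\<close>

lemma good_mvt: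
  assumes "good x" "k < 3" "a \<in> S" "b \<in> S"
  obtains \<xi> where "\<xi> \<in> S" "\<bar>\<xi> - b\<bar> \<le> \<bar>a - b\<bar>" "dloglik S p k x a - dloglik S p k x b = dloglik S p (Suc k) x \<xi> * (a - b)"
proof -
  let ?l = "min a b" and ?u = "max a b"
  have "\<exists>\<xi>\<in>{?l..?u}. dloglik S p k x ?u - dloglik S p k x ?l = dloglik S p (Suc k) x \<xi> * (?u - ?l)"
  proof (rule mvt_very_simple)
    fix y assume "?l \<le> y" "y \<le> ?u"
    then have "y \<in> S" "{?l..?u} \<subseteq> S" using assms by auto
    then show "(dloglik S p k x has_derivative (*) (dloglik S p (Suc k) x y)) (at y within {?l..?u})"
      using good_deriv[OF assms(1,2)] by (meson has_field_derivative_def has_field_derivative_subset)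
  qed simp
  then obtain \<xi> where \<xi>: "\<xi> \<in> {?l..?u}" "dloglik S p k x ?u - dloglik S p k x ?l = dloglik S p (Suc k) x \<xi> * (?u - ?l)" by blast
  show ?thesis
  proof (rule that)
    show "\<xi> \<in> S" using \<xi>(1) assms by (auto simp: min_def max_def split: if_splits)
    show "\<bar>\<xi> - b\<bar> \<le> \<bar>a - b\<bar>" using \<xi>(1) by (auto simp: min_def max_def split: if_splits)
    show "dloglik S p k x a - dloglik S p k x b = dloglik S p (Suc k) x \<xi> * (a - b)"
      using \<xi>(2) by (auto simp: min_def max_def algebra_simps split: if_splits)
  qed
qed

text \<open>
  The supremum of the third derivative need not be measurable, but the Lipschitz constant at
  \<open>\<theta>s\<close> of the second derivative is a supremum over a countable set, and it is all the Taylor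
  expansion needs.
\<close>
lemma ex_lipschitz_second_derivative:
  assumes g2: "\<And>a. a \<in> S \<Longrightarrow> g2 a \<in> borel_measurable Q"
    and g2_eq: "\<And>a x. good x \<Longrightarrow> a \<in> S \<Longrightarrow> g2 a x = dloglik S p 2 x a"
  shows "\<exists>m. m \<in> borel_measurable Q \<and> integrable Q (\<lambda>x. \<bar>m x\<bar> ^ 3) \<and>
     (AE x in Q. 0 \<le> m x \<and> (\<forall>\<theta>\<in>S. \<bar>dloglik S p 2 x \<theta> - dloglik S p 2 x \<theta>s\<bar> \<le> m x * \<bar>\<theta> - \<theta>s\<bar>))"
proof -
  obtain T where T: "countable T" "T \<subseteq> S - {\<theta>s}" "S - {\<theta>s} \<subseteq> closure T"
    using separable by blast
  have clT: "closure T \<subseteq> S" using T(2) by (intro closure_minimal) auto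
  \<comment> \<open>Difference quotients of the second derivative, cubed to match the moment
    hypothesis: by the mean value theorem each is at most the supremum of the cubed third
    derivative.\<close>
  define q where "q a x = (\<bar>g2 a x - g2 \<theta>s x\<bar> / \<bar>a - \<theta>s\<bar>) ^ 3" for a x
  define W where "W x = (SUP a\<in>T. ennreal (q a x))" for x
  have [measurable]: "g2 \<theta>s \<in> borel_measurable Q" using g2 \<theta>s_mem by blast
  have W [measurable]: "W \<in> borel_measurable Q"
    unfolding W_def
  proof (rule borel_measurable_SUP[OF T(1)])
    fix a assume "a \<in> T"
    then have [measurable]: "g2 a \<in> borel_measurable Q" using g2 T(2) by blast
    show "(\<lambda>x. ennreal (q a x)) \<in> borel_measurable Q" unfolding q_def by measurable
  qed
  have q_le: "q a x \<le> \<bar>dloglik S p 3 x \<xi>\<bar> ^ 3" if "good x" "a \<in> T"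
     "dloglik S p 2 x a - dloglik S p 2 x \<theta>s = dloglik S p (Suc 2) x \<xi> * (a - \<theta>s)" for x a \<xi>
  proof -
    have a: "a \<in> S" "a \<noteq> \<theta>s" using that(2) T(2) by auto
    have "\<bar>g2 a x - g2 \<theta>s x\<bar> = \<bar>dloglik S p 3 x \<xi>\<bar> * \<bar>a - \<theta>s\<bar>"
      using that g2_eq[OF that(1)] a \<theta>s_mem by (simp add: abs_mult eval_nat_numeral)
    then show ?thesis using a by (simp add: q_def)
  qed
  have "AE x in Q. W x \<le> (SUP \<theta>\<in>S. ennreal (\<bar>dloglik S p 3 x \<theta>\<bar> ^ 3))"
    using AE_good(2)
  proof eventually_elim
    case (elim x)
    show ?case unfolding W_def
    proof (rule SUP_least)
      fix a assume a: "a \<in> T"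
      then have aS: "a \<in> S" using T(2) by auto
      obtain \<xi> where \<xi>: "\<xi> \<in> S" "dloglik S p 2 x a - dloglik S p 2 x \<theta>s = dloglik S p (Suc 2) x \<xi> * (a - \<theta>s)"
        using good_mvt[OF elim, of 2 a \<theta>s] aS \<theta>s_mem by auto
      have "ennreal (q a x) \<le> ennreal (\<bar>dloglik S p 3 x \<xi>\<bar> ^ 3)" using q_le[OF elim a \<xi>(2)] by (rule ennreal_leI)
      also have "\<dots> \<le> (SUP \<theta>\<in>S. ennreal (\<bar>dloglik S p 3 x \<theta>\<bar> ^ 3))" using \<xi>(1) by (rule SUP_upper)
      finally show "ennreal (q a x) \<le> (SUP \<theta>\<in>S. ennreal (\<bar>dloglik S p 3 x \<theta>\<bar> ^ 3))" .
    qed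
  qed
  then have "(\<integral>\<^sup>+x. W x \<partial>Q) \<le> (\<integral>\<^sup>+x. (SUP \<theta>\<in>S. ennreal (\<bar>dloglik S p 3 x \<theta>\<bar> ^ 3)) \<partial>Q)"
    by (rule nn_integral_mono_AE)
  also have "\<dots> < \<infinity>" using d3_third_moment by (simp add: nn_integral_completion)
  finally have Wfin: "(\<integral>\<^sup>+x. W x \<partial>Q) < \<infinity>" .
  then have W_AE: "AE x in Q. W x \<noteq> \<infinity>" by (intro nn_integral_PInf_AE) auto
  \<comment> \<open>Undoes the cube. Where \<open>W\<close> is infinite, a null set,
    \<open>enn2real\<close> returns 0.\<close>
  define m where "m x = root 3 (enn2real (W x))" for x
  have m0: "0 \<le> m x" for x by (simp add: m_def)
  have m3: "\<bar>m x\<bar> ^ 3 = enn2real (W x)" for x using m0[of x] by (simp add: m_def)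
  have "m \<in> borel_measurable Q" unfolding m_def by measurable
  moreover have "integrable Q (\<lambda>x. \<bar>m x\<bar> ^ 3)"
    unfolding m3
  proof (rule integrableI_nn_integral_finite[where x="enn2real (\<integral>\<^sup>+x. W x \<partial>Q)"])
    have "(\<integral>\<^sup>+x. ennreal (enn2real (W x)) \<partial>Q) = (\<integral>\<^sup>+x. W x \<partial>Q)"
      using W_AE by (intro nn_integral_cong_AE) (auto elim!: eventually_mono simp: top.not_eq_extremum)
    then show "(\<integral>\<^sup>+x. ennreal (enn2real (W x)) \<partial>Q) = ennreal (enn2real (\<integral>\<^sup>+x. W x \<partial>Q))" using Wfin by simp
  qed auto
  moreover have "AE x in Q. 0 \<le> m x \<and> (\<forall>\<theta>\<in>S. \<bar>dloglik S p 2 x \<theta> - dloglik S p 2 x \<theta>s\<bar> \<le> m x * \<bar>\<theta> - \<theta>s\<bar>)"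
    using AE_good(2) W_AE
  proof eventually_elim
    case (elim x)
    have cont: "continuous_on S (dloglik S p 2 x)"
      using good_deriv[OF elim(1), of 2] by (intro DERIV_continuous_on) auto
    have T_le: "\<bar>dloglik S p 2 x a - dloglik S p 2 x \<theta>s\<bar> \<le> m x * \<bar>a - \<theta>s\<bar>" if "a \<in> T" for a
    proof -
      have a: "a \<in> S" "a \<noteq> \<theta>s" using that T(2) by auto
      have "ennreal (q a x) \<le> W x" unfolding W_def using that by (rule SUP_upper)
      then have "enn2real (ennreal (q a x)) \<le> enn2real (W x)" using elim(2) by (intro enn2real_mono) (auto simp: top.not_eq_extremum)
      then have "q a x \<le> enn2real (W x)" by (simp add: q_def)
      then have "root 3 (q a x) \<le> m x" by (simp add: m_def)
      moreover have "root 3 (q a x) = \<bar>g2 a x - g2 \<theta>s x\<bar> / \<bar>a - \<theta>s\<bar>" unfolding q_def by (rule real_root_power_cancel) auto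
      ultimately show ?thesis using a g2_eq[OF elim(1)] \<theta>s_mem by (simp add: pos_divide_le_eq)
    qed
    have "\<bar>dloglik S p 2 x \<theta> - dloglik S p 2 x \<theta>s\<bar> - m x * \<bar>\<theta> - \<theta>s\<bar> \<le> 0" if "\<theta> \<in> S" for \<theta>
    proof (cases "\<theta> = \<theta>s")
      case False
      \<comment> \<open>The second derivative is differentiable, hence continuous, so the bound
        extends from the dense set \<open>T\<close> to the whole interval.\<close>
      have "continuous_on (closure T) (\<lambda>\<theta>. \<bar>dloglik S p 2 x \<theta> - dloglik S p 2 x \<theta>s\<bar> - m x * \<bar>\<theta> - \<theta>s\<bar>)"
        by (intro continuous_intros continuous_on_subset[OF cont clT])
      then show ?thesis
        by (rule continuous_le_on_closure) (use False that T(3) T_le in auto)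
    qed simp
    then show ?case using m0 by auto
  qed
  ultimately show ?thesis by blast
qed

text \<open>Borel versions of both derivatives come from applying \<open>ex_borel_derivative\<close>
  twice, which requires \<open>g1\<close> on the whole interval and not just at
  \<open>\<theta>s\<close>. The quadratic remainder follows from the mean value theorem for the
  first derivative and the Lipschitz constant \<open>m\<close> of the second.\<close>

lemma ex_score_expansion:
  "\<exists>Z U m. score_expansion Q \<theta>s \<delta> (fisher_info S P p \<theta>s) ll (\<lambda>\<theta> x. dloglik S p 1 x \<theta>) Z U m"
proof -
  have lu: "\<theta>s - \<delta> < \<theta>s + \<delta>" using \<delta>_pos by simp
  obtain g1 where g1: "\<And>a. a \<in> S \<Longrightarrow> g1 a \<in> borel_measurable Q" and
    g1D: "\<And>a x D. a \<in> S \<Longrightarrow> ((\<lambda>a. ll a x) has_real_derivative D) (at a within S) \<Longrightarrow> g1 a x = D"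
    using ex_borel_derivative[OF lu, of ll Q] ll_measurable by blast
  have g1_eq: "g1 a x = dloglik S p 1 x a" if "good x" "a \<in> S" for a x
    using good_deriv[OF that(1), of 0 a] that by (intro g1D) (simp_all add: dloglik_0)
  obtain g2 where g2: "\<And>a. a \<in> S \<Longrightarrow> g2 a \<in> borel_measurable Q" and
    g2D: "\<And>a x D. a \<in> S \<Longrightarrow> ((\<lambda>a. g1 a x) has_real_derivative D) (at a within S) \<Longrightarrow> g2 a x = D"
    using ex_borel_derivative[OF lu, of g1 Q] g1 by blast
  have g2_eq: "g2 a x = dloglik S p 2 x a" if "good x" "a \<in> S" for a x
  proof (rule g2D[OF that(2)])
    have "(dloglik S p 1 x has_real_derivative dloglik S p 2 x a) (at a within S)"
      using good_deriv[OF that(1), of 1 a] that(2) by (simp add: numeral_2_eq_2)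
    then show "((\<lambda>a. g1 a x) has_real_derivative dloglik S p 2 x a) (at a within S)"
      by (rule has_field_derivative_transform_within[where d=1]) (use that g1_eq in auto)
  qed
  obtain m where m: "m \<in> borel_measurable Q" "integrable Q (\<lambda>x. \<bar>m x\<bar> ^ 3)"
    "AE x in Q. 0 \<le> m x \<and> (\<forall>\<theta>\<in>S. \<bar>dloglik S p 2 x \<theta> - dloglik S p 2 x \<theta>s\<bar> \<le> m x * \<bar>\<theta> - \<theta>s\<bar>)"
    using ex_lipschitz_second_derivative[OF g2 g2_eq] by blast
  define Z U where "Z = g1 \<theta>s" and "U = g2 \<theta>s"
  have Zm [measurable]: "Z \<in> borel_measurable Q" and Um [measurable]: "U \<in> borel_measurable Q"
    using g1 g2 \<theta>s_mem by (auto simp: Z_def U_def)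
  have Zae: "AE x in Q. dloglik S p 1 x \<theta>s = Z x" and Uae: "AE x in Q. dloglik S p 2 x \<theta>s = U x"
    using AE_good(2) g1_eq g2_eq \<theta>s_mem by (auto elim!: eventually_mono simp: Z_def U_def)
  have "score_expansion Q \<theta>s \<delta> (fisher_info S P p \<theta>s) ll (\<lambda>\<theta> x. dloglik S p 1 x \<theta>) Z U m"
    unfolding score_expansion_def score_expansion_axioms_def
  proof (intro conjI allI impI)
    show "prob_space Q" by (rule prob_Q)
    show "0 < \<delta>" by (rule \<delta>_pos)
    show "ll \<theta> \<in> borel_measurable Q" if "\<theta> \<in> S" for \<theta> using that by (rule ll_measurable)
    show "Z \<in> borel_measurable Q" "U \<in> borel_measurable Q" by fact+
    show "m \<in> borel_measurable Q" "integrable Q (\<lambda>x. \<bar>m x\<bar> ^ 3)" by fact+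
    show "integrable Q (\<lambda>x. \<bar>Z x\<bar> ^ 3)"
      by (rule completion_moment(1)[OF _ _ score_third_moment]) (use Zae in \<open>auto elim: eventually_mono\<close>)
    show "integrable Q (\<lambda>x. \<bar>U x\<bar> ^ 3)"
      by (rule completion_moment(1)[OF _ _ d2_third_moment]) (use Uae in \<open>auto elim: eventually_mono\<close>)
    show "integral\<^sup>L Q Z = 0"
      using completion_moment(2)[OF Zae Zm score_integrable] score_mean by simp
    show "integral\<^sup>L Q (\<lambda>x. (Z x)\<^sup>2) = fisher_info S P p \<theta>s"
      unfolding fisher_info_def
      by (rule completion_moment(2)[OF _ _ score_sq_integrable]) (use Zae in \<open>auto elim: eventually_mono\<close>)
    show "integral\<^sup>L Q U = - fisher_info S P p \<theta>s"
      using completion_moment(2)[OF Uae Um d2_integrable] fisher_info_eq by simp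
    show "0 < fisher_info S P p \<theta>s" by (rule fisher_info_pos)
    show "AE x in Q. 0 \<le> m x \<and> (\<forall>\<theta>\<in>S. ((\<lambda>\<theta>. ll \<theta> x) has_real_derivative dloglik S p 1 x \<theta>) (at \<theta> within S) \<and>
        \<bar>dloglik S p 1 x \<theta> - Z x - U x * (\<theta> - \<theta>s)\<bar> \<le> m x * (\<theta> - \<theta>s)\<^sup>2)"
      using AE_good(2) m(3) Zae Uae
    proof eventually_elim
      case (elim x)
      have "((\<lambda>\<theta>. ll \<theta> x) has_real_derivative dloglik S p 1 x \<theta>) (at \<theta> within S)" if "\<theta> \<in> S" for \<theta>
        using good_deriv[OF elim(1), of 0 \<theta>] that by (simp add: dloglik_0)
      moreover have "\<bar>dloglik S p 1 x \<theta> - Z x - U x * (\<theta> - \<theta>s)\<bar> \<le> m x * (\<theta> - \<theta>s)\<^sup>2" if \<theta>: "\<theta> \<in> S" for \<theta>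
      proof -
        obtain \<xi> where \<xi>: "\<xi> \<in> S" "\<bar>\<xi> - \<theta>s\<bar> \<le> \<bar>\<theta> - \<theta>s\<bar>" "dloglik S p 1 x \<theta> - dloglik S p 1 x \<theta>s = dloglik S p (Suc 1) x \<xi> * (\<theta> - \<theta>s)"
          using good_mvt[OF elim(1), of 1 \<theta> \<theta>s] \<theta> \<theta>s_mem by auto
        have "dloglik S p 1 x \<theta> - Z x - U x * (\<theta> - \<theta>s) = (dloglik S p 2 x \<xi> - dloglik S p 2 x \<theta>s) * (\<theta> - \<theta>s)"
          using \<xi>(3) elim by (simp add: algebra_simps numeral_2_eq_2)
        also have "\<bar>\<dots>\<bar> \<le> (m x * \<bar>\<theta> - \<theta>s\<bar>) * \<bar>\<theta> - \<theta>s\<bar>"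
          unfolding abs_mult
        proof (rule mult_right_mono)
          have "\<bar>dloglik S p 2 x \<xi> - dloglik S p 2 x \<theta>s\<bar> \<le> m x * \<bar>\<xi> - \<theta>s\<bar>" using elim \<xi> by blast
          also have "\<dots> \<le> m x * \<bar>\<theta> - \<theta>s\<bar>" using elim \<xi> by (intro mult_left_mono) auto
          finally show "\<bar>dloglik S p 2 x \<xi> - dloglik S p 2 x \<theta>s\<bar> \<le> m x * \<bar>\<theta> - \<theta>s\<bar>" .
        qed simp
        finally show ?thesis by (simp add: power2_eq_square)
      qed
      ultimately show ?case using elim by blast
    qed
  qed
  then show ?thesis by blast
qed

text \<open>A finite log-likelihood makes the densities positive almost everywhere, so the laws over
  the interval are mutually absolutely continuous. The ratio is their Radon-Nikodym derivative,
  which does not depend on the dominating measure.\<close>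

lemma ratio_density:
  assumes \<theta>: "\<theta> \<in> S"
  shows "P \<theta> = density Q (\<lambda>x. ennreal (p \<theta> x / p \<theta>s x))"
proof -
  note [measurable] = p_meas[OF S_sub[OF \<theta>]] p_meas[OF \<theta>s_mem(2)]
  have "density Q (\<lambda>x. ennreal (p \<theta> x / p \<theta>s x)) = density \<mu> (\<lambda>x. ennreal (p \<theta>s x) * ennreal (p \<theta> x / p \<theta>s x))"
    unfolding density[OF \<theta>s_mem(2)] by (rule density_density_eq) measurable
  also have "\<dots> = density \<mu> (\<lambda>x. ennreal (p \<theta> x))"
  proof (rule density_cong)
    show "AE x in \<mu>. ennreal (p \<theta>s x) * ennreal (p \<theta> x / p \<theta>s x) = ennreal (p \<theta> x)"
      using AE_good(1)
    proof eventually_elim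
      case (elim x)
      then show ?case using good_pos[OF elim \<theta>s_mem(1)] good_pos[OF elim \<theta>] by (simp flip: ennreal_mult)
    qed
  qed measurable
  finally show ?thesis using density[OF S_sub[OF \<theta>]] by simp
qed

lemma ratio_measurable: "\<theta> \<in> S \<Longrightarrow> (\<lambda>x. p \<theta> x / p \<theta>s x) \<in> borel_measurable Q"
  using p_measurable[OF S_sub] p_measurable[OF \<theta>s_mem(2)] measurable_cong_sets[OF sets_P[OF \<theta>s_mem(2)] refl]
  by (intro borel_measurable_divide) auto

text \<open>Gibbs' inequality: ln R \<le> R - 1 with equality only for R = 1, and \<open>R\<close>
  has mean 1. A nonnegative integral would force R = 1 almost surely, that is, equal laws.\<close>

lemma kullback_leibler_neg:
  assumes \<theta>: "\<theta> \<in> S" and ne: "P \<theta> \<noteq> Q" and int: "integrable Q (\<lambda>x. ll \<theta> x - ll \<theta>s x)"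
  shows "(\<integral>x. ll \<theta> x - ll \<theta>s x \<partial>Q) < 0"
proof (rule ccontr)
  assume n: "\<not> ?thesis"
  interpret Q: prob_space Q by (rule prob_Q)
  interpret P\<theta>: prob_space "P \<theta>" by (rule prob[OF S_sub[OF \<theta>]])
  define R where "R x = p \<theta> x / p \<theta>s x" for x
  have [measurable]: "R \<in> borel_measurable Q" unfolding R_def by (rule ratio_measurable[OF \<theta>])
  have dens: "P \<theta> = density Q (\<lambda>x. ennreal (R x))" using ratio_density[OF \<theta>] by (simp add: R_def)
  have R0: "0 \<le> R x" for x using p_nonneg[OF S_sub[OF \<theta>]] p_nonneg[OF \<theta>s_mem(2)] by (simp add: R_def)
  have "(\<integral>\<^sup>+x. ennreal (R x) \<partial>Q) = emeasure (P \<theta>) (space (P \<theta>))"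
    unfolding dens by (subst emeasure_density) (auto intro!: nn_integral_cong simp: indicator_def)
  then have nn: "(\<integral>\<^sup>+x. ennreal (R x) \<partial>Q) = 1" using P\<theta>.emeasure_space_1 by simp
  have Rint: "integrable Q R" by (rule integrableI_nn_integral_finite[where x=1]) (use nn R0 in auto)
  have ER: "integral\<^sup>L Q R = 1" using nn R0 by (subst integral_eq_nn_integral) auto
  have le: "AE x in Q. 0 \<le> R x - 1 - (ll \<theta> x - ll \<theta>s x) \<and> (R x - 1 - (ll \<theta> x - ll \<theta>s x) = 0 \<longrightarrow> R x = 1)"
    using AE_good(2)
  proof eventually_elim
    case (elim x)
    note pos = good_pos[OF elim \<theta>] good_pos[OF elim \<theta>s_mem(1)]
    have R: "0 < R x" "ll \<theta> x - ll \<theta>s x = ln (R x)" using pos good_ll[OF elim] \<theta> \<theta>s_mem by (auto simp: R_def ln_div)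
    show ?case unfolding R(2) using ln_le_minus_one[OF R(1)] ln_eq_minus_one[OF R(1)] by auto
  qed
  have int': "integrable Q (\<lambda>x. R x - 1 - (ll \<theta> x - ll \<theta>s x))"
    by (rule Bochner_Integration.integrable_diff[OF _ int]) (use Rint in auto)
  have "integral\<^sup>L Q (\<lambda>x. R x - 1 - (ll \<theta> x - ll \<theta>s x)) = (integral\<^sup>L Q (\<lambda>x. R x - 1)) - (\<integral>x. ll \<theta> x - ll \<theta>s x \<partial>Q)"
    by (rule Bochner_Integration.integral_diff[OF _ int]) (use Rint in auto)
  also have "integral\<^sup>L Q (\<lambda>x. R x - 1) = 0" using Rint ER by (simp add: Q.prob_space)
  finally have "integral\<^sup>L Q (\<lambda>x. R x - 1 - (ll \<theta> x - ll \<theta>s x)) \<le> 0" using n by simp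
  moreover have "0 \<le> integral\<^sup>L Q (\<lambda>x. R x - 1 - (ll \<theta> x - ll \<theta>s x))"
    using le by (intro integral_nonneg_AE) (auto elim: eventually_mono)
  ultimately have "integral\<^sup>L Q (\<lambda>x. R x - 1 - (ll \<theta> x - ll \<theta>s x)) = 0" by simp
  then have "AE x in Q. R x - 1 - (ll \<theta> x - ll \<theta>s x) = 0"
    using integral_nonneg_eq_0_iff_AE[OF int'] le by (auto elim: eventually_mono)
  then have "AE x in Q. R x = 1" using le by eventually_elim auto
  then have "density Q (\<lambda>x. ennreal (R x)) = density Q (\<lambda>x. 1)"
    by (intro density_cong) (auto elim: eventually_mono)
  then show False using ne dens by (simp add: density_1)
qed

end

text \<open>
  This is why a constant found for one choice of dominating measure and densities serves for all.
\<close>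
lemma loglik_increments_unique:
  assumes 1: "regular_family \<Theta>1 \<mu>1 P1 p1 \<theta>s \<delta>" and 2: "regular_family \<Theta>2 \<mu>2 P2 p2 \<theta>s \<delta>"
    and eq: "\<And>\<theta>. \<theta> \<in> {\<theta>s - \<delta>..\<theta>s + \<delta>} \<Longrightarrow> P1 \<theta> = P2 \<theta>"
  shows "AE x in P1 \<theta>s. \<forall>\<theta>\<in>{\<theta>s - \<delta>..\<theta>s + \<delta>}.
    real_of_ereal (loglik p1 x \<theta>) - real_of_ereal (loglik p1 x \<theta>s) = real_of_ereal (loglik p2 x \<theta>) - real_of_ereal (loglik p2 x \<theta>s)"
proof -
  interpret R1: regular_family \<Theta>1 \<mu>1 P1 p1 \<theta>s \<delta> by fact
  interpret R2: regular_family \<Theta>2 \<mu>2 P2 p2 \<theta>s \<delta> by fact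
  let ?S = "{\<theta>s - \<delta>..\<theta>s + \<delta>}"
  have Q: "P2 \<theta>s = P1 \<theta>s" using eq R1.\<theta>s_mem by simp
  interpret Q: prob_space "P1 \<theta>s" by (rule R1.prob_Q)
  have pt: "AE x in P1 \<theta>s. R1.ll \<theta> x - R1.ll \<theta>s x = R2.ll \<theta> x - R2.ll \<theta>s x" if \<theta>: "\<theta> \<in> ?S" for \<theta>
  proof -
    have "AE x in P1 \<theta>s. ennreal (p1 \<theta> x / p1 \<theta>s x) = ennreal (p2 \<theta> x / p2 \<theta>s x)"
      using R1.ratio_density[OF \<theta>] R2.ratio_density[OF \<theta>] R1.ratio_measurable[OF \<theta>] R2.ratio_measurable[OF \<theta>] eq[OF \<theta>]
      unfolding Q by (intro Q.density_unique) auto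
    then show ?thesis using R1.AE_good(2) R2.AE_good(2)[unfolded Q]
    proof eventually_elim
      case (elim x)
      note pos = R1.good_pos[OF elim(2) \<theta>] R1.good_pos[OF elim(2) R1.\<theta>s_mem(1)]
        R2.good_pos[OF elim(3) \<theta>] R2.good_pos[OF elim(3) R1.\<theta>s_mem(1)]
      have "p1 \<theta> x / p1 \<theta>s x = p2 \<theta> x / p2 \<theta>s x" using elim(1) pos by (subst (asm) ennreal_inj) auto
      then have "ln (p1 \<theta> x / p1 \<theta>s x) = ln (p2 \<theta> x / p2 \<theta>s x)" by simp
      then show ?case using pos R1.good_ll[OF elim(2)] R2.good_ll[OF elim(3)] \<theta> R1.\<theta>s_mem by (simp add: ln_div)
    qed
  qed
  \<comment> \<open>Uniqueness of densities gives one null set per parameter. A countable dense set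
    and continuity in the parameter yield a common one.\<close>
  obtain T where T: "countable T" "T \<subseteq> ?S" "?S \<subseteq> closure T" using separable by blast
  have cl: "closure T = ?S" using T by (intro subset_antisym closure_minimal) auto
  have "AE x in P1 \<theta>s. \<forall>\<theta>\<in>T. R1.ll \<theta> x - R1.ll \<theta>s x = R2.ll \<theta> x - R2.ll \<theta>s x"
    using T pt by (subst AE_ball_countable) auto
  then have "AE x in P1 \<theta>s. \<forall>\<theta>\<in>?S. R1.ll \<theta> x - R1.ll \<theta>s x = R2.ll \<theta> x - R2.ll \<theta>s x"
    using R1.AE_good(2) R2.AE_good(2)[unfolded Q]
  proof eventually_elim
    case (elim x)
    show ?case
    proof
      fix \<theta> assume \<theta>: "\<theta> \<in> ?S"
      have "continuous_on (closure T) (\<lambda>\<theta>. (R1.ll \<theta> x - R1.ll \<theta>s x) - (R2.ll \<theta> x - R2.ll \<theta>s x))"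
        unfolding cl by (intro continuous_intros R1.good_continuous R2.good_continuous elim)
      then have "(R1.ll \<theta> x - R1.ll \<theta>s x) - (R2.ll \<theta> x - R2.ll \<theta>s x) = 0"
        by (rule continuous_constant_on_closure) (use elim(1) \<theta> cl in auto)
      then show "R1.ll \<theta> x - R1.ll \<theta>s x = R2.ll \<theta> x - R2.ll \<theta>s x" by simp
    qed
  qed
  then show ?thesis by (simp add: R1.ll_def R2.ll_def)
qed

text \<open>Two log-likelihoods with equal increments differ by a term free of the parameter, so
  their derivatives at the interior point \<open>\<theta>s\<close> agree almost surely.\<close>

lemma fisher_info_unique:
  assumes 1: "regular_family \<Theta>1 \<mu>1 P1 p1 \<theta>s \<delta>" and 2: "regular_family \<Theta>2 \<mu>2 P2 p2 \<theta>s \<delta>"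
    and eq: "\<And>\<theta>. \<theta> \<in> {\<theta>s - \<delta>..\<theta>s + \<delta>} \<Longrightarrow> P1 \<theta> = P2 \<theta>"
  shows "fisher_info {\<theta>s - \<delta>..\<theta>s + \<delta>} P1 p1 \<theta>s = fisher_info {\<theta>s - \<delta>..\<theta>s + \<delta>} P2 p2 \<theta>s"
proof -
  interpret R1: regular_family \<Theta>1 \<mu>1 P1 p1 \<theta>s \<delta> by fact
  interpret R2: regular_family \<Theta>2 \<mu>2 P2 p2 \<theta>s \<delta> by fact
  let ?S = "{\<theta>s - \<delta>..\<theta>s + \<delta>}"
  have Q: "P2 \<theta>s = P1 \<theta>s" using eq R1.\<theta>s_mem by simp
  have inc: "AE x in P1 \<theta>s. \<forall>\<theta>\<in>?S.
    real_of_ereal (loglik p1 x \<theta>) - real_of_ereal (loglik p1 x \<theta>s) = real_of_ereal (loglik p2 x \<theta>) - real_of_ereal (loglik p2 x \<theta>s)"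
    by (rule loglik_increments_unique[OF 1 2 eq])
  have ae: "AE x in P1 \<theta>s. dloglik ?S p1 1 x \<theta>s = dloglik ?S p2 1 x \<theta>s"
    using inc R1.AE_good(2) R2.AE_good(2)[unfolded Q]
  proof eventually_elim
    case (elim x)
    have d1: "((\<lambda>\<theta>. R1.ll \<theta> x) has_real_derivative dloglik ?S p1 1 x \<theta>s) (at \<theta>s within ?S)"
      using R1.good_deriv[OF elim(2), of 0 \<theta>s] R1.\<theta>s_mem by (simp add: R1.dloglik_0)
    have d2: "((\<lambda>\<theta>. R2.ll \<theta> x) has_real_derivative dloglik ?S p2 1 x \<theta>s) (at \<theta>s within ?S)"
      using R2.good_deriv[OF elim(3), of 0 \<theta>s] R1.\<theta>s_mem by (simp add: R2.dloglik_0)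
    have "((\<lambda>\<theta>. R2.ll \<theta> x + (R1.ll \<theta>s x - R2.ll \<theta>s x)) has_real_derivative dloglik ?S p2 1 x \<theta>s) (at \<theta>s within ?S)"
      using DERIV_add[OF d2 DERIV_const] by simp
    then have "((\<lambda>\<theta>. R1.ll \<theta> x) has_real_derivative dloglik ?S p2 1 x \<theta>s) (at \<theta>s within ?S)"
      by (rule has_field_derivative_transform_within[where d=1])
        (use elim(1) R1.\<theta>s_mem in \<open>auto simp: R1.ll_def R2.ll_def algebra_simps\<close>)
    moreover have "at \<theta>s within ?S = at \<theta>s"
      by (rule at_within_interior) (use R1.\<delta>_pos in simp)
    ultimately show ?case using d1 by (metis DERIV_unique)
  qed
  then show ?thesis
    using R1.score_sq_integrable R2.score_sq_integrable unfolding fisher_info_def Q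
    by (intro integral_cong_AE AE_completion) (auto elim: eventually_mono)
qed

context regular_family
begin

lemma ex_score_model:
  assumes "\<forall>\<theta>\<in>{\<theta>s - \<delta>..\<theta>s + \<delta>}. P \<theta> = P \<theta>s \<longrightarrow> \<theta> = \<theta>s"
  shows "\<exists>Z U m. score_model (P \<theta>s) \<theta>s \<delta> (fisher_info {\<theta>s - \<delta>..\<theta>s + \<delta>} P p \<theta>s) ll
    (\<lambda>\<theta> x. dloglik {\<theta>s - \<delta>..\<theta>s + \<delta>} p 1 x \<theta>) Z U m"
proof -
  obtain Z U m where e: "score_expansion (P \<theta>s) \<theta>s \<delta> (fisher_info {\<theta>s - \<delta>..\<theta>s + \<delta>} P p \<theta>s) ll
    (\<lambda>\<theta> x. dloglik {\<theta>s - \<delta>..\<theta>s + \<delta>} p 1 x \<theta>) Z U m"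
    using ex_score_expansion by blast
  then interpret E: score_expansion "P \<theta>s" \<theta>s \<delta> "fisher_info {\<theta>s - \<delta>..\<theta>s + \<delta>} P p \<theta>s" ll
    "\<lambda>\<theta> x. dloglik {\<theta>s - \<delta>..\<theta>s + \<delta>} p 1 x \<theta>" Z U m .
  have "score_model (P \<theta>s) \<theta>s \<delta> (fisher_info {\<theta>s - \<delta>..\<theta>s + \<delta>} P p \<theta>s) ll
    (\<lambda>\<theta> x. dloglik {\<theta>s - \<delta>..\<theta>s + \<delta>} p 1 x \<theta>) Z U m"
    by unfold_locales (use assms kullback_leibler_neg E.L_diff_integrable(1) in blast)
  then show ?thesis by blast
qed

text \<open>Almost surely all log-likelihoods of the sample are finite on the interval, so
  maximality among extended reals becomes maximality among reals. The estimator must lie in the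
  interval for its own value to be covered.\<close>

lemma mle_maximizes:
  assumes I: "finite I" and T: "is_mle \<Theta> p (P \<theta>s) I T"
  shows "AE x in Pi\<^sub>M I (\<lambda>_. P \<theta>s). \<bar>T x - \<theta>s\<bar> < \<delta> \<longrightarrow>
    (\<forall>\<theta>\<in>{\<theta>s - \<delta>..\<theta>s + \<delta>}. (\<Sum>i\<in>I. ll \<theta> (x i)) \<le> (\<Sum>i\<in>I. ll (T x) (x i)))"
proof -
  have "AE x in Pi\<^sub>M I (\<lambda>_. P \<theta>s). is_arg_max (\<lambda>\<theta>. \<Sum>i\<in>I. loglik p (x i) \<theta>) (\<lambda>\<theta>. \<theta> \<in> \<Theta>) (T x)"
    using T by (simp add: is_mle_def)
  with AE_PiM_all[OF prob_Q I AE_good(2)] show ?thesis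
  proof eventually_elim
    case (elim x)
    show ?case
    proof (intro impI ballI)
      fix \<theta> assume T: "\<bar>T x - \<theta>s\<bar> < \<delta>" and \<theta>: "\<theta> \<in> {\<theta>s - \<delta>..\<theta>s + \<delta>}"
      have TS: "T x \<in> {\<theta>s - \<delta>..\<theta>s + \<delta>}" using T by auto
      have eq: "(\<Sum>i\<in>I. loglik p (x i) \<theta>') = ereal (\<Sum>i\<in>I. ll \<theta>' (x i))" if "\<theta>' \<in> {\<theta>s - \<delta>..\<theta>s + \<delta>}" for \<theta>'
        using elim(1) that by (subst sum_ereal[symmetric]) (auto intro!: sum.cong simp: good_loglik)
      have "\<not> (\<Sum>i\<in>I. loglik p (x i) (T x)) < (\<Sum>i\<in>I. loglik p (x i) \<theta>)"
        using elim(2) S_sub[OF \<theta>] by (auto simp: is_arg_max_def)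
      then show "(\<Sum>i\<in>I. ll \<theta> (x i)) \<le> (\<Sum>i\<in>I. ll (T x) (x i))"
        unfolding eq[OF \<theta>] eq[OF TS] by simp
    qed
  qed
qed

end

text \<open>The constant has to be fixed before the presentation is known. It is computed from any
  one admissible presentation, and is arbitrary if there is none. Equal increments make a maximizer
  for one presentation a maximizer on the interval for the other.\<close>

lemma ex_uniform_tail_constant:
  fixes P0 :: "real \<Rightarrow> (real^'d) measure" and \<theta>s \<delta> :: real
  shows "\<exists>C>0. \<forall>\<Theta> \<mu> P p. regular_family \<Theta> \<mu> P p \<theta>s \<delta> \<and>
    (\<forall>\<theta>\<in>{\<theta>s - \<delta>..\<theta>s + \<delta>}. P \<theta> = P0 \<theta>) \<and>
    (\<forall>\<theta>\<in>{\<theta>s - \<delta>..\<theta>s + \<delta>}. P \<theta> = P \<theta>s \<longrightarrow> \<theta> = \<theta>s) \<longrightarrow>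
    (\<forall>(I::nat set) (n::nat) u T. finite I \<and> 1 \<le> n \<and> n \<le> card I \<and> 0 < u \<and> u \<le> 0.33 \<and> C / sqrt n \<le> 0.33 \<and>
      is_mle \<Theta> p (P \<theta>s) I T \<longrightarrow>
      \<P>(x in Pi\<^sub>M I (\<lambda>_. P \<theta>s). T x > \<theta>s + 3 * u / sqrt (n * fisher_info {\<theta>s - \<delta>..\<theta>s + \<delta>} P p \<theta>s))
        \<le> 1 / 2 - u + C / sqrt n + \<P>(x in Pi\<^sub>M I (\<lambda>_. P \<theta>s). \<delta> \<le> \<bar>T x - \<theta>s\<bar>) \<and>
      \<P>(x in Pi\<^sub>M I (\<lambda>_. P \<theta>s). T x < \<theta>s - 3 * u / sqrt (n * fisher_info {\<theta>s - \<delta>..\<theta>s + \<delta>} P p \<theta>s))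
        \<le> 1 / 2 - u + C / sqrt n + \<P>(x in Pi\<^sub>M I (\<lambda>_. P \<theta>s). \<delta> \<le> \<bar>T x - \<theta>s\<bar>))"
  (is "\<exists>C>0. \<forall>\<Theta> \<mu> P p. ?adm \<Theta> \<mu> P p \<longrightarrow> ?tail C \<Theta> P p")
proof (cases "\<exists>\<Theta> \<mu> P p. ?adm \<Theta> \<mu> P p")
  case True
  then obtain \<Theta>1 \<mu>1 P1 p1 where adm1: "?adm \<Theta>1 \<mu>1 P1 p1" by blast
  then interpret R1: regular_family \<Theta>1 \<mu>1 P1 p1 \<theta>s \<delta> by blast
  let ?S = "{\<theta>s - \<delta>..\<theta>s + \<delta>}"
  obtain Z U m where "score_model (P1 \<theta>s) \<theta>s \<delta> (fisher_info ?S P1 p1 \<theta>s) R1.ll (\<lambda>\<theta> x. dloglik ?S p1 1 x \<theta>) Z U m"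
    using R1.ex_score_model adm1 by blast
  then interpret M: score_model "P1 \<theta>s" \<theta>s \<delta> "fisher_info ?S P1 p1 \<theta>s" R1.ll "\<lambda>\<theta> x. dloglik ?S p1 1 x \<theta>" Z U m .
  obtain C where C: "C > 0" and tail: "\<forall>(I::nat set) (n::nat) u T. finite I \<and> 1 \<le> n \<and> n \<le> card I \<and> 0 < u \<and> u \<le> 0.33 \<and> C / sqrt n \<le> 0.33 \<and>
     T \<in> borel_measurable (Pi\<^sub>M I (\<lambda>_. P1 \<theta>s)) \<and>
     (AE x in Pi\<^sub>M I (\<lambda>_. P1 \<theta>s). \<bar>T x - \<theta>s\<bar> < \<delta> \<longrightarrow> (\<forall>\<theta>\<in>?S. (\<Sum>i\<in>I. R1.ll \<theta> (x i)) \<le> (\<Sum>i\<in>I. R1.ll (T x) (x i)))) \<longrightarrow>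
     \<P>(x in Pi\<^sub>M I (\<lambda>_. P1 \<theta>s). T x > \<theta>s + 3 * u / sqrt (n * fisher_info ?S P1 p1 \<theta>s))
       \<le> 1 / 2 - u + C / sqrt n + \<P>(x in Pi\<^sub>M I (\<lambda>_. P1 \<theta>s). \<delta> \<le> \<bar>T x - \<theta>s\<bar>) \<and>
     \<P>(x in Pi\<^sub>M I (\<lambda>_. P1 \<theta>s). T x < \<theta>s - 3 * u / sqrt (n * fisher_info ?S P1 p1 \<theta>s))
       \<le> 1 / 2 - u + C / sqrt n + \<P>(x in Pi\<^sub>M I (\<lambda>_. P1 \<theta>s). \<delta> \<le> \<bar>T x - \<theta>s\<bar>)"
    using M.two_sided_tail by blast
  have "?tail C \<Theta> P p" if adm: "?adm \<Theta> \<mu> P p" for \<Theta> \<mu> P p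
  proof -
    interpret R: regular_family \<Theta> \<mu> P p \<theta>s \<delta> using adm by blast
    have eq: "P \<theta> = P1 \<theta>" if "\<theta> \<in> ?S" for \<theta> using adm adm1 that by simp
    have Q: "P \<theta>s = P1 \<theta>s" by (rule eq[OF R.\<theta>s_mem(1)])
    have F: "fisher_info ?S P p \<theta>s = fisher_info ?S P1 p1 \<theta>s"
      by (rule fisher_info_unique[OF R.regular_family_axioms R1.regular_family_axioms eq])
    have inc: "AE x in P1 \<theta>s. \<forall>\<theta>\<in>?S. R.ll \<theta> x - R.ll \<theta>s x = R1.ll \<theta> x - R1.ll \<theta>s x"
      using loglik_increments_unique[OF R.regular_family_axioms R1.regular_family_axioms eq, unfolded Q]
      by (simp add: R.ll_def R1.ll_def)
    show ?thesis
      unfolding F Q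
    proof (intro allI impI, elim conjE, rule tail[rule_format], intro conjI)
      fix I :: "nat set" and n :: nat and u :: real and T
      assume I: "finite I" and T: "is_mle \<Theta> p (P1 \<theta>s) I T"
      have "sets (Pi\<^sub>M I (\<lambda>_. P1 \<theta>s)) = sets (Pi\<^sub>M I (\<lambda>_. borel))"
        using R1.sets_P[OF R1.\<theta>s_mem(2)] by (intro sets_PiM_cong) auto
      then show "T \<in> borel_measurable (Pi\<^sub>M I (\<lambda>_. P1 \<theta>s))"
        using T by (simp add: is_mle_def cong: measurable_cong_sets)
      show "AE x in Pi\<^sub>M I (\<lambda>_. P1 \<theta>s). \<bar>T x - \<theta>s\<bar> < \<delta> \<longrightarrow> (\<forall>\<theta>\<in>?S. (\<Sum>i\<in>I. R1.ll \<theta> (x i)) \<le> (\<Sum>i\<in>I. R1.ll (T x) (x i)))"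
        using R.mle_maximizes[OF I T[folded Q], unfolded Q] AE_PiM_all[OF R1.prob_Q I inc]
      proof eventually_elim
        case (elim x)
        show ?case
        proof (intro impI ballI)
          fix \<theta> assume T: "\<bar>T x - \<theta>s\<bar> < \<delta>" and \<theta>: "\<theta> \<in> ?S"
          have TS: "T x \<in> ?S" using T by auto
          \<comment> \<open>The two log-likelihood sums differ by a term free of the parameter, so
            they have the same maximizers.\<close>
          have s: "(\<Sum>i\<in>I. R1.ll \<theta>' (x i)) = (\<Sum>i\<in>I. R.ll \<theta>' (x i)) + (\<Sum>i\<in>I. R1.ll \<theta>s (x i) - R.ll \<theta>s (x i))" if "\<theta>' \<in> ?S" for \<theta>'
            unfolding sum.distrib[symmetric] using elim(2) that by (intro sum.cong refl) (force simp: algebra_simps)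
          show "(\<Sum>i\<in>I. R1.ll \<theta> (x i)) \<le> (\<Sum>i\<in>I. R1.ll (T x) (x i))"
            unfolding s[OF \<theta>] s[OF TS] using elim(1) T \<theta> by auto
        qed
      qed
    qed assumption+
  qed
  then show ?thesis using C by blast
next
  case False
  then have "\<And>\<Theta> \<mu> P p. \<not> ?adm \<Theta> \<mu> P p" by blast
  then show ?thesis by (intro exI[of _ 1] conjI zero_less_one allI impI; blast)
qed

text \<open>Choosing \<open>C\<close> right after \<open>P0\<close>, \<open>\<theta>s\<close> and
  \<open>\<delta>\<close> expresses that it depends only on the laws over the interval. The clause
  on \<open>set_pmf\<close> in the final event holds almost surely and confines the event to
  countably many partitions, which keeps it measurable.\<close>

theorem corollary3:
  fixes P0 :: "real \<Rightarrow> (real^'d) measure" and \<theta>s \<delta> :: real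
  shows "\<exists>C>0. \<forall>\<Theta> \<mu> P p.
    regular_family \<Theta> \<mu> P p \<theta>s \<delta> \<and>
    (\<forall>\<theta>\<in>{\<theta>s - \<delta>..\<theta>s + \<delta>}. P \<theta> = P0 \<theta>) \<and>
    (\<forall>\<theta>\<in>{\<theta>s - \<delta>..\<theta>s + \<delta>}. P \<theta> = P \<theta>s \<longrightarrow> \<theta> = \<theta>s) \<longrightarrow>
    (\<forall>(c::real) (\<gamma>::real) mle.
      c > 0 \<and> 0 \<le> \<gamma> \<and> \<gamma> < 1 \<and>
      (\<forall>I. finite I \<and> I \<noteq> {} \<longrightarrow>
        is_mle \<Theta> p (P \<theta>s) I (mle I) \<and>
        \<P>(x in Pi\<^sub>M I (\<lambda>_. P \<theta>s). \<bar>mle I x - \<theta>s\<bar> \<ge> \<delta>) \<le> c * \<gamma> ^ card I) \<longrightarrow>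
      (\<forall>(N::nat) (k::nat) (n::nat) \<rho> (s::real).
        1 \<le> k \<and> k \<le> N \<and> n = N div k \<and>
        (\<forall>G\<in>set_pmf \<rho>. sample_partition N k G) \<and>
        s > 0 \<and> C / sqrt n + c * \<gamma> ^ n + sqrt (s / k) \<le> 0.33 \<longrightarrow>
        \<P>(\<omega> in sample_space N (P \<theta>s) \<rho>. snd \<omega> \<in> set_pmf \<rho> \<and>
            \<bar>median_mle mle k (snd \<omega>) (fst \<omega>) - \<theta>s\<bar>
              \<le> 3 / sqrt (fisher_info {\<theta>s - \<delta>..\<theta>s + \<delta>} P p \<theta>s)
                  * (C / n + c / sqrt n * \<gamma> ^ n + sqrt (s / (k * n))))
          \<ge> 1 - 4 * exp (- 2 * s)))"
proof -
  let ?S = "{\<theta>s - \<delta>..\<theta>s + \<delta>}"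
  let ?adm = "\<lambda>\<Theta> \<mu> P p. regular_family \<Theta> \<mu> P p \<theta>s \<delta> \<and> (\<forall>\<theta>\<in>?S. P \<theta> = P0 \<theta>) \<and> (\<forall>\<theta>\<in>?S. P \<theta> = P \<theta>s \<longrightarrow> \<theta> = \<theta>s)"
  obtain C where C: "C > 0" and tail: "\<forall>\<Theta> \<mu> P p. ?adm \<Theta> \<mu> P p \<longrightarrow>
    (\<forall>(I::nat set) (n::nat) u T. finite I \<and> 1 \<le> n \<and> n \<le> card I \<and> 0 < u \<and> u \<le> 0.33 \<and> C / sqrt n \<le> 0.33 \<and>
      is_mle \<Theta> p (P \<theta>s) I T \<longrightarrow>
      \<P>(x in Pi\<^sub>M I (\<lambda>_. P \<theta>s). T x > \<theta>s + 3 * u / sqrt (n * fisher_info ?S P p \<theta>s))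
        \<le> 1 / 2 - u + C / sqrt n + \<P>(x in Pi\<^sub>M I (\<lambda>_. P \<theta>s). \<delta> \<le> \<bar>T x - \<theta>s\<bar>) \<and>
      \<P>(x in Pi\<^sub>M I (\<lambda>_. P \<theta>s). T x < \<theta>s - 3 * u / sqrt (n * fisher_info ?S P p \<theta>s))
        \<le> 1 / 2 - u + C / sqrt n + \<P>(x in Pi\<^sub>M I (\<lambda>_. P \<theta>s). \<delta> \<le> \<bar>T x - \<theta>s\<bar>))"
    using ex_uniform_tail_constant[of \<theta>s \<delta> P0] by blast
  have main: "\<P>(\<omega> in sample_space N (P \<theta>s) \<rho>. snd \<omega> \<in> set_pmf \<rho> \<and>
            \<bar>median_mle mle k (snd \<omega>) (fst \<omega>) - \<theta>s\<bar>
              \<le> 3 / sqrt (fisher_info ?S P p \<theta>s) * (C / n + c / sqrt n * \<gamma> ^ n + sqrt (s / (k * n))))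
          \<ge> 1 - 4 * exp (- 2 * s)"
    if adm: "?adm \<Theta> \<mu> P p" and c: "c > 0" and \<gamma>: "0 \<le> \<gamma>" "\<gamma> < 1"
      and mle: "\<And>I. finite I \<Longrightarrow> I \<noteq> {} \<Longrightarrow> is_mle \<Theta> p (P \<theta>s) I (mle I) \<and>
        \<P>(x in Pi\<^sub>M I (\<lambda>_. P \<theta>s). \<bar>mle I x - \<theta>s\<bar> \<ge> \<delta>) \<le> c * \<gamma> ^ card I"
      and k: "1 \<le> k" "k \<le> N" and n: "n = N div k" and G: "\<forall>G\<in>set_pmf \<rho>. sample_partition N k G"
      and s: "s > 0" and small: "C / sqrt n + c * \<gamma> ^ n + sqrt (s / k) \<le> 0.33"
    for \<Theta> \<mu> P p and c \<gamma> :: real and mle and N k n :: nat and \<rho> and s :: real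
  proof -
    interpret regular_family \<Theta> \<mu> P p \<theta>s \<delta> using adm by blast
    define F where "F = fisher_info ?S P p \<theta>s"
    have F: "F > 0" using fisher_info_pos by (simp add: F_def)
    define Q where "Q = P \<theta>s"
    have Q: "prob_space Q" using prob_Q by (simp add: Q_def)
    have n1: "1 \<le> n" using k by (simp add: n Suc_le_eq div_greater_zero_iff)
    \<comment> \<open>The left side of the smallness condition. A one-sided tail bound 1/2 - u +
      C/sqrt n + c \<gamma>^n then collapses to 1/2 - sqrt(s/k), and 3 u / sqrt(n F) is exactly the
      claimed radius.\<close>
    define u where "u = C / sqrt n + c * \<gamma> ^ n + sqrt (s / k)"
    have nn: "0 \<le> C / sqrt n" "0 \<le> c * \<gamma> ^ n" "0 < sqrt (s / k)" using C c \<gamma> s k by auto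
    have u: "0 < u" "u \<le> 0.33" "C / sqrt n \<le> 0.33" using nn small unfolding u_def by linarith+
    define t where "t = 3 * u / sqrt (n * F)"
    have t_eq: "3 / sqrt F * (C / n + c / sqrt n * \<gamma> ^ n + sqrt (s / (k * n))) = t"
    proof -
      have "C / n = C / sqrt n / sqrt n" by simp
      moreover have "sqrt (s / (k * n)) = sqrt (s / k) / sqrt n" by (simp add: real_sqrt_divide real_sqrt_mult)
      ultimately have "C / n + c / sqrt n * \<gamma> ^ n + sqrt (s / (k * n)) = u / sqrt n"
        by (simp add: u_def add_divide_distrib)
      then show ?thesis by (simp add: t_def real_sqrt_mult)
    qed
    define v where "v = sqrt (s / k)"
    have kv: "k * v\<^sup>2 = s" using s k by (simp add: v_def)
    let ?PN = "Pi\<^sub>M {..<N} (\<lambda>_. Q)"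
    interpret PN: prob_space ?PN by (intro prob_space_PiM Q)
    have conc: "{x\<in>space ?PN. \<bar>median_mle mle k G x - \<theta>s\<bar> \<le> t} \<in> sets ?PN \<and>
       1 - 2 * exp (- 2 * s) \<le> \<P>(x in ?PN. \<bar>median_mle mle k G x - \<theta>s\<bar> \<le> t)" if GG: "sample_partition N k G" for G
    proof -
      have part: "disjoint_family_on G {..<k}" "(\<Union>j<k. G j) = {..<N}" "\<And>j. j < k \<Longrightarrow> n \<le> card (G j)"
        using GG by (auto simp: sample_partition_def n)
      have Gj: "finite (G j)" "G j \<noteq> {}" "G j \<subseteq> {..<N}" if "j < k" for j
      proof -
        show "G j \<subseteq> {..<N}" using part(2) that by blast
        then show "finite (G j)" by (rule finite_subset) simp
        show "G j \<noteq> {}" using part(3)[OF that] n1 by auto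
      qed
      define T where "T j x = mle (G j) (restrict x (G j))" for j x
      have mleG: "is_mle \<Theta> p Q (G j) (mle (G j))" if "j < k" for j
        using mle[OF Gj(1,2)[OF that]] by (simp add: Q_def)
      have mle_meas: "mle (G j) \<in> borel_measurable (Pi\<^sub>M (G j) (\<lambda>_. Q))" if "j < k" for j
      proof -
        have "sets (Pi\<^sub>M (G j) (\<lambda>_. Q)) = sets (Pi\<^sub>M (G j) (\<lambda>_. borel))"
          using sets_P[OF \<theta>s_mem(2)] by (intro sets_PiM_cong) (auto simp: Q_def)
        then show ?thesis using mleG[OF that] by (simp add: is_mle_def cong: measurable_cong_sets)
      qed
      have T_meas: "T j \<in> borel_measurable ?PN" if "j < k" for j
        unfolding T_def using Gj(3)[OF that]
        by (intro measurable_compose[OF measurable_restrict_subset mle_meas[OF that]])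
      have ind: "PN.indep_vars (\<lambda>_. borel) T {..<k}"
      proof -
        have "PN.indep_vars (\<lambda>_. Q) (\<lambda>i \<omega>. \<omega> i) {..<N}"
          using k by (intro indep_vars_PiM_coordinates Q) (auto simp: lessThan_empty_iff)
        then have i: "PN.indep_vars (\<lambda>j. Pi\<^sub>M (G j) (\<lambda>_. Q)) (\<lambda>j \<omega>. restrict (\<lambda>i. \<omega> i) (G j)) {..<k}"
          using Gj(3) part(1) by (intro PN.indep_vars_restrict) auto
        show ?thesis
          unfolding T_def
          by (rule PN.indep_vars_compose2[OF i, of "\<lambda>j. mle (G j)" "\<lambda>_. borel"]) (rule mle_meas, simp)
      qed
      have tl: "\<P>(x in ?PN. T j x > \<theta>s + t) \<le> 1 / 2 - v \<and> \<P>(x in ?PN. T j x < \<theta>s - t) \<le> 1 / 2 - v" if j: "j < k" for j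
      proof -
        let ?PG = "Pi\<^sub>M (G j) (\<lambda>_. Q)"
        note [measurable] = mle_meas[OF j]
        have "\<P>(x in ?PG. \<delta> \<le> \<bar>mle (G j) x - \<theta>s\<bar>) \<le> c * \<gamma> ^ card (G j)"
          using mle[OF Gj(1,2)[OF j]] by (simp add: Q_def)
        also have "\<dots> \<le> c * \<gamma> ^ n"
          using part(3)[OF j] \<gamma> c by (intro mult_left_mono power_decreasing) auto
        finally have d: "1 / 2 - u + C / sqrt n + \<P>(x in ?PG. \<delta> \<le> \<bar>mle (G j) x - \<theta>s\<bar>) \<le> 1 / 2 - v"
          by (simp add: u_def v_def)
        have "\<P>(x in ?PG. mle (G j) x > \<theta>s + t) \<le> 1 / 2 - u + C / sqrt n + \<P>(x in ?PG. \<delta> \<le> \<bar>mle (G j) x - \<theta>s\<bar>) \<and>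
              \<P>(x in ?PG. mle (G j) x < \<theta>s - t) \<le> 1 / 2 - u + C / sqrt n + \<P>(x in ?PG. \<delta> \<le> \<bar>mle (G j) x - \<theta>s\<bar>)"
          unfolding t_def F_def Q_def
          using adm Gj[OF j] part(3)[OF j] n1 u mleG[OF j]
          by (intro tail[rule_format, of \<Theta> \<mu> P p "G j" n u "mle (G j)"]) (auto simp: Q_def)
        moreover have "\<P>(x in ?PN. T j x > \<theta>s + t) = \<P>(x in ?PG. mle (G j) x > \<theta>s + t)"
          unfolding T_def by (intro prob_restrict_PiM[OF Q _ Gj(3)[OF j]]) measurable
        moreover have "\<P>(x in ?PN. T j x < \<theta>s - t) = \<P>(x in ?PG. mle (G j) x < \<theta>s - t)"
          unfolding T_def by (intro prob_restrict_PiM[OF Q _ Gj(3)[OF j]]) measurable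
        ultimately show ?thesis using d by linarith
      qed
      have med: "median_mle mle k G x = median (map (\<lambda>j. T j x) [0..<k])" for x
        by (simp add: median_mle_def T_def)
      have "(\<lambda>x. median (map (\<lambda>j. T j x) [0..<k])) \<in> borel_measurable ?PN"
        using T_meas k by (intro median_measurable) auto
      then have ev: "{x\<in>space ?PN. \<bar>median (map (\<lambda>j. T j x) [0..<k]) - \<theta>s\<bar> \<le> t} \<in> sets ?PN" by measurable
      have "1 - 2 * exp (- 2 * (k * v\<^sup>2)) \<le> \<P>(x in ?PN. \<bar>median (map (\<lambda>j. T j x) [0..<k]) - \<theta>s\<bar> \<le> t)"
        using tl k ev by (intro PN.median_concentration[OF ind]) (auto simp: v_def s less_imp_le)
      then show ?thesis using ev unfolding med kv by blast
    qed
    \<comment> \<open>The two-sided union bound gives the factor 2, which is weakened to the stated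
      4.\<close>
    have "1 - 4 * exp (- 2 * s) \<le> 1 - 2 * exp (- 2 * s)" by simp
    also have "\<dots> \<le> \<P>(\<omega> in ?PN \<Otimes>\<^sub>M measure_pmf \<rho>. snd \<omega> \<in> set_pmf \<rho> \<and> \<bar>median_mle mle k (snd \<omega>) (fst \<omega>) - \<theta>s\<bar> \<le> t)"
      using conc G by (intro prob_pair_pmf_ge PN.prob_space_axioms) auto
    finally show ?thesis unfolding sample_space_def F_def[symmetric] t_eq Q_def .
  qed
  show ?thesis
  proof (rule exI[of _ C], rule conjI[OF C], intro allI impI, goal_cases)
    case (1 \<Theta> \<mu> P p c \<gamma> mle N k n \<rho> s)
    show ?case
      by (rule main[where \<Theta>=\<Theta> and \<mu>=\<mu>]; (use 1 in blast)?)
  qed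
qed

end
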